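(* Let $m_0\in\mathcal{P}(\mathbb{R}^{2d})$ and let $(\psi,\phi)$ be $m_0$-admissible weights with associated weight $m$. Let $f_0$ be a minimizer of $$\mathfrak{F}^{\psi,\phi,m_0}[f]=\|\psi f\|^2_{L^2(\mathbb{R}^d)}+\|\phi\widehat f\|^2_{L^2(\mathbb{R}^d)}$$ in $M^2_m(\mathbb{R}^d)$ subject to the constraint $\|f\|_{M^2_{m_0}(\mathbb{R}^d)}=1$. Then $f_0$ is a solution of the eigenvalue equation $$Af_0=\frac1{\lambda+1}f_0,$$ where $\lambda=\mathfrak{F}^{\psi,\phi,m_0}[f_0]$, and $\frac1{\lambda+1}$ is the largest eigenvalue of the operator $A$.
   Context: A weight on $\mathbb{R}^n$ is a positive continuous function. A weight $m$ is $v$-moderate if $m(x+y)\le Cm(x)v(y)$ for all $x,y$ and some $C>0$. $\mathcal{P}(\mathbb{R}^n)$ is the set of weights that are $v$-moderate for some polynomial weight $v$. $L^\infty_0(\mathbb{R}^n)$ is the set of $h\in L^\infty(\mathbb{R}^n)$ with $\lim_{R\to\infty}\operatorname{ess\,sup}_{|z|\ge R}|h(z)|=0$. Given $m_0\in\mathcal{P}(\mathbb{R}^{2d})$, a pair of continuous functions $\psi,\phi\in L^\infty_{loc}(\mathbb{R}^d)$ is called $m_0$-admissible weights if $m(x,\omega)=\sqrt{|m_0(x,\omega)|^2+|\psi(x)|^2+|\phi(\omega)|^2}$ satisfies $m\in\mathcal{P}(\mathbb{R}^{2d})$ and $m_0/m\in L^\infty_0(\mathbb{R}^{2d})$. The Fourier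 transform is $\widehat f(\omega)=\int f(x)e^{-2\pi ix\cdot\omega}dx$. Fix $g\in\mathcal{S}(\mathbb{R}^d)\setminus\{0\}$ and let $V_gf(x,\omega)=\int_{\mathbb{R}^d}f(t)\overline{g(t-x)}e^{-2\pi it\cdot\omega}dt$ (extended to $\mathcal S'$ by duality). For $\mu\in\mathcal{P}(\mathbb{R}^{2d})$, $M^2_\mu(\mathbb{R}^d)$ is the space of $f\in\mathcal{S}'(\mathbb{R}^d)$ with $\|f\|_{M^2_\mu}=\left(\int_{\mathbb{R}^{2d}}|\mu(z)V_gf(z)|^2dz\right)^{1/2}<\infty$, with inner product $(u,v)_{M^2_\mu}=\int_{\mathbb{R}^{2d}}\mu(z)^2V_gu(z)\overline{V_gv(z)}dz$. The space $M^2_m(\mathbb{R}^d)$ is regarded as a Hilbert space with the inner product $$(u,v)_{\psi,\phi,m_0}=(u,v)_{M^2_{m_0}}+\int_{\mathbb{R}^d}|\psi(x)|^2u(x)\overline{v(x)}dx+\int_{\mathbb{R}^d}|\phi(\omega)|^2\widehat u(\omega)\overline{\widehat v(\omega)}d\omega,$$ whose norm $\|\cdot\|_{\psi,\phi,m_0}$ is equivalent to $\|\cdot\|_{M^2_m}$. The operator $A:M^2_m(\mathbb{R}^d)\to M^2_m(\mathbb{R}^d)$ is the bounded linear operator (given by the Riesz representation theorem) such that $(u,v)_{M^2_{m_0}}=(Au,v)_{\psi,\phi,m_0}$ for all $u,v\in M^2_m(\mathbb{R}^d)$. *)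

theory Defs
  imports "HOL-Probability.Essential_Supremum"
begin

section \<open>Weights\<close>

definition weight :: "('a::euclidean_space \<Rightarrow> real) \<Rightarrow> bool" where
  "weight m \<longleftrightarrow> continuous_on UNIV m \<and> (\<forall>z. 0 < m z)"

definition moderate :: "('a::euclidean_space \<Rightarrow> real) \<Rightarrow> ('a \<Rightarrow> real) \<Rightarrow> bool" where
  "moderate v m \<longleftrightarrow> (\<exists>C>0. \<forall>x y. m (x + y) \<le> C * m x * v y)"

definition poly_weight :: "real \<Rightarrow> 'a::euclidean_space \<Rightarrow> real" where
  "poly_weight s z = (1 + norm z) powr s"

definition weights_P :: "('a::euclidean_space \<Rightarrow> real) set" where
  "weights_P = {m. weight m \<and> (\<exists>s\<ge>0. moderate (poly_weight s) m)}"

definition Linf :: "('a::euclidean_space \<Rightarrow> 'b::real_normed_vector) set" where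
  "Linf = {h \<in> borel_measurable lborel. esssup lborel (\<lambda>z. ereal (norm (h z))) < \<infinity>}"

definition Linf_loc :: "('a::euclidean_space \<Rightarrow> 'b::real_normed_vector) set" where
  "Linf_loc = {h \<in> borel_measurable lborel.
     \<forall>K. compact K \<longrightarrow> esssup (restrict_space lborel K) (\<lambda>z. ereal (norm (h z))) < \<infinity>}"

definition Linf_0 :: "('a::euclidean_space \<Rightarrow> 'b::real_normed_vector) set" where
  "Linf_0 = {h \<in> Linf.
     ((\<lambda>R::real. esssup (restrict_space lborel {z. norm z \<ge> R}) (\<lambda>z. ereal (norm (h z))))
        \<longlongrightarrow> 0) at_top}"

definition assoc_weight ::
  "('a \<Rightarrow> complex) \<Rightarrow> ('a \<Rightarrow> complex) \<Rightarrow> ('a \<times> 'a \<Rightarrow> real) \<Rightarrow> 'a::euclidean_space \<times> 'a \<Rightarrow> real" where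
  "assoc_weight \<psi> \<phi> m0 = (\<lambda>(x, \<omega>). sqrt ((m0 (x, \<omega>))\<^sup>2 + (norm (\<psi> x))\<^sup>2 + (norm (\<phi> \<omega>))\<^sup>2))"

definition admissible ::
  "('a::euclidean_space \<times> 'a \<Rightarrow> real) \<Rightarrow> ('a \<Rightarrow> complex) \<Rightarrow> ('a \<Rightarrow> complex) \<Rightarrow> bool" where
  "admissible m0 \<psi> \<phi> \<longleftrightarrow>
     continuous_on UNIV \<psi> \<and> \<psi> \<in> Linf_loc \<and>
     continuous_on UNIV \<phi> \<and> \<phi> \<in> Linf_loc \<and>
     assoc_weight \<psi> \<phi> m0 \<in> weights_P \<and>
     (\<lambda>z. m0 z / assoc_weight \<psi> \<phi> m0 z) \<in> Linf_0"


section \<open>Schwartz functions and tempered distributions\<close>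

text \<open>Iterated partial derivatives along a list of directions; a multi-index derivative
  corresponds to a list of basis vectors.\<close>

fun iter_partial :: "'a::euclidean_space list \<Rightarrow> ('a \<Rightarrow> complex) \<Rightarrow> 'a \<Rightarrow> complex" where
  "iter_partial [] f = f"
| "iter_partial (b # bs) f = (\<lambda>x. frechet_derivative (iter_partial bs f) (at x) b)"

text \<open>Smoothness is expressed by (Frechet) differentiability of all iterated partial derivatives.\<close>

definition schwartz :: "('a::euclidean_space \<Rightarrow> complex) set" where
  "schwartz = {f. \<forall>bs\<in>lists Basis.
     (\<forall>x. iter_partial bs f differentiable (at x)) \<and>
     (\<forall>k::nat. bounded (range (\<lambda>x. (1 + norm x) ^ k * norm (iter_partial bs f x))))}"

definition schwartz_seminorm :: "nat \<Rightarrow> ('a::euclidean_space \<Rightarrow> complex) \<Rightarrow> real" where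
  "schwartz_seminorm N f =
     (\<Sum>bs | set bs \<subseteq> Basis \<and> length bs \<le> N.
        SUP x. (1 + norm x) ^ N * norm (iter_partial bs f x))"

type_synonym 'a distribution = "('a \<Rightarrow> complex) \<Rightarrow> complex"

text \<open>Tempered distributions are (complex-)linear functionals on the Schwartz space, not
  antilinear ones. They are extended by 0 to all functions, so that equality of
  functionals is equality of tempered distributions.\<close>

definition tempered :: "'a::euclidean_space distribution set" where
  "tempered = {T.
     (\<forall>f\<in>schwartz. \<forall>h\<in>schwartz. T (\<lambda>x. f x + h x) = T f + T h) \<and>
     (\<forall>f\<in>schwartz. \<forall>c. T (\<lambda>x. c * f x) = c * T f) \<and>
     (\<exists>C N. \<forall>f\<in>schwartz. norm (T f) \<le> C * schwartz_seminorm N f) \<and>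
     (\<forall>f. f \<notin> schwartz \<longrightarrow> T f = 0)}"

definition fourier :: "('a::euclidean_space \<Rightarrow> complex) \<Rightarrow> 'a \<Rightarrow> complex" where
  "fourier f \<omega> = (LINT x|lborel. f x * cis (- 2 * pi * (x \<bullet> \<omega>)))"

definition dist_fourier :: "'a::euclidean_space distribution \<Rightarrow> 'a distribution" where
  "dist_fourier T = (\<lambda>f. if f \<in> schwartz then T (fourier f) else 0)"

definition represents :: "('a::euclidean_space \<Rightarrow> complex) \<Rightarrow> 'a distribution \<Rightarrow> bool" where
  "represents u T \<longleftrightarrow> u \<in> borel_measurable lborel \<and>
     (\<forall>f\<in>schwartz. integrable lborel (\<lambda>x. u x * f x) \<and> T f = (LINT x|lborel. u x * f x))"

text \<open>The function (unique almost everywhere) that represents a regular tempered distribution;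
  0 if the distribution is not regular. The latter convention only matters in products with a
  vanishing factor: let \<open>m = assoc_weight \<psi> \<phi> m0\<close> be in \<open>weights_P\<close>. If \<open>\<psi>\<close> is not
  identically 0, then moderateness of \<open>m\<close> and \<open>m (x, \<omega>) \<ge> \<bar>\<psi> x\<bar>\<close> give
  \<open>m (x, \<omega>) \<ge> c (1 + \<bar>x\<bar>) powr -s\<close> with \<open>c > 0\<close>, so every element of the modulation space with
  weight \<open>m\<close> is a locally square integrable function of polynomial growth in the mean.
  If \<open>\<psi>\<close> is 0, then \<open>\<psi> f\<close> is 0 whatever \<open>f\<close> is. The same holds for \<open>\<phi>\<close> and the Fourier
  transform of \<open>f\<close>.\<close>

definition density_of :: "'a::euclidean_space distribution \<Rightarrow> 'a \<Rightarrow> complex" where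
  "density_of T = (if \<exists>u. represents u T then SOME u. represents u T else (\<lambda>_. 0))"


section \<open>Short-time Fourier transform and modulation spaces\<close>

definition stft ::
  "('a::euclidean_space \<Rightarrow> complex) \<Rightarrow> 'a distribution \<Rightarrow> 'a \<times> 'a \<Rightarrow> complex" where
  "stft g T = (\<lambda>(x, \<omega>). T (\<lambda>t. cnj (g (t - x)) * cis (- 2 * pi * (t \<bullet> \<omega>))))"

text \<open>Since \<open>stft g f\<close> is continuous for a tempered distribution \<open>f\<close>, integrability below is the
  same as finiteness of the norm.\<close>

definition M2 ::
  "('a::euclidean_space \<Rightarrow> complex) \<Rightarrow> ('a \<times> 'a \<Rightarrow> real) \<Rightarrow> 'a distribution set" where
  "M2 g \<mu> = {f \<in> tempered. integrable lborel (\<lambda>z. (norm (of_real (\<mu> z) * stft g f z))\<^sup>2)}"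

definition M2_norm ::
  "('a::euclidean_space \<Rightarrow> complex) \<Rightarrow> ('a \<times> 'a \<Rightarrow> real) \<Rightarrow> 'a distribution \<Rightarrow> real" where
  "M2_norm g \<mu> f = sqrt (LINT z|lborel. (norm (of_real (\<mu> z) * stft g f z))\<^sup>2)"

definition M2_inner ::
  "('a::euclidean_space \<Rightarrow> complex) \<Rightarrow> ('a \<times> 'a \<Rightarrow> real) \<Rightarrow>
   'a distribution \<Rightarrow> 'a distribution \<Rightarrow> complex" where
  "M2_inner g \<mu> u v = (LINT z|lborel. of_real ((\<mu> z)\<^sup>2) * stft g u z * cnj (stft g v z))"

definition mixed_inner ::
  "('a::euclidean_space \<Rightarrow> complex) \<Rightarrow> ('a \<Rightarrow> complex) \<Rightarrow> ('a \<Rightarrow> complex) \<Rightarrow> ('a \<times> 'a \<Rightarrow> real) \<Rightarrow>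
   'a distribution \<Rightarrow> 'a distribution \<Rightarrow> complex" where
  "mixed_inner g \<psi> \<phi> m0 u v =
     M2_inner g m0 u v
     + (LINT x|lborel. of_real ((norm (\<psi> x))\<^sup>2) * density_of u x * cnj (density_of v x))
     + (LINT \<omega>|lborel. of_real ((norm (\<phi> \<omega>))\<^sup>2) *
          density_of (dist_fourier u) \<omega> * cnj (density_of (dist_fourier v) \<omega>))"

definition mixed_norm ::
  "('a::euclidean_space \<Rightarrow> complex) \<Rightarrow> ('a \<Rightarrow> complex) \<Rightarrow> ('a \<Rightarrow> complex) \<Rightarrow> ('a \<times> 'a \<Rightarrow> real) \<Rightarrow>
   'a distribution \<Rightarrow> real" where
  "mixed_norm g \<psi> \<phi> m0 u = sqrt (Re (mixed_inner g \<psi> \<phi> m0 u u))"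

definition uncertainty_functional ::
  "('a::euclidean_space \<Rightarrow> complex) \<Rightarrow> ('a \<Rightarrow> complex) \<Rightarrow> 'a distribution \<Rightarrow> real" where
  "uncertainty_functional \<psi> \<phi> f =
     (LINT x|lborel. (norm (\<psi> x * density_of f x))\<^sup>2)
     + (LINT \<omega>|lborel. (norm (\<phi> \<omega> * density_of (dist_fourier f) \<omega>))\<^sup>2)"


section \<open>Operators on spaces of distributions\<close>

definition bounded_operator_on ::
  "'a distribution set \<Rightarrow> ('a distribution \<Rightarrow> real) \<Rightarrow> ('a distribution \<Rightarrow> 'a distribution) \<Rightarrow> bool"
  where
  "bounded_operator_on V nrm A \<longleftrightarrow>
     (\<forall>u\<in>V. A u \<in> V) \<and>
     (\<forall>u\<in>V. \<forall>v\<in>V. A (\<lambda>h. u h + v h) = (\<lambda>h. A u h + A v h)) \<and>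
     (\<forall>u\<in>V. \<forall>c. A (\<lambda>h. c * u h) = (\<lambda>h. c * A u h)) \<and>
     (\<exists>K. \<forall>u\<in>V. nrm (A u) \<le> K * nrm u)"

text \<open>The characterization of \<open>A\<close> by the Riesz representation theorem; it determines \<open>A\<close> on
  the modulation space uniquely.\<close>

definition riesz_operator ::
  "('a::euclidean_space \<Rightarrow> complex) \<Rightarrow> ('a \<Rightarrow> complex) \<Rightarrow> ('a \<Rightarrow> complex) \<Rightarrow> ('a \<times> 'a \<Rightarrow> real) \<Rightarrow>
   ('a distribution \<Rightarrow> 'a distribution) \<Rightarrow> bool" where
  "riesz_operator g \<psi> \<phi> m0 A \<longleftrightarrow>
     bounded_operator_on (M2 g (assoc_weight \<psi> \<phi> m0)) (mixed_norm g \<psi> \<phi> m0) A \<and>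
     (\<forall>u\<in>M2 g (assoc_weight \<psi> \<phi> m0). \<forall>v\<in>M2 g (assoc_weight \<psi> \<phi> m0).
        M2_inner g m0 u v = mixed_inner g \<psi> \<phi> m0 (A u) v)"

definition eigenvalues_on ::
  "'a distribution set \<Rightarrow> ('a distribution \<Rightarrow> 'a distribution) \<Rightarrow> complex set" where
  "eigenvalues_on V A = {\<mu>. \<exists>u\<in>V. u \<noteq> (\<lambda>_. 0) \<and> A u = (\<lambda>h. \<mu> * u h)}"

definition largest_eigenvalue_on ::
  "'a distribution set \<Rightarrow> ('a distribution \<Rightarrow> 'a distribution) \<Rightarrow> real \<Rightarrow> bool" where
  "largest_eigenvalue_on V A r \<longleftrightarrow>
     of_real r \<in> eigenvalues_on V A \<and> (\<forall>\<mu>\<in>eigenvalues_on V A. \<mu> \<in> \<real> \<and> Re \<mu> \<le> r)"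

end

theory Submission
  imports Defs "HOL-Probability.Probability"
begin

text \<open>The statement is the Rayleigh principle for the pencil of two Hermitian forms on the modulation
space: \<open>B\<close>, the inner product with weight \<open>m0\<close>, and \<open>Q = B + F\<close>, the mixed inner product, where
\<open>F\<close> is the form whose diagonal is the uncertainty functional. A minimizer \<open>f0\<close> makes
\<open>F - \<lambda> B\<close> a positive form with \<open>f0\<close> as an isotropic vector; an isotropic vector of a positive form
lies in its radical, so \<open>Q f0 v = (\<lambda> + 1) B f0 v = (\<lambda> + 1) Q (A f0) v\<close> for all \<open>v\<close>, and definiteness
of \<open>Q\<close> gives \<open>f0 = (\<lambda> + 1) A f0\<close>. Any other eigenvalue is a quotient \<open>B u u / Q u u\<close>, which is real
and at most \<open>1 / (\<lambda> + 1)\<close>. This is \<open>rayleigh_minimizer\<close>.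

The work lies in the hypotheses of that lemma: \<open>F\<close> has to be a Hermitian form at all, and \<open>B\<close> has to be
definite. The elements of the space are tempered distributions, and \<open>F\<close> is written with the
functions that represent them and their Fourier transforms. It must be shown that these functions exist,
that they depend linearly on the distribution up to null sets, and that they are square-integrable
with the weights \<open>\<psi>\<close> and \<open>\<phi>\<close>; otherwise the integrals in \<open>F\<close> could take the default value 0.

Definiteness and the existence of densities rest on one identity (\<open>stft_pairing\<close>): for tempered \<open>T\<close> and Schwartz \<open>g\<close>, \<open>h\<close>,
the value \<open>T h\<close> times the squared norm of \<open>g\<close> is the integral over phase space of the
short-time Fourier transform of \<open>T\<close> against rapidly decreasing coefficients of \<open>h\<close>. It is Fourier inversion
for \<open>h\<close> windowed by \<open>g\<close>, followed by an exchange of \<open>T\<close> with an integral, which the continuity of \<open>T\<close> permits because finite sums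
approximate the integral in every Schwartz seminorm. Definiteness of \<open>B\<close> is immediate from the identity (\<open>stft_injective\<close>).

For the existence of densities (\<open>L2_representation\<close>), the short-time Fourier transform \<open>V\<close> of \<open>T\<close> is truncated
to balls of phase space; the truncations synthesize honest functions, and these form a Cauchy sequence in
a weighted \<open>L2\<close> space. The estimate behind this (\<open>synth_bound\<close>) is Bessel's inequality in the
frequency variable combined with a weighted convolution bound in the space variable. The weight is the
infimum of \<open>m\<close> over all frequencies: it is again moderate, it dominates \<open>\<psi>\<close>, and it is positive everywhere as
soon as \<open>\<psi>\<close> is nonzero somewhere. For the Fourier transform of \<open>T\<close> the same lemma is applied to
\<open>V\<close> turned by a quarter of the phase plane, with the window \<open>fourier g\<close>. Uniqueness of densities follows from
the injectivity of the Fourier transform on integrable functions, applied to the windowed density.\<close>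

section \<open>Integration on Euclidean space\<close>

definition rapid :: "('a::real_normed_vector \<Rightarrow> 'b::real_normed_vector) \<Rightarrow> bool" where
  "rapid f \<longleftrightarrow> (\<forall>k::nat. \<exists>C. \<forall>x. (1 + norm x) ^ k * norm (f x) \<le> C)"

lemma rapidD: "rapid f \<Longrightarrow> \<exists>C\<ge>0. \<forall>x. (1 + norm x) ^ k * norm (f x) \<le> C"
  unfolding rapid_def by (meson dual_order.trans linorder_linear)

lemma integrable_lborel_prod_Basis:
  fixes f :: "'a::euclidean_space \<Rightarrow> real \<Rightarrow> 'b::{real_normed_field,banach,second_countable_topology}"
  assumes "\<And>b. b \<in> Basis \<Longrightarrow> integrable lborel (f b)"
  shows "integrable lborel (\<lambda>x::'a. \<Prod>b\<in>Basis. f b (x \<bullet> b))" (is ?A)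
    and "(LINT x|lborel. (\<Prod>b\<in>Basis. f b (x \<bullet> b))) = (\<Prod>b\<in>Basis. integral\<^sup>L lborel (f b))" (is ?B)
proof -
  interpret product_sigma_finite "\<lambda>_::'a. lborel :: real measure" ..
  have m[measurable]: "f b \<in> borel_measurable borel" if "b \<in> Basis" for b
    using borel_measurable_integrable[OF assms[OF that]] by simp
  have [measurable]: "(\<lambda>x::'a. \<Prod>b\<in>Basis. f b (x \<bullet> b)) \<in> borel_measurable borel"
    by (intro borel_measurable_prod measurable_compose[OF _ m]) auto
  have s: "(\<Sum>b'\<in>Basis. x b' *\<^sub>R b') \<bullet> b = x b" if "b \<in> Basis" for x and b :: 'a
    using that by (simp add: inner_sum_left inner_Basis if_distrib cong: if_cong)
  have i: "integrable (\<Pi>\<^sub>M b\<in>Basis. lborel) (\<lambda>x. \<Prod>b\<in>(Basis::'a set). f b (x b))"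
    using product_integrable_prod[of Basis f] assms by simp
  show ?A
    by (subst lborel_eq, subst integrable_distr_eq) (use i s in \<open>simp_all cong: prod.cong\<close>)
  show ?B
    by (subst lborel_eq, subst integral_distr)
       (use product_integral_prod[of Basis f] assms s in \<open>simp_all cong: prod.cong\<close>)
qed

text \<open>The exponent is twice the dimension because
\<open>(1 + \<bar>x\<bar>)\<^sup>2\<close> bounds each factor \<open>1 + x\<^sub>b\<^sup>2\<close>; the product of their inverses is integrable coordinate by
coordinate.\<close>

lemma integrable_inverse_norm_power:
  "integrable lborel (\<lambda>x::'a::euclidean_space. inverse ((1 + norm x) ^ (2 * DIM('a))))"
proof (rule Bochner_Integration.integrable_bound)
  have 1: "integrable lborel (\<lambda>x::real. inverse (1 + x\<^sup>2))"
    using integrable_inverse_1_plus_square by (simp add: set_integrable_def einterval_def)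
  then show "integrable lborel (\<lambda>x::'a. \<Prod>b\<in>Basis. inverse (1 + (x \<bullet> b)\<^sup>2))"
    by (rule integrable_lborel_prod_Basis)
  have "norm (inverse ((1 + norm x) ^ (2 * DIM('a)))) \<le> norm (\<Prod>b\<in>Basis. inverse (1 + (x \<bullet> b)\<^sup>2))" for x :: 'a
  proof -
    have "1 + (x \<bullet> b)\<^sup>2 \<le> (1 + norm x)\<^sup>2" if "b \<in> Basis" for b
    proof -
      have "(x \<bullet> b)\<^sup>2 \<le> (norm x)\<^sup>2"
        using Basis_le_norm[OF that, of x] power2_le_iff_abs_le norm_ge_zero by blast
      then show ?thesis by (simp add: power2_sum add_increasing2)
    qed
    then have "(\<Prod>b\<in>(Basis::'a set). inverse ((1 + norm x)\<^sup>2)) \<le> (\<Prod>b\<in>Basis. inverse (1 + (x \<bullet> b)\<^sup>2))"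
      by (intro prod_mono) (auto intro!: le_imp_inverse_le add_pos_nonneg)
    then show ?thesis
      by (simp add: power_mult power_inverse abs_prod del: prod_constant) (simp add: prod_nonneg power_inverse)
  qed
  then show "AE x::'a in lborel. norm (inverse ((1 + norm x) ^ (2 * DIM('a)))) \<le> norm (\<Prod>b\<in>Basis. inverse (1 + (x \<bullet> b)\<^sup>2))"
    by (intro AE_I2)
qed simp

lemma decay_integrable:
  fixes f :: "'a::euclidean_space \<Rightarrow> 'b::{banach,second_countable_topology}"
  assumes "f \<in> borel_measurable borel" "\<And>x. (1 + norm x) ^ (2 * DIM('a)) * norm (f x) \<le> C"
  shows "integrable lborel f"
proof (rule Bochner_Integration.integrable_bound)
  show "integrable lborel (\<lambda>x::'a. C * inverse ((1 + norm x) ^ (2 * DIM('a))))"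
    by (intro integrable_mult_right integrable_inverse_norm_power)
  have "norm (f x) \<le> norm (C * inverse ((1 + norm x) ^ (2 * DIM('a))))" for x
  proof -
    have "norm (f x) \<le> C / (1 + norm x) ^ (2 * DIM('a))"
      using assms(2)[of x] by (subst pos_le_divide_eq) (auto simp: mult.commute intro!: zero_less_power add_pos_nonneg)
    then show ?thesis by (simp add: divide_inverse)
  qed
  then show "AE x in lborel. norm (f x) \<le> norm (C * inverse ((1 + norm x) ^ (2 * DIM('a))))" by simp
qed (use assms in simp)

lemma rapid_integrable:
  fixes f :: "'a::euclidean_space \<Rightarrow> 'b::{banach,second_countable_topology}"
  assumes "f \<in> borel_measurable borel" "rapid f"
  shows "integrable lborel f"
  using decay_integrable[OF assms(1)] rapidD[OF assms(2)] by blast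

lemma bounded_support_integrable:
  fixes G :: "'a::euclidean_space \<Rightarrow> complex"
  assumes [measurable]: "G \<in> borel_measurable borel" and B: "\<And>z. norm (G z) \<le> B" and R: "\<And>z. norm z > R \<Longrightarrow> G z = 0"
  shows "integrable lborel G"
proof (rule decay_integrable)
  have "B \<ge> 0" using order_trans[OF norm_ge_zero B] .
  fix z :: 'a
  show "(1 + norm z) ^ (2 * DIM('a)) * norm (G z) \<le> (1 + \<bar>R\<bar>) ^ (2 * DIM('a)) * B"
  proof (cases "norm z > R")
    case False
    then show ?thesis by (intro mult_mono power_mono B) auto
  qed (use R \<open>B \<ge> 0\<close> in simp)
qed simp

lemma nn_integral_lborel_affine:
  fixes f :: "'a::euclidean_space \<Rightarrow> ennreal"
  assumes [measurable]: "f \<in> borel_measurable borel" and c: "c \<noteq> 0"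
  shows "(\<integral>\<^sup>+x. f x \<partial>lborel) = ennreal (\<bar>c\<bar> ^ DIM('a)) * (\<integral>\<^sup>+x. f (t + c *\<^sub>R x) \<partial>lborel)"
  by (subst lborel_affine[OF c, of t])
     (simp add: nn_integral_density nn_integral_distr nn_integral_cmult)

lemma integrable_lborel_affine:
  fixes f :: "'a::euclidean_space \<Rightarrow> 'b::{banach, second_countable_topology}"
  assumes f: "integrable lborel f" and c: "c \<noteq> 0"
  shows "integrable lborel (\<lambda>x. f (t + c *\<^sub>R x))"
  using f f[THEN borel_measurable_integrable] c unfolding integrable_iff_bounded
  by (subst (asm) nn_integral_lborel_affine[where c=c and t=t])
     (auto simp: ennreal_mult_less_top intro!: measurable_compose[of "\<lambda>x. t + c *\<^sub>R x" borel borel f])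

lemma integral_lborel_affine:
  fixes f :: "'a::euclidean_space \<Rightarrow> 'b::{banach, second_countable_topology}" and c :: real
  assumes c: "c \<noteq> 0"
  shows "(LINT x|lborel. f x) = \<bar>c\<bar> ^ DIM('a) *\<^sub>R (LINT x|lborel. f (t + c *\<^sub>R x))"
proof cases
  assume f: "integrable lborel f"
  note [measurable] = f[THEN borel_measurable_integrable, simplified]
  show ?thesis
    by (subst lborel_affine[OF c, of t]) (simp add: integral_density integral_distr)
next
  assume nf: "\<not> integrable lborel f"
  have "\<not> integrable lborel (\<lambda>x. f (t + c *\<^sub>R x))"
  proof
    assume "integrable lborel (\<lambda>x. f (t + c *\<^sub>R x))"
    from integrable_lborel_affine[OF this, of "1/c" "- (1/c) *\<^sub>R t"] c nf show False
      by (simp add: algebra_simps)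
  qed
  then show ?thesis using nf by (simp add: not_integrable_integral_eq)
qed

lemma integral_lborel_shift:
  fixes f :: "'a::euclidean_space \<Rightarrow> 'b::{banach, second_countable_topology}"
  shows "(LINT x|lborel. f (t + x)) = (LINT x|lborel. f x)"
    and "(LINT x|lborel. f (t - x)) = (LINT x|lborel. f x)"
  using integral_lborel_affine[of 1 f t] integral_lborel_affine[of "-1" f t] by simp_all

lemma integrable_lborel_shift:
  fixes f :: "'a::euclidean_space \<Rightarrow> 'b::{banach, second_countable_topology}"
  assumes "integrable lborel f"
  shows "integrable lborel (\<lambda>x. f (t + x))" "integrable lborel (\<lambda>x. f (t - x))"
  using integrable_lborel_affine[OF assms, of 1 t] integrable_lborel_affine[OF assms, of "-1" t] by simp_all

lemma nn_integral_lborel_shift: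
  fixes f :: "'a::euclidean_space \<Rightarrow> ennreal"
  assumes "f \<in> borel_measurable borel"
  shows "(\<integral>\<^sup>+x. f (t + x) \<partial>lborel) = (\<integral>\<^sup>+x. f x \<partial>lborel)"
    and "(\<integral>\<^sup>+x. f (t - x) \<partial>lborel) = (\<integral>\<^sup>+x. f x \<partial>lborel)"
  using nn_integral_lborel_affine[OF assms, of 1 t] nn_integral_lborel_affine[OF assms, of "-1" t] by simp_all

section \<open>Gaussian summation and the Fourier transform of integrable functions\<close>

text \<open>Normalized so that it is its own Fourier transform.\<close>

definition gauss :: "'a::euclidean_space \<Rightarrow> real" where
  "gauss x = exp (- pi * (norm x)\<^sup>2)"

lemma gauss_measurable[measurable]: "gauss \<in> borel_measurable borel"
  unfolding gauss_def by measurable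

lemma gauss_pos: "0 < gauss x" and gauss_le_1: "gauss x \<le> 1"
  by (auto simp: gauss_def)

lemma cis_measurable[measurable]: "cis \<in> borel_measurable borel"
  by (intro borel_measurable_continuous_onI continuous_intros)

lemma norm_mult_cis[simp]: "norm (a * cis t) = norm a" 
  by (simp add: norm_mult)

lemma integrable_mult_cis:
  assumes "integrable M f" and [measurable]: "\<theta> \<in> borel_measurable M"
  shows "integrable M (\<lambda>x. f x * cis (\<theta> x))"
  by (rule Bochner_Integration.integrable_bound[OF assms(1)]) (use assms(1) in auto)

text \<open>A change of scale in the characteristic function of the standard normal distribution.\<close>

lemma gauss_real: 
  fixes w :: real
  shows "integrable lborel (\<lambda>x::real. complex_of_real (exp (- pi * x\<^sup>2)) * cis (- 2 * pi * (x * w)))"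
    and "(LINT x|lborel. complex_of_real (exp (- pi * x\<^sup>2)) * cis (- 2 * pi * (x * w))) = of_real (exp (- pi * w\<^sup>2))"
proof -
  let ?r = "sqrt (2 * pi)"
  let ?h = "\<lambda>x. complex_of_real (std_normal_density x) * cis (- ?r * w * x)"
  have r: "?r > 0" "?r * ?r = 2 * pi" by auto
  have e: "?h (0 + ?r * x) = of_real (1 / ?r) * (complex_of_real (exp (- pi * x\<^sup>2)) * cis (- 2 * pi * (x * w)))" for x
  proof -
    have sq: "(?r * x)\<^sup>2 = 2 * pi * x\<^sup>2" using r by (simp add: power_mult_distrib)
    have "- ?r * w * (?r * x) = - (?r * ?r) * (x * w)" by (simp only: ac_simps mult_minus_left)
    then have ph: "- ?r * w * (?r * x) = - 2 * pi * (x * w)" using r(2) by simp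
    show ?thesis
      unfolding add_0 ph by (simp add: sq std_normal_density_def del: real_sqrt_mult)
  qed
  have "integrable lborel (\<lambda>x. complex_of_real (std_normal_density x))"
    by (intro integrable_of_real integrable_normal_density) simp
  then have i: "integrable lborel ?h"
    using integrable_mult_cis[of lborel "\<lambda>x. complex_of_real (std_normal_density x)" "\<lambda>x. - ?r * w * x"]
    by simp
  have "complex_of_real (exp (- ((- ?r * w)\<^sup>2) / 2)) = char std_normal_distribution (- ?r * w)"
    by (simp add: char_std_normal_distribution)
  also have "\<dots> = (LINT x|lborel. ?h x)"
    unfolding char_def by (subst integral_density) (auto simp: normal_density_nonneg scaleR_conv_of_real cis_conv_exp)
  also have "\<dots> = ?r *\<^sub>R (LINT x|lborel. ?h (0 + ?r * x))"
    using lborel_integral_real_affine[of ?r ?h 0] r by simp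
  finally have 2: "complex_of_real (exp (- ((- ?r * w)\<^sup>2) / 2)) = ?r *\<^sub>R (LINT x|lborel. ?h (0 + ?r * x))" .
  have 3: "(- ?r * w)\<^sup>2 = 2 * pi * w\<^sup>2" using r by (simp add: power_mult_distrib)
  show "(LINT x|lborel. complex_of_real (exp (- pi * x\<^sup>2)) * cis (- 2 * pi * (x * w))) = of_real (exp (- pi * w\<^sup>2))"
    using 2 unfolding e 3 integral_mult_right_zero using r(1) by (simp add: scaleR_conv_of_real del: real_sqrt_mult)
  have "integrable lborel (\<lambda>x. of_real ?r * ?h (0 + ?r * x))"
    using lborel_integrable_real_affine[OF i, of ?r 0] r(1) by (intro integrable_mult_right) auto
  then show "integrable lborel (\<lambda>x::real. complex_of_real (exp (- pi * x\<^sup>2)) * cis (- 2 * pi * (x * w)))"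
    unfolding e using r(1) by (simp add: mult.assoc[symmetric] del: real_sqrt_mult)
qed

lemma gauss_prod:
  fixes x w :: "'a::euclidean_space"
  shows "complex_of_real (gauss x) * cis (- 2 * pi * (x \<bullet> w)) =
    (\<Prod>b\<in>Basis. complex_of_real (exp (- pi * (x \<bullet> b)\<^sup>2)) * cis (- 2 * pi * ((x \<bullet> b) * (w \<bullet> b))))"
proof -
  have "(norm x)\<^sup>2 = (\<Sum>b\<in>Basis. (x \<bullet> b)\<^sup>2)"
    by (simp add: power2_norm_eq_inner) (simp add: euclidean_inner[of x x] power2_eq_square)
  then have 1: "complex_of_real (gauss x) = (\<Prod>b\<in>Basis. complex_of_real (exp (- pi * (x \<bullet> b)\<^sup>2)))"
    by (simp add: gauss_def sum_distrib_left exp_sum flip: of_real_prod sum_negf)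
  have c: "cis (sum f S) = (\<Prod>b\<in>S. cis (f b))" if "finite S" for f and S :: "'a set"
    using that by induction (auto simp flip: cis_mult)
  have 2: "cis (- 2 * pi * (x \<bullet> w)) = (\<Prod>b\<in>Basis. cis (- 2 * pi * ((x \<bullet> b) * (w \<bullet> b))))"
    by (subst euclidean_inner) (simp add: sum_distrib_left c del: mult_minus_left)
  show ?thesis unfolding 1 2 by (simp add: prod.distrib)
qed

lemma fourier_gauss:
  fixes w :: "'a::euclidean_space"
  shows "(LINT x|lborel. complex_of_real (gauss x) * cis (- 2 * pi * (x \<bullet> w))) = of_real (gauss w)"
proof -
  have "(LINT x|lborel. complex_of_real (gauss x) * cis (- 2 * pi * (x \<bullet> w))) =
      (\<Prod>b\<in>Basis. of_real (exp (- pi * (w \<bullet> b)\<^sup>2)))"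
    unfolding gauss_prod
    by (subst integrable_lborel_prod_Basis(2)[OF gauss_real(1)]) (simp only: gauss_real(2))
  also have "\<dots> = of_real (gauss w)"
    using gauss_prod[of w 0] by simp
  finally show ?thesis .
qed

lemma gauss_integrable: "integrable lborel (gauss :: 'a::euclidean_space \<Rightarrow> real)"
  and gauss_integral: "(LINT x|lborel. gauss (x::'a)) = 1"
proof -
  have "integrable lborel (\<lambda>x::'a. complex_of_real (gauss x) * cis (- 2 * pi * (x \<bullet> 0)))"
    by (simp only: gauss_prod) (intro integrable_lborel_prod_Basis gauss_real)
  then have *: "integrable lborel (\<lambda>x::'a. complex_of_real (gauss x))" by simp
  from integrable_Re[OF *] show "integrable lborel (gauss :: 'a::euclidean_space \<Rightarrow> real)" by simp
  show "(LINT x|lborel. gauss (x::'a)) = 1"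
    using fourier_gauss[of "0::'a"] integral_complex_of_real[of lborel "gauss :: 'a \<Rightarrow> real"]
    by (simp add: gauss_def[of "0::'a"])
qed

lemma fourier_gauss_scaled:
  fixes y :: "'a::euclidean_space"
  assumes "\<epsilon> > 0"
  shows "integrable lborel (\<lambda>w::'a. gauss (\<epsilon> *\<^sub>R w))"
    and "(LINT w|lborel. complex_of_real (gauss (\<epsilon> *\<^sub>R w)) * cis (2 * pi * (w \<bullet> y)))
      = of_real (gauss ((1/\<epsilon>) *\<^sub>R y) / \<epsilon> ^ DIM('a))"
proof -
  show "integrable lborel (\<lambda>w::'a. gauss (\<epsilon> *\<^sub>R w))"
    using integrable_lborel_affine[OF gauss_integrable, of \<epsilon> 0] assms by simp
  have "of_real (gauss ((1/\<epsilon>) *\<^sub>R y)) = (LINT x|lborel. complex_of_real (gauss x) * cis (- 2 * pi * (x \<bullet> (-(1/\<epsilon>) *\<^sub>R y))))"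
    by (subst fourier_gauss) (simp add: gauss_def)
  also have "\<dots> = \<epsilon> ^ DIM('a) *\<^sub>R (LINT w|lborel. complex_of_real (gauss (\<epsilon> *\<^sub>R w)) * cis (2 * pi * (w \<bullet> y)))"
    using assms by (subst integral_lborel_affine[of \<epsilon> _ 0]) (simp_all add: algebra_simps)
  finally show "(LINT w|lborel. complex_of_real (gauss (\<epsilon> *\<^sub>R w)) * cis (2 * pi * (w \<bullet> y)))
      = of_real (gauss ((1/\<epsilon>) *\<^sub>R y) / \<epsilon> ^ DIM('a))"
    using assms by (simp add: scaleR_conv_of_real)
qed

lemma integrable_prod_mult:
  fixes f :: "'a::euclidean_space \<Rightarrow> 'c::{real_normed_field,banach,second_countable_topology}"
    and g :: "'b::euclidean_space \<Rightarrow> 'c"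
  assumes f: "integrable lborel f" and g: "integrable lborel g"
  shows "integrable (lborel \<Otimes>\<^sub>M lborel) (\<lambda>(x, y). f x * g y)"
proof (rule lborel_pair.Fubini_integrable)
  note [measurable] = borel_measurable_integrable[OF f, simplified] borel_measurable_integrable[OF g, simplified]
  show "(\<lambda>(x, y). f x * g y) \<in> borel_measurable (lborel \<Otimes>\<^sub>M lborel)" by measurable
qed (use f g in \<open>auto simp: norm_mult\<close>)

lemma norm_integral_le_nn_integral:
  fixes f :: "'a \<Rightarrow> 'b::{banach,second_countable_topology}"
  shows "ennreal (norm (integral\<^sup>L M f)) \<le> (\<integral>\<^sup>+x. ennreal (norm (f x)) \<partial>M)"
  by (cases "integrable M f") (auto simp: not_integrable_integral_eq intro: integral_norm_bound_ennreal)

lemma fourier_measurable[measurable]: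
  assumes [measurable]: "f \<in> borel_measurable borel"
  shows "fourier f \<in> borel_measurable borel"
proof -
  have "(\<lambda>w. LINT x|lborel. f x * cis (- 2 * pi * (x \<bullet> w))) \<in> borel_measurable lborel"
    by (rule lborel.borel_measurable_lebesgue_integral) measurable
  then show ?thesis by (simp add: fourier_def[abs_def])
qed

lemma norm_fourier_le: "norm (fourier f w) \<le> (LINT x|lborel. norm (f x))"
  unfolding fourier_def by (rule order_trans[OF integral_norm_bound]) simp

lemma integrable_mult_bounded:
  fixes f :: "'a \<Rightarrow> 'b::{real_normed_field,banach,second_countable_topology}"
  assumes "integrable M f" "g \<in> borel_measurable M" "\<And>x. norm (g x) \<le> C"
  shows "integrable M (\<lambda>x. f x * g x)"
proof (rule Bochner_Integration.integrable_bound)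
  show "integrable M (\<lambda>x. norm (f x) * C)" using assms(1) by simp
  show "AE x in M. norm (f x * g x) \<le> norm (norm (f x) * C)"
    using assms(3) by (auto simp: norm_mult intro!: mult_left_mono order_trans[OF _ abs_ge_self])
qed (use assms in measurable)

lemma square_integrable_bounded:
  fixes f :: "'a \<Rightarrow> complex"
  assumes f: "integrable M f" and b: "\<And>x. norm (f x) \<le> C"
  shows "integrable M (\<lambda>x. (norm (f x))\<^sup>2)"
proof -
  have "integrable M (\<lambda>x. norm (f x) * norm (f x))"
    by (rule integrable_mult_bounded[OF integrable_norm[OF f], where C=C]) (use f b in auto)
  then show ?thesis by (simp add: power2_eq_square)
qed

lemma fourier_multiplication_formula:
  fixes f h :: "'a::euclidean_space \<Rightarrow> complex"
  assumes f: "integrable lborel f" and h: "integrable lborel h"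
  shows "(LINT t|lborel. fourier f t * h t) = (LINT s|lborel. f s * fourier h s)"
proof -
  let ?m = "\<lambda>s t. cis (- 2 * pi * (s \<bullet> t))"
  have i: "integrable (lborel \<Otimes>\<^sub>M lborel) (\<lambda>(s, t). f s * h t * ?m s t)"
    using integrable_mult_cis[OF integrable_prod_mult[OF f h], of "\<lambda>z. - 2 * pi * (fst z \<bullet> snd z)"]
    by (simp add: case_prod_unfold)
  have "(LINT t|lborel. fourier f t * h t) = (LINT t|lborel. LINT s|lborel. f s * h t * ?m s t)"
    unfolding fourier_def integral_mult_left_zero[symmetric] by (simp only: ac_simps)
  also have "\<dots> = (LINT s|lborel. LINT t|lborel. f s * h t * ?m s t)"
    by (rule lborel_pair.Fubini_integral[OF i])
  also have "\<dots> = (LINT s|lborel. f s * fourier h s)"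
    unfolding fourier_def integral_mult_right_zero[symmetric] by (simp only: inner_commute mult.assoc)
  finally show ?thesis .
qed

text \<open>Summing the Fourier integral of \<open>f\<close> with a Gaussian cut-off is the same as
averaging \<open>f\<close> over a small Gaussian around \<open>t\<close>. Inversion, injectivity and Bessel's inequality below are the three
ways of letting the cut-off go to infinity.\<close>

lemma fourier_gauss_summation:
  fixes f :: "'a::euclidean_space \<Rightarrow> complex"
  assumes f: "integrable lborel f" and e: "\<epsilon> > 0"
  shows "(LINT w|lborel. fourier f w * cis (2 * pi * (t \<bullet> w)) * of_real (gauss (\<epsilon> *\<^sub>R w)))
    = (LINT y|lborel. f (t - \<epsilon> *\<^sub>R y) * of_real (gauss y))"
proof -
  note [measurable] = borel_measurable_integrable[OF f, simplified]
  have gi: "integrable lborel (\<lambda>w::'a. complex_of_real (gauss (\<epsilon> *\<^sub>R w)))"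
    by (intro integrable_of_real fourier_gauss_scaled e)
  have "integrable (lborel \<Otimes>\<^sub>M lborel) (\<lambda>(x, w::'a). f x * of_real (gauss (\<epsilon> *\<^sub>R w)))"
    by (rule integrable_prod_mult[OF f gi])
  then have "integrable (lborel \<Otimes>\<^sub>M lborel) (\<lambda>z. (case z of (x, w::'a) \<Rightarrow> f x * of_real (gauss (\<epsilon> *\<^sub>R w)))
      * cis (2 * pi * ((t - fst z) \<bullet> snd z)))"
    by (rule integrable_mult_cis) measurable
  then have i: "integrable (lborel \<Otimes>\<^sub>M lborel)
      (\<lambda>(x, w). f x * of_real (gauss (\<epsilon> *\<^sub>R w)) * cis (2 * pi * ((t - x) \<bullet> w)))"
    by (simp add: case_prod_unfold)
  have "(LINT w|lborel. fourier f w * cis (2 * pi * (t \<bullet> w)) * of_real (gauss (\<epsilon> *\<^sub>R w)))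
    = (LINT w|lborel. LINT x|lborel. f x * of_real (gauss (\<epsilon> *\<^sub>R w)) * cis (2 * pi * ((t - x) \<bullet> w)))"
  proof (rule Bochner_Integration.integral_cong[OF refl])
    fix w
    have "fourier f w * cis (2 * pi * (t \<bullet> w)) * of_real (gauss (\<epsilon> *\<^sub>R w)) =
      fourier f w * (cis (2 * pi * (t \<bullet> w)) * of_real (gauss (\<epsilon> *\<^sub>R w)))" by simp
    also have "\<dots> = (LINT x|lborel. f x * cis (- 2 * pi * (x \<bullet> w)) * (cis (2 * pi * (t \<bullet> w)) * of_real (gauss (\<epsilon> *\<^sub>R w))))"
      unfolding fourier_def by simp
    also have "\<dots> = (LINT x|lborel. f x * of_real (gauss (\<epsilon> *\<^sub>R w)) * cis (2 * pi * ((t - x) \<bullet> w)))"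
    proof (rule Bochner_Integration.integral_cong[OF refl])
      fix x
      have "cis (- 2 * pi * (x \<bullet> w)) * cis (2 * pi * (t \<bullet> w)) = cis (2 * pi * ((t - x) \<bullet> w))"
        by (simp add: cis_mult inner_diff_left algebra_simps)
      from this[symmetric]
      show "f x * cis (- 2 * pi * (x \<bullet> w)) * (cis (2 * pi * (t \<bullet> w)) * of_real (gauss (\<epsilon> *\<^sub>R w)))
        = f x * of_real (gauss (\<epsilon> *\<^sub>R w)) * cis (2 * pi * ((t - x) \<bullet> w))"
        by (simp only: ac_simps)
    qed
    finally show "fourier f w * cis (2 * pi * (t \<bullet> w)) * of_real (gauss (\<epsilon> *\<^sub>R w)) =
      (LINT x|lborel. f x * of_real (gauss (\<epsilon> *\<^sub>R w)) * cis (2 * pi * ((t - x) \<bullet> w)))" .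
  qed
  also have "\<dots> = (LINT x|lborel. LINT w|lborel. f x * of_real (gauss (\<epsilon> *\<^sub>R w)) * cis (2 * pi * ((t - x) \<bullet> w)))"
    by (rule lborel_pair.Fubini_integral[OF i])
  also have "\<dots> = (LINT x|lborel. f x * of_real (gauss ((1/\<epsilon>) *\<^sub>R (t - x)) / \<epsilon> ^ DIM('a)))"
    by (subst fourier_gauss_scaled(2)[OF e, symmetric]) (simp add: mult.assoc inner_commute)
  also have "\<dots> = (LINT y|lborel. f (t - \<epsilon> *\<^sub>R y) * of_real (gauss y))"
  proof -
    have "(LINT x|lborel. f x * of_real (gauss ((1/\<epsilon>) *\<^sub>R (t - x)) / \<epsilon> ^ DIM('a)))
      = \<epsilon> ^ DIM('a) *\<^sub>R (LINT y|lborel. f (t + (-\<epsilon>) *\<^sub>R y) * of_real (gauss ((1/\<epsilon>) *\<^sub>R (t - (t + (-\<epsilon>) *\<^sub>R y))) / \<epsilon> ^ DIM('a)))"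
      using e by (subst integral_lborel_affine[of "-\<epsilon>" _ t]) auto
    also have "\<dots> = \<epsilon> ^ DIM('a) *\<^sub>R (LINT y|lborel. f (t - \<epsilon> *\<^sub>R y) * of_real (gauss y) * of_real (1 / \<epsilon> ^ DIM('a)))"
      using e by simp
    also have "\<dots> = (LINT y|lborel. f (t - \<epsilon> *\<^sub>R y) * of_real (gauss y))"
      unfolding integral_mult_left_zero using e by (simp add: scaleR_conv_of_real)
    finally show ?thesis .
  qed
  finally show ?thesis .
qed

lemma gauss_mollify_tendsto:
  fixes f :: "'a::euclidean_space \<Rightarrow> complex"
  assumes [measurable]: "f \<in> borel_measurable borel" and c: "isCont f t" and b: "\<And>x. norm (f x) \<le> C"
  shows "(\<lambda>n. LINT y|lborel. f (t + (s * (1 / real (Suc n))) *\<^sub>R y) * of_real (gauss y)) \<longlonglongrightarrow> f t"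
proof -
  have "(\<lambda>n. LINT y|lborel. f (t + (s * (1 / real (Suc n))) *\<^sub>R y) * of_real (gauss y)) \<longlonglongrightarrow>
    (LINT y|lborel. f t * of_real (gauss (y::'a)))"
  proof (rule integral_dominated_convergence)
    show "integrable lborel (\<lambda>y::'a. C * gauss y)" by (simp add: gauss_integrable)
    show "AE y in lborel. (\<lambda>n. f (t + (s * (1 / real (Suc n))) *\<^sub>R y) * of_real (gauss y)) \<longlonglongrightarrow> f t * of_real (gauss y)"
    proof (rule AE_I2, intro tendsto_intros isCont_tendsto_compose[OF c])
      fix y :: 'a
      have "(\<lambda>n. t + (s * (1 / real (Suc n))) *\<^sub>R y) \<longlonglongrightarrow> t + (s * 0) *\<^sub>R y"
        by (intro tendsto_intros LIMSEQ_Suc lim_1_over_n)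
      then show "(\<lambda>n. t + (s * (1 / real (Suc n))) *\<^sub>R y) \<longlonglongrightarrow> t" by simp
    qed
    show "AE y in lborel. norm (f (t + (s * (1 / real (Suc n))) *\<^sub>R y) * of_real (gauss y)) \<le> C * gauss y" for n
      using b by (auto simp: norm_mult less_imp_le[OF gauss_pos] intro!: mult_right_mono)
  qed measurable
  also have "(LINT y|lborel. f t * of_real (gauss (y::'a))) = f t"
    using gauss_integral[where 'a='a] by (simp add: integral_complex_of_real)
  finally show ?thesis .
qed

text \<open>Both sides of the summation formula converge, by dominated convergence: the cut-off tends to
1, and the averages tend to the value of the continuous function at \<open>t\<close>.\<close>

theorem fourier_inversion:
  fixes f :: "'a::euclidean_space \<Rightarrow> complex"
  assumes c: "continuous_on UNIV f" and b: "\<And>x. norm (f x) \<le> C"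
    and f: "integrable lborel f" and ff: "integrable lborel (fourier f)"
  shows "(LINT w|lborel. fourier f w * cis (2 * pi * (t \<bullet> w))) = f t"
proof (rule LIMSEQ_unique)
  note [measurable] = borel_measurable_integrable[OF f, simplified]
  let ?e = "\<lambda>n. 1 / real (Suc n)"
  have "(\<lambda>n. LINT y|lborel. f (t + (- 1 * ?e n) *\<^sub>R y) * of_real (gauss y)) \<longlonglongrightarrow> f t"
    using c b by (intro gauss_mollify_tendsto) (auto simp: continuous_on_eq_continuous_at)
  then show "(\<lambda>n. LINT w|lborel. fourier f w * cis (2 * pi * (t \<bullet> w)) * of_real (gauss (?e n *\<^sub>R w))) \<longlonglongrightarrow> f t"
    by (subst fourier_gauss_summation[OF f]) auto
  show "(\<lambda>n. LINT w|lborel. fourier f w * cis (2 * pi * (t \<bullet> w)) * of_real (gauss (?e n *\<^sub>R w)))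
     \<longlonglongrightarrow> (LINT w|lborel. fourier f w * cis (2 * pi * (t \<bullet> w)))"
  proof (rule integral_dominated_convergence[where w="\<lambda>w. norm (fourier f w)"])
    show "AE w in lborel. (\<lambda>n. fourier f w * cis (2 * pi * (t \<bullet> w)) * of_real (gauss (?e n *\<^sub>R w)))
         \<longlonglongrightarrow> fourier f w * cis (2 * pi * (t \<bullet> w))"
    proof (rule AE_I2)
      fix w :: 'a
      have "(\<lambda>n. fourier f w * cis (2 * pi * (t \<bullet> w)) * complex_of_real (exp (- pi * (norm (?e n *\<^sub>R w))\<^sup>2)))
         \<longlonglongrightarrow> fourier f w * cis (2 * pi * (t \<bullet> w)) * of_real (exp (- pi * (norm (0 *\<^sub>R w))\<^sup>2))"
        by (intro tendsto_intros LIMSEQ_Suc lim_1_over_n)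
      then show "(\<lambda>n. fourier f w * cis (2 * pi * (t \<bullet> w)) * of_real (gauss (?e n *\<^sub>R w)))
         \<longlonglongrightarrow> fourier f w * cis (2 * pi * (t \<bullet> w))" by (simp add: gauss_def)
    qed
    show "AE w in lborel. norm (fourier f w * cis (2 * pi * (t \<bullet> w)) * of_real (gauss (?e n *\<^sub>R w))) \<le> norm (fourier f w)" for n
      by (auto simp: norm_mult less_imp_le[OF gauss_pos] intro!: mult_left_le gauss_le_1)
  qed (use ff in auto)
qed

text \<open>The multiplication formula makes \<open>f\<close> orthogonal to every Fourier transform, and Gaussian averages of
an integrable continuous function are Fourier transforms. So \<open>f\<close> is orthogonal to the bounded ones among these functions; indicators
of open sets are their limits, and open sets generate the Borel sets.\<close>

lemma fourier_zero_imp_AE_zero: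
  fixes f :: "'a::euclidean_space \<Rightarrow> complex"
  assumes f: "integrable lborel f" and z: "\<And>w. fourier f w = 0"
  shows "AE x in lborel. f x = 0"
proof -
  note [measurable] = borel_measurable_integrable[OF f, simplified]
  let ?e = "\<lambda>n. 1 / real (Suc n)"
  have test: "(LINT x|lborel. f x * \<eta> x) = 0"
    if ch: "continuous_on UNIV \<eta>" and b: "\<And>x. norm (\<eta> x) \<le> 1" and ci: "integrable lborel \<eta>" for \<eta> :: "'a \<Rightarrow> complex"
  proof (rule LIMSEQ_unique)
    note [measurable] = borel_measurable_continuous_onI[OF ch]
    let ?m = "\<lambda>n x. LINT y|lborel. \<eta> (x + (- 1 * ?e n) *\<^sub>R y) * of_real (gauss y)"
    have nm: "norm (?m n x) \<le> 1" for n x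
    proof -
      have "norm (?m n x) \<le> (LINT y|lborel. norm (\<eta> (x + (- 1 * ?e n) *\<^sub>R y) * complex_of_real (gauss y)))"
        by (rule integral_norm_bound)
      also have "\<dots> \<le> (LINT y|lborel. gauss (y::'a))"
        by (rule integral_mono')
          (use b in \<open>auto simp: norm_mult gauss_integrable less_imp_le[OF gauss_pos] intro!: mult_left_le_one_le\<close>)
      finally show ?thesis by (simp add: gauss_integral)
    qed
    have [measurable]: "?m n \<in> borel_measurable borel" for n
    proof -
      have "?m n \<in> borel_measurable lborel"
        by (rule lborel.borel_measurable_lebesgue_integral) measurable
      then show ?thesis by simp
    qed
    show "(\<lambda>n. LINT x|lborel. f x * ?m n x) \<longlonglongrightarrow> (LINT x|lborel. f x * \<eta> x)"
    proof (rule integral_dominated_convergence[where w="\<lambda>w. norm (f w)"])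
      show "AE x in lborel. (\<lambda>n. f x * ?m n x) \<longlonglongrightarrow> f x * \<eta> x"
        using ch b by (intro AE_I2 tendsto_mult_left gauss_mollify_tendsto) (auto simp: continuous_on_eq_continuous_at)
      show "AE x in lborel. norm (f x * ?m n x) \<le> norm (f x)" for n
        using nm by (intro AE_I2) (auto simp: norm_mult intro!: mult_left_le)
    qed (use f in auto)
    have "(LINT x|lborel. f x * ?m n x) = 0" for n
    proof -
      \<comment> \<open>the averages of \<open>\<eta>\<close> are Fourier transforms, up to a reflection\<close>
      define k where "k w = complex_of_real (gauss (?e n *\<^sub>R w)) * fourier \<eta> w" for w :: 'a
      have ki: "integrable lborel k"
        unfolding k_def
        by (rule integrable_mult_bounded[OF integrable_of_real[OF fourier_gauss_scaled(1)] _ norm_fourier_le]) auto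
      have mk: "?m n (0 - x) = fourier k x" for x
        using fourier_gauss_summation[OF ci, of "?e n" "0 - x"]
        by (simp add: fourier_def k_def inner_commute mult_ac)
      have "fourier (\<lambda>x. f (0 - x)) w = fourier f (- w)" for w
        using integral_lborel_shift(2)[of "\<lambda>x. f x * cis (- 2 * pi * (x \<bullet> (- w)))" 0] by (simp add: fourier_def)
      then have fz: "fourier (\<lambda>x. f (0 - x)) w = 0" for w by (simp add: z)
      have "(LINT x|lborel. f x * ?m n x) = (LINT x|lborel. f (0 - x) * ?m n (0 - x))"
        by (rule integral_lborel_shift(2)[symmetric])
      also have "\<dots> = (LINT x|lborel. f (0 - x) * fourier k x)" by (simp only: mk)
      also have "\<dots> = (LINT x|lborel. fourier (\<lambda>x. f (0 - x)) x * k x)"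
        by (rule fourier_multiplication_formula[OF integrable_lborel_shift(2)[OF f] ki, symmetric])
      also have "\<dots> = 0" unfolding fz by simp
      finally show ?thesis .
    qed
    then show "(\<lambda>n. LINT x|lborel. f x * ?m n x) \<longlonglongrightarrow> 0" by simp
  qed
  have opn: "set_lebesgue_integral lborel U f = 0" if U: "open U" for U
  proof -
    \<comment> \<open>continuous functions with bounded support in \<open>U\<close> that converge to its indicator\<close>
    define S where "S n = - (U \<inter> ball 0 (real n))" for n :: nat
    define \<eta> where "\<eta> n x = complex_of_real (min 1 (real n * infdist x (S n)))" for n x
    have S: "S n \<noteq> {}" for n
    proof
      assume "S n = {}"
      then have "ball 0 (real n) = (UNIV :: 'a set)" unfolding S_def by blast
      then have "bounded (UNIV :: 'a set)" by (metis bounded_ball)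
      then show False by simp
    qed
    have c: "continuous_on UNIV (\<eta> n)" and b: "norm (\<eta> n x) \<le> 1" for n x
      unfolding \<eta>_def by (intro continuous_intros) (auto simp: infdist_nonneg)
    note [measurable] = borel_measurable_continuous_onI[OF c]
    have c0: "(LINT x|lborel. f x * \<eta> n x) = 0" for n
      by (rule test[OF c b bounded_support_integrable[OF borel_measurable_continuous_onI[OF c] b, where R="real n"]])
        (simp add: \<eta>_def S_def)
    have lim: "(\<lambda>n. \<eta> n x) \<longlonglongrightarrow> indicator U x" for x
    proof (cases "x \<in> U")
      case True
      then obtain r where r: "r > 0" "ball x r \<subseteq> U" using U openE by blast
      have "\<forall>\<^sub>F n in sequentially. \<eta> n x = 1"
      proof (rule eventually_sequentiallyI)
        fix n assume n: "max (nat \<lceil>norm x + r\<rceil>) (nat \<lceil>1 / r\<rceil>) \<le> n"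
        have "r \<le> dist x a" if "a \<in> S n" for a
        proof (rule ccontr)
          assume a: "\<not> r \<le> dist x a"
          then have "a \<in> U" using r(2) by auto
          moreover have "norm a \<le> norm x + dist x a" by (metis dist_norm norm_triangle_sub norm_minus_commute)
          then have "norm a < real n" using a n by linarith
          ultimately show False using that by (simp add: S_def)
        qed
        then have "r \<le> infdist x (S n)" using S by (simp add: infdist_notempty cINF_greatest)
        then have "real n * r \<le> real n * infdist x (S n)" by (intro mult_left_mono) auto
        moreover have "1 / r \<le> real n" using n by linarith
        then have "1 \<le> real n * r" using r(1) by (simp add: pos_divide_le_eq)
        ultimately show "\<eta> n x = 1" by (simp add: \<eta>_def min_def)
      qed
      then show ?thesis using True by (simp add: tendsto_eventually)
    qed (simp add: \<eta>_def S_def)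
    have "(\<lambda>n. LINT x|lborel. f x * \<eta> n x) \<longlonglongrightarrow> (LINT x|lborel. f x * indicator U x)"
    proof (rule integral_dominated_convergence[where w="\<lambda>w. norm (f w)"])
      show "AE x in lborel. norm (f x * \<eta> n x) \<le> norm (f x)" for n
        using b by (intro AE_I2) (auto simp: norm_mult intro!: mult_left_le)
    qed (use f U lim in \<open>auto intro!: tendsto_intros\<close>)
    then show ?thesis unfolding c0
      by (simp add: LIMSEQ_const_iff set_lebesgue_integral_def scaleR_conv_of_real mult.commute of_real_indicator)
  qed
  show ?thesis
  proof (rule sigma_finite_measure.density_zero[OF sigma_finite_lborel f])
    fix A :: "'a set" assume "A \<in> sets lborel"
    then have A: "A \<in> sigma_sets UNIV {S. open S}" by (simp add: borel_def)
    show "set_lebesgue_integral lborel A f = 0"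
    proof (rule sigma_sets_induct_disjoint[OF _ _ A])
      fix B assume "B \<in> sigma_sets UNIV {S::'a set. open S}"
        and 0: "set_lebesgue_integral lborel B f = 0"
      then have [measurable]: "B \<in> sets borel" by (simp add: borel_def)
      have "f x = indicat_real B x *\<^sub>R f x + indicat_real (UNIV - B) x *\<^sub>R f x" for x
        by (simp add: indicator_def)
      then have "(LINT x|lborel. f x) = (LINT x|lborel. indicat_real B x *\<^sub>R f x + indicat_real (UNIV - B) x *\<^sub>R f x)"
        by simp
      also have "\<dots> = (LINT x|lborel. indicat_real B x *\<^sub>R f x) + (LINT x|lborel. indicat_real (UNIV - B) x *\<^sub>R f x)"
        by (intro Bochner_Integration.integral_add integrable_mult_indicator f) auto
      finally show "set_lebesgue_integral lborel (UNIV - B) f = 0"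
        using 0 opn[of UNIV] by (simp add: set_lebesgue_integral_def)
    next
      fix B :: "nat \<Rightarrow> 'a set" assume d: "disjoint_family B" and r: "range B \<subseteq> sigma_sets UNIV {S. open S}"
        and 0: "\<And>i. set_lebesgue_integral lborel (B i) f = 0"
      have m: "B i \<in> sets lborel" for i using r by (auto simp: borel_def)
      have "set_lebesgue_integral lborel (\<Union>i. B i) f = (\<Sum>i. set_lebesgue_integral lborel (B i) f)"
        using d m by (intro lebesgue_integral_countable_add)
          (auto simp: disjoint_family_on_def set_integrable_def intro!: integrable_mult_indicator f)
      then show "set_lebesgue_integral lborel (\<Union> (range B)) f = 0" using 0 by simp
    qed (auto simp: Int_stable_def opn)
  qed
qed

text \<open>The energy of the
transform, damped by a Gaussian, is a Gaussian average of autocorrelations of \<open>f\<close>; each of these is at most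
the energy of \<open>f\<close>. Fatou's lemma removes the damping.\<close>

lemma fourier_bessel:
  fixes f :: "'a::euclidean_space \<Rightarrow> complex"
  assumes f: "integrable lborel f" and f2: "integrable lborel (\<lambda>x. (norm (f x))\<^sup>2)"
  shows "(\<integral>\<^sup>+w. ennreal ((norm (fourier f w))\<^sup>2) \<partial>lborel) \<le> (\<integral>\<^sup>+x. ennreal ((norm (f x))\<^sup>2) \<partial>lborel)"
proof -
  note [measurable] = borel_measurable_integrable[OF f, simplified]
  let ?e = "\<lambda>n. 1 / real (Suc n)"
  let ?N = "LINT x|lborel. (norm (f x))\<^sup>2"
  have main: "(\<integral>\<^sup>+w. ennreal ((norm (fourier f w))\<^sup>2 * gauss (\<epsilon> *\<^sub>R w)) \<partial>lborel) \<le> ennreal ?N"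
    if e: "\<epsilon> > 0" for \<epsilon>
  proof -
    let ?p = "\<lambda>w. (norm (fourier f w))\<^sup>2 * gauss (\<epsilon> *\<^sub>R w)"
    let ?K = "\<lambda>w b. (complex_of_real (gauss (\<epsilon> *\<^sub>R w)) * fourier f w * cnj (f b)) * cis (2 * pi * (b \<bullet> w))"
    let ?c = "\<lambda>b y. cnj (f b) * (f (b - \<epsilon> *\<^sub>R y) * complex_of_real (gauss y))"
    have gi: "integrable lborel (\<lambda>w::'a. complex_of_real (gauss (\<epsilon> *\<^sub>R w)))"
      by (intro integrable_of_real fourier_gauss_scaled e)
    have hi: "integrable lborel (\<lambda>w::'a. complex_of_real (gauss (\<epsilon> *\<^sub>R w)) * fourier f w)"
      by (rule integrable_mult_bounded[OF gi _ norm_fourier_le]) simp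
    have i0: "integrable (lborel \<Otimes>\<^sub>M lborel) (\<lambda>(w, b). (complex_of_real (gauss (\<epsilon> *\<^sub>R w)) * fourier f w) * cnj (f b))"
      by (intro integrable_prod_mult hi) (use f in simp)
    have i: "integrable (lborel \<Otimes>\<^sub>M lborel) (\<lambda>(w, b). ?K w b)"
      using integrable_mult_cis[OF i0, of "\<lambda>z. 2 * pi * (snd z \<bullet> fst z)"] by (simp add: case_prod_unfold)
    have c: "cnj (fourier f w) = (LINT b|lborel. cnj (f b) * cis (2 * pi * (b \<bullet> w)))" for w
      unfolding fourier_def Bochner_Integration.integral_cnj[symmetric] by (simp add: cis_cnj)
    have sq: "complex_of_real (?p w) =
      (LINT b|lborel. ?K w b)" for w
    proof -
      have "complex_of_real (?p w) =
          (complex_of_real (gauss (\<epsilon> *\<^sub>R w)) * fourier f w) * cnj (fourier f w)"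
        by (simp only: of_real_mult complex_norm_square) (simp only: ac_simps)
      also have "\<dots> = (LINT b|lborel. (complex_of_real (gauss (\<epsilon> *\<^sub>R w)) * fourier f w) * (cnj (f b) * cis (2 * pi * (b \<bullet> w))))"
        unfolding c by simp
      finally show ?thesis by (simp only: mult.assoc)
    qed
    have "integrable lborel (\<lambda>w. gauss (\<epsilon> *\<^sub>R w) * ((norm (fourier f w))\<^sup>2))"
      by (rule integrable_mult_bounded[OF fourier_gauss_scaled(1)[OF e], where C="(LINT x|lborel. norm (f x))\<^sup>2"])
        (auto intro!: power_mono norm_fourier_le)
    then have gfi: "integrable lborel (\<lambda>w. ?p w)"
      by (simp add: mult.commute)
    have "complex_of_real (LINT w|lborel. ?p w) =
        (LINT w|lborel. LINT b|lborel. ?K w b)"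
      unfolding sq[symmetric] by (rule integral_complex_of_real[symmetric])
    also have "\<dots> = (LINT b|lborel. LINT w|lborel. ?K w b)"
      by (rule lborel_pair.Fubini_integral[OF i, symmetric])
    also have "\<dots> = (LINT b|lborel. cnj (f b) * (LINT y|lborel. f (b - \<epsilon> *\<^sub>R y) * of_real (gauss y)))"
    proof (rule Bochner_Integration.integral_cong[OF refl])
      fix b
      have "(LINT w|lborel. ?K w b)
        = (LINT w|lborel. cnj (f b) * (fourier f w * cis (2 * pi * (b \<bullet> w)) * complex_of_real (gauss (\<epsilon> *\<^sub>R w))))"
        by (simp only: ac_simps)
      then show "(LINT w|lborel. ?K w b)
        = cnj (f b) * (LINT y|lborel. f (b - \<epsilon> *\<^sub>R y) * of_real (gauss y))"
        by (simp only: integral_mult_right_zero fourier_gauss_summation[OF f e])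
    qed
    finally have eq: "complex_of_real (LINT w|lborel. ?p w) =
      (LINT b|lborel. LINT y|lborel. ?c b y)" by simp
    let ?D = "\<lambda>b y. ((norm (f b))\<^sup>2 + (norm (f (b - \<epsilon> *\<^sub>R y)))\<^sup>2) / 2 * gauss y"
    have "ennreal (LINT w|lborel. ?p w) \<le>
      ennreal (norm (LINT b|lborel. LINT y|lborel. ?c b y))"
      unfolding eq[symmetric] by (intro ennreal_leI) simp
    also have "\<dots> \<le> (\<integral>\<^sup>+b. ennreal (norm (LINT y|lborel. ?c b y)) \<partial>lborel)"
      by (rule norm_integral_le_nn_integral)
    also have "\<dots> \<le> (\<integral>\<^sup>+b. (\<integral>\<^sup>+y. ennreal (norm (?c b y)) \<partial>lborel) \<partial>lborel)"
      by (intro nn_integral_mono norm_integral_le_nn_integral)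
    also have "\<dots> \<le> (\<integral>\<^sup>+b. (\<integral>\<^sup>+y. ennreal (?D b y) \<partial>lborel) \<partial>lborel)"
    proof (intro nn_integral_mono ennreal_leI)
      fix b y
      have "norm (f b) * norm (f (b - \<epsilon> *\<^sub>R y)) \<le> ((norm (f b))\<^sup>2 + (norm (f (b - \<epsilon> *\<^sub>R y)))\<^sup>2) / 2"
        using sum_squares_bound[of "norm (f b)" "norm (f (b - \<epsilon> *\<^sub>R y))"] by simp
      then show "norm (?c b y) \<le> ?D b y"
        using gauss_pos[of y] by (simp add: norm_mult mult_right_mono flip: mult.assoc)
    qed
    also have "\<dots> = (\<integral>\<^sup>+y. (\<integral>\<^sup>+b. ennreal (?D b y) \<partial>lborel) \<partial>lborel)"
      by (rule lborel_pair.Fubini'[symmetric]) measurable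
    also have "\<dots> = (\<integral>\<^sup>+y. ennreal ?N * ennreal (gauss (y::'a)) \<partial>lborel)"
    proof (rule nn_integral_cong)
      fix y :: 'a
      have s: "integrable lborel (\<lambda>b. (norm (f (b - \<epsilon> *\<^sub>R y)))\<^sup>2)"
        using integrable_lborel_shift(1)[OF f2, of "- \<epsilon> *\<^sub>R y"] by simp
      have n: "(LINT b|lborel. (norm (f (b - \<epsilon> *\<^sub>R y)))\<^sup>2) = ?N"
        using integral_lborel_shift(1)[of "\<lambda>x. (norm (f x))\<^sup>2" "- \<epsilon> *\<^sub>R y"] by simp
      have "(LINT b|lborel. ?D b y) = ?N * gauss y"
        using s f2 n by simp
      moreover have "integrable lborel (\<lambda>b. ?D b y)" using s f2 by simp
      ultimately show "(\<integral>\<^sup>+b. ennreal (?D b y) \<partial>lborel) = ennreal ?N * ennreal (gauss y)"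
        using gauss_pos[of y] by (subst nn_integral_eq_integral) (auto simp: ennreal_mult)
    qed
    also have "\<dots> = ennreal ?N"
    proof -
      have "(\<integral>\<^sup>+y. ennreal (gauss (y::'a)) \<partial>lborel) = 1"
        by (subst nn_integral_eq_integral) (auto simp: gauss_integrable gauss_integral less_imp_le[OF gauss_pos])
      then show ?thesis by (simp add: nn_integral_cmult)
    qed
    finally show ?thesis
      using gfi by (subst nn_integral_eq_integral) (auto simp: less_imp_le[OF gauss_pos])
  qed
  have "(\<integral>\<^sup>+w. ennreal ((norm (fourier f w))\<^sup>2) \<partial>lborel) =
     (\<integral>\<^sup>+w. liminf (\<lambda>n. ennreal ((norm (fourier f w))\<^sup>2 * gauss (?e n *\<^sub>R w))) \<partial>lborel)"
  proof (rule nn_integral_cong)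
    fix w :: 'a
    have "(\<lambda>n. ennreal ((norm (fourier f w))\<^sup>2 * exp (- pi * (norm (?e n *\<^sub>R w))\<^sup>2)))
      \<longlonglongrightarrow> ennreal ((norm (fourier f w))\<^sup>2 * exp (- pi * (norm (0 *\<^sub>R w))\<^sup>2))"
      by (intro tendsto_intros LIMSEQ_Suc lim_1_over_n tendsto_ennrealI)
    then have "(\<lambda>n. ennreal ((norm (fourier f w))\<^sup>2 * gauss (?e n *\<^sub>R w))) \<longlonglongrightarrow> ennreal ((norm (fourier f w))\<^sup>2)"
      by (simp add: gauss_def)
    then show "ennreal ((norm (fourier f w))\<^sup>2) = liminf (\<lambda>n. ennreal ((norm (fourier f w))\<^sup>2 * gauss (?e n *\<^sub>R w)))"
      by (simp add: lim_imp_Liminf)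
  qed
  also have "\<dots> \<le> liminf (\<lambda>n. \<integral>\<^sup>+w. ennreal ((norm (fourier f w))\<^sup>2 * gauss (?e n *\<^sub>R w)) \<partial>lborel)"
    by (rule nn_integral_liminf) measurable
  also have "\<dots> \<le> liminf (\<lambda>n::nat. ennreal ?N)"
    by (intro Liminf_mono always_eventually allI main) simp
  also have "\<dots> = (\<integral>\<^sup>+x. ennreal ((norm (f x))\<^sup>2) \<partial>lborel)"
    using f2 by (subst nn_integral_eq_integral) (auto simp: Liminf_const)
  finally show ?thesis .
qed

section \<open>The Schwartz space and its Fourier transform\<close>

abbreviation partial :: "'a::euclidean_space \<Rightarrow> ('a \<Rightarrow> complex) \<Rightarrow> 'a \<Rightarrow> complex" where
  "partial b f \<equiv> (\<lambda>x. frechet_derivative f (at x) b)"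

lemma partial_eqI: "(f has_derivative f') (at x) \<Longrightarrow> partial b f x = f' b"
  by (metis frechet_derivative_at)

lemma iter_partial_snoc: "iter_partial (bs @ [b]) f = iter_partial bs (partial b f)"
  by (induction bs) auto

lemma schwartz_iff: "f \<in> schwartz \<longleftrightarrow>
  (\<forall>bs\<in>lists Basis. (\<forall>x. iter_partial bs f differentiable at x) \<and> rapid (iter_partial bs f))"
proof -
  have "rapid h \<longleftrightarrow> (\<forall>k::nat. bounded (range (\<lambda>x. (1 + norm x) ^ k * norm (h x))))" for h :: "'a \<Rightarrow> complex"
    unfolding rapid_def bounded_iff by (auto simp: abs_mult)
  then show ?thesis by (auto simp: schwartz_def)
qed

text \<open>Membership in the Schwartz space is a greatest fixed point: a set of differentiable, rapidly
decreasing functions that is closed under partial derivatives consists of Schwartz functions. This replaces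
the Leibniz formula for iterated derivatives in all the closure properties below.\<close>

lemma schwartz_coinduct:
  assumes "f \<in> F"
    and "\<And>f x. f \<in> F \<Longrightarrow> f differentiable at x"
    and "\<And>f. f \<in> F \<Longrightarrow> rapid f"
    and "\<And>f b. f \<in> F \<Longrightarrow> b \<in> Basis \<Longrightarrow> partial b f \<in> F"
  shows "f \<in> schwartz"
proof -
  have "iter_partial bs f \<in> F" if "bs \<in> lists Basis" for bs
    using that by (induction bs) (use assms in auto)
  then show ?thesis using assms by (auto simp: schwartz_iff)
qed

lemma schwartz_differentiable: "f \<in> schwartz \<Longrightarrow> f differentiable at x"
  and schwartz_rapid: "f \<in> schwartz \<Longrightarrow> rapid f"
  by (force simp: schwartz_iff dest!: bspec[where x="[]"])+

lemma schwartz_partial: "f \<in> schwartz \<Longrightarrow> b \<in> Basis \<Longrightarrow> partial b f \<in> schwartz"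
  unfolding schwartz_iff iter_partial_snoc[symmetric] by auto

lemma schwartz_iter_partial: "f \<in> schwartz \<Longrightarrow> bs \<in> lists Basis \<Longrightarrow> iter_partial bs f \<in> schwartz"
  by (induction bs) (auto intro: schwartz_partial)

lemma schwartz_has_derivative: "f \<in> schwartz \<Longrightarrow> (f has_derivative frechet_derivative f (at x)) (at x)"
  using schwartz_differentiable frechet_derivative_works by blast

lemma schwartz_continuous: "f \<in> schwartz \<Longrightarrow> continuous_on UNIV f"
  by (simp add: continuous_on_eq_continuous_at differentiable_imp_continuous_within schwartz_differentiable)

lemma schwartz_measurable: "f \<in> schwartz \<Longrightarrow> f \<in> borel_measurable borel"
  by (intro borel_measurable_continuous_onI schwartz_continuous)

lemma schwartz_integrable: "f \<in> schwartz \<Longrightarrow> integrable lborel f"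
  by (intro rapid_integrable schwartz_measurable schwartz_rapid)

lemma rapid_bounded: "rapid f \<Longrightarrow> \<exists>C. \<forall>x. norm (f x) \<le> C"
  using rapidD[of f 0] by auto

lemma rapid_add: 
  assumes f: "rapid f" and g: "rapid g" shows "rapid (\<lambda>x. f x + g x)"
  unfolding rapid_def
proof
  fix k
  obtain C where C: "\<And>x. (1 + norm x) ^ k * norm (f x) \<le> C" using rapidD[OF f] by blast
  obtain D where D: "\<And>x. (1 + norm x) ^ k * norm (g x) \<le> D" using rapidD[OF g] by blast
  have "(1 + norm x) ^ k * norm (f x + g x) \<le> C + D" for x
  proof -
    have "(1 + norm x) ^ k * norm (f x + g x) \<le> (1 + norm x) ^ k * (norm (f x) + norm (g x))"
      by (intro mult_left_mono norm_triangle_ineq) auto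
    then show ?thesis using C[of x] D[of x] by (simp add: distrib_left)
  qed
  then show "\<exists>C. \<forall>x. (1 + norm x) ^ k * norm (f x + g x) \<le> C" by blast
qed

lemma rapid_mult_poly:
  fixes f :: "'a::real_normed_vector \<Rightarrow> 'b::real_normed_vector" and g :: "'a \<Rightarrow> 'c::real_normed_vector"
  assumes f: "rapid f" and g: "\<And>x. norm (g x) \<le> D * (1 + norm x) ^ j * norm (f x)"
  shows "rapid g"
  unfolding rapid_def
proof
  fix k
  obtain C where C: "\<And>x. (1 + norm x) ^ (k + j) * norm (f x) \<le> C" using rapidD[OF f] by blast
  have "(1 + norm x) ^ k * norm (g x) \<le> \<bar>D\<bar> * C" for x
  proof -
    have "(1 + norm x) ^ k * norm (g x) \<le> (1 + norm x) ^ k * (D * (1 + norm x) ^ j * norm (f x))"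
      by (intro mult_left_mono g) auto
    also have "\<dots> = D * ((1 + norm x) ^ (k + j) * norm (f x))" by (simp add: power_add)
    also have "\<dots> \<le> \<bar>D\<bar> * ((1 + norm x) ^ (k + j) * norm (f x))" by (intro mult_right_mono) auto
    also have "\<dots> \<le> \<bar>D\<bar> * C" by (intro mult_left_mono C) auto
    finally show ?thesis .
  qed
  then show "\<exists>C. \<forall>x. (1 + norm x) ^ k * norm (g x) \<le> C" by blast
qed

text \<open>It moves polynomial weights across translations.\<close>

lemma Peetre: "1 + norm x \<le> (1 + norm y) * (1 + norm (x - y))"
proof -
  have "norm x \<le> norm y + norm (x - y)" using norm_triangle_sub by blast
  moreover have "0 \<le> norm y * norm (x - y)" by simp
  ultimately show ?thesis unfolding distrib_left distrib_right mult_1 mult_1_right by linarith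
qed

lemma rapid_translate:
  assumes f: "rapid f" shows "rapid (\<lambda>x. f (x - a))"
  unfolding rapid_def
proof
  fix k
  obtain C where C: "\<And>x. (1 + norm x) ^ k * norm (f x) \<le> C" using rapidD[OF f] by blast
  have "(1 + norm x) ^ k * norm (f (x - a)) \<le> (1 + norm a) ^ k * C" for x
  proof -
    have "(1 + norm x) ^ k * norm (f (x - a)) \<le> ((1 + norm a) * (1 + norm (x - a))) ^ k * norm (f (x - a))"
      by (intro mult_right_mono power_mono Peetre) auto
    also have "\<dots> = (1 + norm a) ^ k * ((1 + norm (x - a)) ^ k * norm (f (x - a)))"
      by (simp add: power_mult_distrib)
    also have "\<dots> \<le> (1 + norm a) ^ k * C" by (intro mult_left_mono C) auto
    finally show ?thesis .
  qed
  then show "\<exists>C. \<forall>x. (1 + norm x) ^ k * norm (f (x - a)) \<le> C" by blast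
qed

lemma rapid_scale: "rapid f \<Longrightarrow> rapid (\<lambda>x. c * f x)" for f :: "'a::real_normed_vector \<Rightarrow> complex"
  by (rule rapid_mult_poly[of f _ "norm c" 0]) (auto simp: norm_mult)

lemma schwartz_0: "(\<lambda>_. 0) \<in> schwartz"
  by (rule schwartz_coinduct[of _ "{\<lambda>_. 0}"]) (auto simp: rapid_def)

lemma partial_add:
  "f \<in> schwartz \<Longrightarrow> h \<in> schwartz \<Longrightarrow> partial b (\<lambda>x. f x + h x) = (\<lambda>x. partial b f x + partial b h x)"
  by (intro ext, subst partial_eqI[OF has_derivative_add[OF schwartz_has_derivative schwartz_has_derivative]]) auto

lemma partial_scale: "f \<in> schwartz \<Longrightarrow> partial b (\<lambda>x. c * f x) = (\<lambda>x. c * partial b f x)"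
  by (intro ext, subst partial_eqI[OF has_derivative_mult_right[OF schwartz_has_derivative]]) auto

lemma schwartz_add:
  assumes "f \<in> schwartz" "h \<in> schwartz" shows "(\<lambda>x. f x + h x) \<in> schwartz"
proof (rule schwartz_coinduct[of _ "{\<lambda>x. f x + h x | f h. f \<in> schwartz \<and> h \<in> schwartz}"], safe)
  fix f h :: "'a \<Rightarrow> complex" and b :: 'a assume fh: "f \<in> schwartz" "h \<in> schwartz" and b: "b \<in> Basis"
  have "partial b (\<lambda>x. f x + h x) = (\<lambda>x. partial b f x + partial b h x)"
    using fh by (rule partial_add)
  then show "\<exists>f' h'. partial b (\<lambda>x. f x + h x) = (\<lambda>x. f' x + h' x) \<and> f' \<in> schwartz \<and> h' \<in> schwartz"
    using fh b by (intro exI[of _ "partial b f"] exI[of _ "partial b h"] conjI schwartz_partial)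
next
  fix f h :: "'a \<Rightarrow> complex" and x assume fh: "f \<in> schwartz" "h \<in> schwartz"
  then show "(\<lambda>x. f x + h x) differentiable at x" by (intro differentiable_add schwartz_differentiable)
next
  fix f h :: "'a \<Rightarrow> complex" assume fh: "f \<in> schwartz" "h \<in> schwartz"
  then show "rapid (\<lambda>x. f x + h x)" by (intro rapid_add schwartz_rapid)
qed (use assms in \<open>intro exI[of _ f] exI[of _ h] conjI refl\<close>)

lemma schwartz_scale:
  assumes "f \<in> schwartz" shows "(\<lambda>x. c * f x) \<in> schwartz"
proof (rule schwartz_coinduct[of _ "{\<lambda>x. c * f x | f. f \<in> schwartz}"], safe)
  fix f :: "'a \<Rightarrow> complex" and b :: 'a assume f: "f \<in> schwartz" and b: "b \<in> Basis"
  have "partial b (\<lambda>x. c * f x) = (\<lambda>x. c * partial b f x)"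
    using f by (rule partial_scale)
  then show "\<exists>f'. partial b (\<lambda>x. c * f x) = (\<lambda>x. c * f' x) \<and> f' \<in> schwartz"
    using f b by (intro exI[of _ "partial b f"] conjI schwartz_partial)
next
  fix f :: "'a \<Rightarrow> complex" and x assume "f \<in> schwartz"
  then show "(\<lambda>x. c * f x) differentiable at x"
    using has_derivative_mult_right[OF schwartz_has_derivative] unfolding differentiable_def by blast
next
  fix f :: "'a \<Rightarrow> complex" assume "f \<in> schwartz"
  then show "rapid (\<lambda>x. c * f x)" by (intro rapid_scale schwartz_rapid)
qed (use assms in \<open>intro exI[of _ f] conjI refl\<close>)

lemma schwartz_diff: "f \<in> schwartz \<Longrightarrow> h \<in> schwartz \<Longrightarrow> (\<lambda>x. f x - h x) \<in> schwartz"
  using schwartz_add[of f "\<lambda>x. -1 * h x"] schwartz_scale[of h "-1"] by simp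

lemma schwartz_sum: "(\<And>i. i \<in> I \<Longrightarrow> f i \<in> schwartz) \<Longrightarrow> (\<lambda>x. \<Sum>i\<in>I. f i x) \<in> schwartz"
  by (induction I rule: infinite_finite_induct) (auto intro: schwartz_0 schwartz_add)

lemma schwartz_cnj:
  assumes "f \<in> schwartz" shows "(\<lambda>x. cnj (f x)) \<in> schwartz"
proof (rule schwartz_coinduct[of _ "{\<lambda>x. cnj (f x) | f. f \<in> schwartz}"], safe)
  fix f :: "'a \<Rightarrow> complex" and b :: 'a assume f: "f \<in> schwartz" and b: "b \<in> Basis"
  have "partial b (\<lambda>x. cnj (f x)) = (\<lambda>x. cnj (partial b f x))"
    by (intro ext, subst partial_eqI[OF has_derivative_cnj[OF schwartz_has_derivative[OF f]]]) simp
  then show "\<exists>f'. partial b (\<lambda>x. cnj (f x)) = (\<lambda>x. cnj (f' x)) \<and> f' \<in> schwartz"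
    using f b by (intro exI[of _ "partial b f"] conjI schwartz_partial)
next
  fix f :: "'a \<Rightarrow> complex" and x assume "f \<in> schwartz"
  then show "(\<lambda>x. cnj (f x)) differentiable at x"
    using has_derivative_cnj[OF schwartz_has_derivative] unfolding differentiable_def by blast
next
  fix f :: "'a \<Rightarrow> complex" assume "f \<in> schwartz"
  then show "rapid (\<lambda>x. cnj (f x))" by (auto dest!: schwartz_rapid simp: rapid_def)
qed (use assms in \<open>intro exI[of _ f] conjI refl\<close>)

lemma schwartz_translate_has_derivative:
  assumes "f \<in> schwartz" 
  shows "((\<lambda>x. f (x - a)) has_derivative frechet_derivative f (at (x - a))) (at x)"
  using has_derivative_compose[OF has_derivative_diff[OF has_derivative_ident has_derivative_const] schwartz_has_derivative[OF assms]]
  by simp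

lemma schwartz_translate:
  assumes "f \<in> schwartz" shows "(\<lambda>x. f (x - a)) \<in> schwartz"
proof (rule schwartz_coinduct[of _ "{\<lambda>x. f (x - a) | f. f \<in> schwartz}"], safe)
  fix f :: "'a \<Rightarrow> complex" and b :: 'a assume f: "f \<in> schwartz" and b: "b \<in> Basis"
  have "partial b (\<lambda>x. f (x - a)) = (\<lambda>x. partial b f (x - a))"
    by (intro ext, subst partial_eqI[OF schwartz_translate_has_derivative[OF f]]) simp
  then show "\<exists>f'. partial b (\<lambda>x. f (x - a)) = (\<lambda>x. f' (x - a)) \<and> f' \<in> schwartz"
    using f b by (intro exI[of _ "partial b f"] conjI schwartz_partial)
next
  fix f :: "'a \<Rightarrow> complex" and x assume "f \<in> schwartz"
  then show "(\<lambda>x. f (x - a)) differentiable at x"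
    using schwartz_translate_has_derivative unfolding differentiable_def by blast
next
  fix f :: "'a \<Rightarrow> complex" assume "f \<in> schwartz"
  then show "rapid (\<lambda>x. f (x - a))" by (intro rapid_translate schwartz_rapid)
qed (use assms in \<open>intro exI[of _ f] conjI refl\<close>)

lemma schwartz_mult_coordinate_partial:
  assumes "f \<in> schwartz"
  shows "((\<lambda>x. of_real (x \<bullet> e) * f x) has_derivative
    (\<lambda>b. of_real (x \<bullet> e) * frechet_derivative f (at x) b + of_real (b \<bullet> e) * f x)) (at x)"
  by (auto intro!: derivative_eq_intros schwartz_has_derivative assms)

lemma rapid_coordinate:
  assumes "rapid f" shows "rapid (\<lambda>x. complex_of_real (x \<bullet> e) * f x)"
proof (rule rapid_mult_poly[OF assms, of _ "norm e" 1])
  fix x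
  have "\<bar>x \<bullet> e\<bar> \<le> norm e * (1 + norm x)"
    using Cauchy_Schwarz_ineq2[of x e] by (simp add: distrib_left mult.commute add_increasing)
  then show "norm (complex_of_real (x \<bullet> e) * f x) \<le> norm e * (1 + norm x) ^ 1 * norm (f x)"
    by (simp add: norm_mult mult_right_mono)
qed

text \<open>The functions \<open>x\<^sub>e f\<close> alone are not closed under derivatives; sums of such a function and a
Schwartz function are.\<close>

lemma schwartz_coordinate:
  assumes "f \<in> schwartz" shows "(\<lambda>x. of_real (x \<bullet> e) * f x) \<in> schwartz"
proof -
  let ?F = "{\<lambda>x. of_real (x \<bullet> e) * f x + h x | f h. f \<in> schwartz \<and> h \<in> schwartz}"
  have "(\<lambda>x. of_real (x \<bullet> e) * f x + 0) \<in> schwartz"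
  proof (rule schwartz_coinduct[of _ ?F])
    fix u and b :: 'a assume "u \<in> ?F" and b: "b \<in> Basis"
    then obtain f h where u: "u = (\<lambda>x. of_real (x \<bullet> e) * f x + h x)" and fh: "f \<in> schwartz" "h \<in> schwartz" by blast
    have "partial b u = (\<lambda>x. of_real (x \<bullet> e) * partial b f x + (of_real (b \<bullet> e) * f x + partial b h x))"
      unfolding u
      by (intro ext, subst partial_eqI[OF has_derivative_add[OF schwartz_mult_coordinate_partial schwartz_has_derivative]])
        (use fh in simp_all)
    moreover have "partial b f \<in> schwartz" "(\<lambda>x. of_real (b \<bullet> e) * f x + partial b h x) \<in> schwartz"
      using fh b by (auto intro!: schwartz_partial schwartz_add schwartz_scale)
    ultimately show "partial b u \<in> ?F"
      by (intro CollectI exI[of _ "partial b f"] exI[of _ "\<lambda>x. of_real (b \<bullet> e) * f x + partial b h x"] conjI)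
  next
    fix u x assume "u \<in> ?F"
    then show "u differentiable at x"
      using has_derivative_add[OF schwartz_mult_coordinate_partial schwartz_has_derivative]
      unfolding differentiable_def by blast
  next
    fix u assume "u \<in> ?F"
    then show "rapid u" by (auto intro!: rapid_add[OF rapid_coordinate[OF schwartz_rapid] schwartz_rapid])
  qed (use assms in \<open>simp, intro exI[of _ f] exI[of _ "\<lambda>_. 0"] conjI schwartz_0, simp_all\<close>)
  then show ?thesis by simp
qed

abbreviation modulate :: "'a::euclidean_space \<Rightarrow> 'a \<Rightarrow> complex" where
  "modulate w t \<equiv> cis (- 2 * pi * (t \<bullet> w))"

lemma modulate_has_derivative:
  "(modulate w has_derivative (\<lambda>b. - (2 * pi * (b \<bullet> w)) *\<^sub>R (\<i> * modulate w t))) (at t)"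
proof -
  have "((\<lambda>t. - 2 * pi * (t \<bullet> w)) has_derivative (\<lambda>b. - 2 * pi * (b \<bullet> w))) (at t)"
    by (auto intro!: derivative_eq_intros)
  then have "((\<lambda>t. \<i> * complex_of_real (- 2 * pi * (t \<bullet> w))) has_derivative (\<lambda>b. \<i> * of_real (- 2 * pi * (b \<bullet> w)))) (at t)"
    by (rule has_derivative_mult_right[OF has_derivative_of_real])
  from has_derivative_compose[OF this DERIV_exp[THEN has_field_derivative_imp_has_derivative]]
  show ?thesis
    unfolding cis_conv_exp
    by (rule has_derivative_eq_rhs) (auto simp: fun_eq_iff scaleR_conv_of_real algebra_simps)
qed

lemma schwartz_modulate_has_derivative:
  assumes "f \<in> schwartz"
  shows "((\<lambda>t. f t * modulate w t) has_derivative
    (\<lambda>b. (frechet_derivative f (at t) b + of_real (b \<bullet> w) * (- 2 * pi * \<i> * f t)) * modulate w t)) (at t)"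
  by (rule has_derivative_eq_rhs[OF has_derivative_mult[OF schwartz_has_derivative[OF assms] modulate_has_derivative]])
    (auto simp: fun_eq_iff scaleR_conv_of_real algebra_simps)

lemma schwartz_modulate_partial:
  "f \<in> schwartz \<Longrightarrow> partial b (\<lambda>t. f t * modulate w t) = 
    (\<lambda>t. (partial b f t + of_real (b \<bullet> w) * (- 2 * pi * \<i> * f t)) * modulate w t)"
  by (intro ext, subst partial_eqI[OF schwartz_modulate_has_derivative]) auto

lemma schwartz_modulate:
  assumes "f \<in> schwartz" shows "(\<lambda>t. f t * modulate w t) \<in> schwartz"
proof (rule schwartz_coinduct[of _ "{\<lambda>t. f t * modulate w t | f. f \<in> schwartz}"], safe)
  fix f :: "'a \<Rightarrow> complex" and b :: 'a assume f: "f \<in> schwartz" and b: "b \<in> Basis"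
  then have "(\<lambda>t. partial b f t + of_real (b \<bullet> w) * (- 2 * pi * \<i> * f t)) \<in> schwartz"
    by (intro schwartz_add schwartz_partial schwartz_scale)
  then show "\<exists>f'. partial b (\<lambda>t. f t * modulate w t) = (\<lambda>t. f' t * modulate w t) \<and> f' \<in> schwartz"
    unfolding schwartz_modulate_partial[OF f] by (intro exI conjI) (rule refl)
next
  fix f :: "'a \<Rightarrow> complex" and x assume "f \<in> schwartz"
  then show "(\<lambda>t. f t * modulate w t) differentiable at x"
    using schwartz_modulate_has_derivative unfolding differentiable_def by blast
next
  fix f :: "'a \<Rightarrow> complex" assume "f \<in> schwartz"
  then show "rapid (\<lambda>t. f t * modulate w t)"
    by (auto simp: rapid_def dest!: schwartz_rapid)
qed (use assms in \<open>intro exI[of _ f] conjI refl\<close>)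

text \<open>Finite sums of products, the closure of the products under partial derivatives.\<close>

inductive_set schwartz_products :: "('a::euclidean_space \<Rightarrow> complex) set" where
  mult: "f \<in> schwartz \<Longrightarrow> h \<in> schwartz \<Longrightarrow> (\<lambda>x. f x * h x) \<in> schwartz_products"
| add: "u \<in> schwartz_products \<Longrightarrow> v \<in> schwartz_products \<Longrightarrow> (\<lambda>x. u x + v x) \<in> schwartz_products"

lemma has_derivative_partials:
  "f differentiable at x \<Longrightarrow> (f has_derivative (\<lambda>b. partial b f x)) (at x)"
  using frechet_derivative_works by auto

lemma partial_mult:
  assumes "f differentiable at x" "h differentiable at x"
  shows "partial b (\<lambda>x. f x * h x) x = partial b f x * h x + f x * partial b h x"
  by (subst partial_eqI[OF has_derivative_mult[OF assms[THEN has_derivative_partials]]]) simp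

lemma schwartz_mult:
  assumes "f \<in> schwartz" "h \<in> schwartz" shows "(\<lambda>x. f x * h x) \<in> schwartz"
proof (rule schwartz_coinduct[of _ schwartz_products])
  show diff: "u differentiable at x" if "u \<in> schwartz_products" for u and x :: 'a
    using that by induction (auto intro: differentiable_add differentiable_mult dest: schwartz_differentiable)
  show "rapid u" if "u \<in> schwartz_products" for u :: "'a \<Rightarrow> complex"
    using that
  proof induction
    case (mult f h)
    then obtain C where "\<And>x. norm (h x) \<le> C" using rapid_bounded schwartz_rapid by blast
    then show ?case
      by (intro rapid_mult_poly[OF schwartz_rapid[OF mult(1)], of _ C 0])
        (auto simp: norm_mult mult.commute[of C] mult_left_mono)
  qed (rule rapid_add)
  show "partial b u \<in> schwartz_products" if "u \<in> schwartz_products" "b \<in> Basis" for u and b :: 'a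
    using that
  proof induction
    case (mult f h)
    have "partial b (\<lambda>x. f x * h x) = (\<lambda>x. partial b f x * h x + f x * partial b h x)"
      using mult by (intro ext partial_mult schwartz_differentiable)
    then show ?case
      using schwartz_products.add[OF schwartz_products.mult[OF schwartz_partial[OF mult(1,3)] mult(2)]
        schwartz_products.mult[OF mult(1) schwartz_partial[OF mult(2,3)]]] by simp
  next
    case (add u v)
    have "partial b (\<lambda>x. u x + v x) = (\<lambda>x. partial b u x + partial b v x)"
      by (intro ext, subst partial_eqI[OF has_derivative_add[OF add(1,2)[THEN diff, THEN has_derivative_partials]]]) simp
    then show ?case using schwartz_products.add[OF add(3,4)] add(5) by simp
  qed
qed (use assms in \<open>rule schwartz_products.mult\<close>)

text \<open>The mean value inequality. The weight at \<open>t\<close> is compared with the weight at the intermediate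
points of the segment, at the price of a power of \<open>1 + \<bar>v\<bar>\<close>.\<close>

lemma schwartz_increment:
  assumes f: "f \<in> schwartz"
  shows "\<exists>C\<ge>0. \<forall>t v. (1 + norm t) ^ k * norm (f (t + v) - f t) \<le> C * (1 + norm v) ^ k * norm v"
proof -
  have "\<forall>b\<in>Basis. \<exists>C. C \<ge> 0 \<and> (\<forall>z. (1 + norm z) ^ k * norm (partial b f z) \<le> C)"
    using rapidD[OF schwartz_rapid[OF schwartz_partial[OF f]]] by blast
  then obtain C where C: "\<And>b. b \<in> Basis \<Longrightarrow> C b \<ge> 0"
      "\<And>b z. b \<in> Basis \<Longrightarrow> (1 + norm z) ^ k * norm (partial b f z) \<le> C b"
    by (metis bchoice)
  let ?C = "\<Sum>b\<in>Basis. C b"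
  have der: "(1 + norm z) ^ k * norm (frechet_derivative f (at z) a) \<le> ?C * norm a" for z a
  proof -
    interpret bounded_linear "frechet_derivative f (at z)"
      using schwartz_has_derivative[OF f] has_derivative_bounded_linear by blast
    have "frechet_derivative f (at z) a = (\<Sum>b\<in>Basis. (a \<bullet> b) *\<^sub>R partial b f z)"
      by (subst euclidean_representation[of a, symmetric]) (simp add: sum scaleR del: euclidean_representation)
    then have "(1 + norm z) ^ k * norm (frechet_derivative f (at z) a) \<le> (1 + norm z) ^ k * (\<Sum>b\<in>Basis. \<bar>a \<bullet> b\<bar> * norm (partial b f z))"
      by (intro mult_left_mono) (auto intro!: sum_norm_le)
    also have "\<dots> = (\<Sum>b\<in>Basis. \<bar>a \<bullet> b\<bar> * ((1 + norm z) ^ k * norm (partial b f z)))"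
      by (simp add: sum_distrib_left mult.left_commute)
    also have "\<dots> \<le> (\<Sum>b\<in>Basis. norm a * C b)"
      by (intro sum_mono mult_mono C Basis_le_norm) auto
    finally show ?thesis by (simp add: sum_distrib_left mult.commute)
  qed
  have "(1 + norm t) ^ k * norm (f (t + v) - f t) \<le> ?C * (1 + norm v) ^ k * norm v" for t v
  proof -
    let ?p = "(1 + norm t) ^ k"
    have p: "?p > 0" by (simp add: add_pos_nonneg)
    have "onorm (frechet_derivative f (at (t + s *\<^sub>R v))) \<le> ?C * (1 + norm v) ^ k / ?p" if s: "s \<in> {0..1}" for s
    proof (rule onorm_le)
      fix a
      let ?z = "t + s *\<^sub>R v"
      have "1 + norm t \<le> (1 + norm ?z) * (1 + norm (t - ?z))" by (rule Peetre)
      also have "\<dots> \<le> (1 + norm ?z) * (1 + norm v)"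
        using s by (intro mult_left_mono) (auto intro: mult_left_le_one_le)
      finally have "?p \<le> ((1 + norm ?z) * (1 + norm v)) ^ k" by (rule power_mono) simp
      from mult_right_mono[OF this norm_ge_zero[of "frechet_derivative f (at ?z) a"]]
      have "?p * norm (frechet_derivative f (at ?z) a)
          \<le> (1 + norm v) ^ k * ((1 + norm ?z) ^ k * norm (frechet_derivative f (at ?z) a))"
        by (simp only: power_mult_distrib ac_simps)
      also have "\<dots> \<le> (1 + norm v) ^ k * (?C * norm a)" by (intro mult_left_mono der) auto
      finally show "norm (frechet_derivative f (at ?z) a) \<le> ?C * (1 + norm v) ^ k / ?p * norm a"
        using p by (simp add: pos_le_divide_eq mult.commute mult.left_commute)
    qed
    then have "norm (f (t + v) - f t) \<le> norm v * (?C * (1 + norm v) ^ k / ?p)"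
      by (intro differentiable_bound_segment[of t v UNIV f "\<lambda>z. frechet_derivative f (at z)"])
        (auto intro: schwartz_has_derivative[OF f])
    from mult_left_mono[OF this less_imp_le[OF p]]
    have "?p * norm (f (t + v) - f t) \<le> ?p * (norm v * (?C * (1 + norm v) ^ k / ?p))" .
    also have "\<dots> = ?C * (1 + norm v) ^ k * norm v"
    proof -
      have "q * (a * (X / q)) = X * a" if "q > 0" for q a X :: real using that by simp
      from this[OF p] show ?thesis .
    qed
    finally show ?thesis .
  qed
  moreover have "?C \<ge> 0" using C by (intro sum_nonneg) auto
  ultimately show ?thesis by blast
qed

lemma difference_quotient_tendsto_partial:
  fixes f :: "'a::euclidean_space \<Rightarrow> complex"
  assumes d: "f differentiable at t" and b: "b \<noteq> 0"
  shows "(\<lambda>n. of_nat (Suc n) * (f (t + (1 / real (Suc n)) *\<^sub>R b) - f t)) \<longlonglongrightarrow> partial b f t"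
proof -
  let ?e = "\<lambda>n. 1 / real (Suc n)"
  let ?D = "\<lambda>h. frechet_derivative f (at t) h"
  have D: "(f has_derivative ?D) (at t)" using d frechet_derivative_works by blast
  interpret bounded_linear ?D using D by (rule has_derivative_bounded_linear)
  have "(\<lambda>n. ?e n *\<^sub>R b) \<longlonglongrightarrow> 0 *\<^sub>R b" by (intro tendsto_intros LIMSEQ_Suc lim_1_over_n)
  then have "filterlim (\<lambda>n. ?e n *\<^sub>R b) (at 0) sequentially"
    using b by (auto simp: filterlim_at intro!: always_eventually)
  moreover have "((\<lambda>h. norm (f (t + h) - f t - ?D h) / norm h) \<longlongrightarrow> 0) (at 0)"
    using D by (auto simp: has_derivative_at)
  ultimately have "(\<lambda>n. norm (f (t + ?e n *\<^sub>R b) - f t - ?D (?e n *\<^sub>R b)) / norm (?e n *\<^sub>R b)) \<longlonglongrightarrow> 0"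
    by (rule filterlim_compose[rotated])
  then have "(\<lambda>n. norm (f (t + ?e n *\<^sub>R b) - f t - ?D (?e n *\<^sub>R b)) / norm (?e n *\<^sub>R b) * norm b) \<longlonglongrightarrow> 0 * norm b"
    by (intro tendsto_intros)
  moreover have "norm (f (t + ?e n *\<^sub>R b) - f t - ?D (?e n *\<^sub>R b)) / norm (?e n *\<^sub>R b) * norm b =
      norm (of_nat (Suc n) * (f (t + ?e n *\<^sub>R b) - f t) - ?D b)" for n
  proof -
    have "of_nat (Suc n) * (f (t + ?e n *\<^sub>R b) - f t) - ?D b = of_nat (Suc n) * (f (t + ?e n *\<^sub>R b) - f t - ?D (?e n *\<^sub>R b))"
      by (simp add: scaleR scaleR_conv_of_real right_diff_distrib del: of_nat_Suc)
    then have "norm (of_nat (Suc n) * (f (t + ?e n *\<^sub>R b) - f t) - ?D b) =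
        real (Suc n) * norm (f (t + ?e n *\<^sub>R b) - f t - ?D (?e n *\<^sub>R b))"
      by (simp only: norm_mult norm_of_nat)
    then show ?thesis using b by (simp del: of_nat_Suc)
  qed
  ultimately have "(\<lambda>n. norm (of_nat (Suc n) * (f (t + ?e n *\<^sub>R b) - f t) - ?D b)) \<longlonglongrightarrow> 0"
    by simp
  then show ?thesis using tendsto_norm_zero_iff LIM_zero_iff by blast
qed

lemma schwartz_difference_quotient_le:
  assumes f: "f \<in> schwartz" and b: "b \<in> Basis"
  shows "\<exists>C. \<forall>n t. (1 + norm t) ^ k * norm (of_nat (Suc n) * (f (t + (1 / real (Suc n)) *\<^sub>R b) - f t)) \<le> C"
proof -
  obtain C where C: "C \<ge> 0" "\<And>t v. (1 + norm t) ^ k * norm (f (t + v) - f t) \<le> C * (1 + norm v) ^ k * norm v"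
    using schwartz_increment[OF f] by blast
  have "(1 + norm t) ^ k * norm (of_nat (Suc n) * (f (t + (1 / real (Suc n)) *\<^sub>R b) - f t)) \<le> C * 2 ^ k" for n t
  proof -
    let ?v = "(1 / real (Suc n)) *\<^sub>R b"
    have v: "norm ?v = 1 / real (Suc n)" using b by (simp del: of_nat_Suc)
    have "(1 + norm t) ^ k * norm (of_nat (Suc n) * (f (t + ?v) - f t)) = real (Suc n) * ((1 + norm t) ^ k * norm (f (t + ?v) - f t))"
      by (simp add: norm_mult del: of_nat_Suc)
    also have "\<dots> \<le> real (Suc n) * (C * (1 + norm ?v) ^ k * norm ?v)" by (intro mult_left_mono C) simp
    also have "\<dots> = C * (1 + norm ?v) ^ k" unfolding v by (simp del: of_nat_Suc)
    also have "\<dots> \<le> C * 2 ^ k" using C(1) unfolding v by (intro mult_left_mono power_mono) auto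
    finally show ?thesis .
  qed
  then show ?thesis by blast
qed

text \<open>Difference quotients have integral 0 by translation invariance, and they converge
dominatedly to the derivative.\<close>

lemma integral_partial_eq_0:
  fixes f :: "'a::euclidean_space \<Rightarrow> complex"
  assumes f: "f \<in> schwartz" and b: "b \<in> Basis"
  shows "(LINT t|lborel. partial b f t) = 0"
proof (rule LIMSEQ_unique)
  let ?q = "\<lambda>n t. of_nat (Suc n) * (f (t + (1 / real (Suc n)) *\<^sub>R b) - f t)"
  note [measurable] = schwartz_measurable[OF f] schwartz_measurable[OF schwartz_partial[OF f b]]
  obtain C where C: "\<And>n t. (1 + norm t) ^ (2 * DIM('a)) * norm (?q n t) \<le> C"
    using schwartz_difference_quotient_le[OF f b] by blast
  show "(\<lambda>n. LINT t|lborel. ?q n t) \<longlonglongrightarrow> (LINT t|lborel. partial b f t)"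
  proof (rule integral_dominated_convergence)
    show "integrable lborel (\<lambda>t::'a. C * inverse ((1 + norm t) ^ (2 * DIM('a))))"
      by (intro integrable_mult_right integrable_inverse_norm_power)
    show "AE t in lborel. (\<lambda>n. ?q n t) \<longlonglongrightarrow> partial b f t"
      using b by (intro AE_I2 difference_quotient_tendsto_partial schwartz_differentiable f) auto
    have "norm (?q n t) \<le> C * inverse ((1 + norm t) ^ (2 * DIM('a)))" for n t
      using C[of t n] by (simp add: pos_le_divide_eq add_pos_nonneg mult.commute flip: divide_inverse)
    then show "AE t in lborel. norm (?q n t) \<le> C * inverse ((1 + norm t) ^ (2 * DIM('a)))" for n by simp
  qed measurable
  have "(LINT t|lborel. ?q n t) = 0" for n
    using integral_lborel_shift(1)[of f "(1 / real (Suc n)) *\<^sub>R b"]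
      integrable_lborel_shift(1)[OF schwartz_integrable[OF f], of "(1 / real (Suc n)) *\<^sub>R b"] schwartz_integrable[OF f]
    by (simp add: add.commute del: of_nat_Suc)
  then show "(\<lambda>n. LINT t|lborel. ?q n t) \<longlonglongrightarrow> 0" by (simp only: tendsto_const)
qed

lemma fourier_add: 
  "integrable lborel f \<Longrightarrow> integrable lborel h \<Longrightarrow> fourier (\<lambda>x. f x + h x) w = fourier f w + fourier h w"
  unfolding fourier_def distrib_right by (intro Bochner_Integration.integral_add integrable_mult_cis) auto

lemma fourier_scale: "fourier (\<lambda>x. c * f x) w = c * fourier f w"
  by (simp add: fourier_def mult.assoc)

lemma fourier_partial:
  assumes f: "f \<in> schwartz" and b: "b \<in> Basis"
  shows "fourier (partial b f) w = 2 * pi * \<i> * of_real (w \<bullet> b) * fourier f w"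
proof -
  have i: "integrable lborel (\<lambda>t. partial b f t * modulate w t)" "integrable lborel (\<lambda>t. f t * modulate w t)"
    using schwartz_integrable[OF schwartz_modulate[OF schwartz_partial[OF f b], of w]]
      schwartz_integrable[OF schwartz_modulate[OF f, of w]] by simp_all
  have "0 = (LINT t|lborel. partial b f t * modulate w t - 2 * pi * \<i> * of_real (w \<bullet> b) * (f t * modulate w t))"
    using integral_partial_eq_0[OF schwartz_modulate[OF f] b, of w]
    unfolding schwartz_modulate_partial[OF f] by (simp add: algebra_simps inner_commute)
  also have "\<dots> = fourier (partial b f) w - 2 * pi * \<i> * of_real (w \<bullet> b) * fourier f w"
    using i unfolding fourier_def by (subst Bochner_Integration.integral_diff) auto
  finally show ?thesis by simp
qed

text \<open>Decay of the Fourier transform by repeated integration by parts, uniformly in a parameter \<open>i\<close>.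
Differentiation may split a member of the family into two, as it does for products; a set \<open>U\<close> of
families closed under this splitting replaces an explicit count of the terms.\<close>

lemma fourier_decay_family:
  fixes U :: "('i \<Rightarrow> 'a::euclidean_space \<Rightarrow> complex) set" and W :: "'i \<Rightarrow> real"
  assumes S: "\<And>u i. u \<in> U \<Longrightarrow> u i \<in> schwartz" and W: "\<And>i. W i \<ge> 0"
    and der: "\<And>u b. u \<in> U \<Longrightarrow> b \<in> Basis \<Longrightarrow> \<exists>v\<in>U. \<exists>v'\<in>U. \<forall>i. partial b (u i) = (\<lambda>t. v i t + v' i t)"
    and base: "\<And>u. u \<in> U \<Longrightarrow> \<exists>C. \<forall>i. W i * (LINT t|lborel. norm (u i t)) \<le> C"
    and u: "u \<in> U"
  shows "\<exists>C. \<forall>i w. W i * (1 + norm w) ^ k * norm (fourier (u i) w) \<le> C"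
  using u
proof (induction k arbitrary: u)
  case 0
  then obtain C where C: "\<And>i. W i * (LINT t|lborel. norm (u i t)) \<le> C" using base by blast
  have "W i * norm (fourier (u i) w) \<le> C" for i w
    using mult_left_mono[OF norm_fourier_le W[of i]] C[of i] by (rule order_trans)
  then show ?case by auto
next
  case (Suc k)
  obtain C where C: "\<And>i w. W i * (1 + norm w) ^ k * norm (fourier (u i) w) \<le> C" using Suc by blast
  have "\<forall>b\<in>Basis. \<exists>D. \<forall>i w. W i * (1 + norm w) ^ k * norm (fourier (partial b (u i)) w) \<le> D"
  proof
    fix b :: 'a assume b: "b \<in> Basis"
    then obtain v v' where v: "v \<in> U" "v' \<in> U" "\<And>i. partial b (u i) = (\<lambda>t. v i t + v' i t)"
      using der[OF Suc(2)] by blast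
    obtain D D' where D: "\<And>i w. W i * (1 + norm w) ^ k * norm (fourier (v i) w) \<le> D"
        "\<And>i w. W i * (1 + norm w) ^ k * norm (fourier (v' i) w) \<le> D'"
      using Suc.IH[OF v(1)] Suc.IH[OF v(2)] by blast
    have "W i * (1 + norm w) ^ k * norm (fourier (partial b (u i)) w) \<le> D + D'" for i w
    proof -
      have "fourier (partial b (u i)) w = fourier (v i) w + fourier (v' i) w"
        unfolding v by (intro fourier_add schwartz_integrable S v)
      then have "W i * (1 + norm w) ^ k * norm (fourier (partial b (u i)) w)
         \<le> W i * (1 + norm w) ^ k * (norm (fourier (v i) w) + norm (fourier (v' i) w))"
        using W by (simp add: mult_left_mono norm_triangle_ineq)
      then show ?thesis using D[of i w] by (simp add: distrib_left)
    qed
    then show "\<exists>D. \<forall>i w. W i * (1 + norm w) ^ k * norm (fourier (partial b (u i)) w) \<le> D" by blast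
  qed
  then obtain D where D: "\<And>b i w. b \<in> Basis \<Longrightarrow> W i * (1 + norm w) ^ k * norm (fourier (partial b (u i)) w) \<le> D b"
    by (metis bchoice)
  have "W i * (1 + norm w) ^ Suc k * norm (fourier (u i) w) \<le> C + (\<Sum>b\<in>Basis. D b)" for i w
  proof -
    let ?a = "W i * (1 + norm w) ^ k"
    have a: "?a \<ge> 0" using W by simp
    have "\<bar>w \<bullet> b\<bar> * norm (fourier (u i) w) \<le> norm (fourier (partial b (u i)) w)" if "b \<in> Basis" for b
    proof -
      have "norm (fourier (partial b (u i)) w) = 2 * pi * (\<bar>w \<bullet> b\<bar> * norm (fourier (u i) w))"
        by (subst fourier_partial[OF S[OF Suc(2)] that]) (simp add: norm_mult)
      moreover have "1 * (\<bar>w \<bullet> b\<bar> * norm (fourier (u i) w)) \<le> 2 * pi * (\<bar>w \<bullet> b\<bar> * norm (fourier (u i) w))"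
        using pi_gt3 by (intro mult_right_mono) auto
      ultimately show ?thesis by simp
    qed
    then have "?a * (\<Sum>b\<in>Basis. \<bar>w \<bullet> b\<bar> * norm (fourier (u i) w)) \<le> ?a * (\<Sum>b\<in>Basis. norm (fourier (partial b (u i)) w))"
      using a by (intro mult_left_mono sum_mono)
    also have "\<dots> \<le> (\<Sum>b\<in>Basis. D b)"
      unfolding sum_distrib_left by (intro sum_mono D)
    finally have 1: "?a * (\<Sum>b\<in>Basis. \<bar>w \<bullet> b\<bar> * norm (fourier (u i) w)) \<le> (\<Sum>b\<in>Basis. D b)" .
    have "norm w * norm (fourier (u i) w) \<le> (\<Sum>b\<in>Basis. \<bar>w \<bullet> b\<bar> * norm (fourier (u i) w))"
      using mult_right_mono[OF norm_le_l1[of w] norm_ge_zero[of "fourier (u i) w"]] by (simp add: sum_distrib_right)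
    from mult_left_mono[OF this a] 1 C[of i w] show ?thesis
      by (simp add: algebra_simps)
  qed
  then show ?case by blast
qed

lemma rapid_fourier:
  assumes "f \<in> schwartz" shows "rapid (fourier f)"
  unfolding rapid_def
proof
  fix k
  have "\<exists>C. \<forall>i w. 1 * (1 + norm w) ^ k * norm (fourier ((\<lambda>_::unit. f) i) w) \<le> C"
  proof (rule fourier_decay_family[where U="{\<lambda>_. f | f. f \<in> schwartz}"])
    fix u :: "unit \<Rightarrow> 'a \<Rightarrow> complex" and b :: 'a assume "u \<in> {\<lambda>_. f | f. f \<in> schwartz}" and b: "b \<in> Basis"
    then obtain f where f: "u = (\<lambda>_. f)" "f \<in> schwartz" by blast
    show "\<exists>v\<in>{\<lambda>_. f | f. f \<in> schwartz}. \<exists>v'\<in>{\<lambda>_. f | f. f \<in> schwartz}. \<forall>i. partial b (u i) = (\<lambda>t. v i t + v' i t)"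
      using f schwartz_partial[OF f(2) b] schwartz_0
      by (intro bexI[of _ "\<lambda>_. partial b f"] bexI[of _ "\<lambda>_ _. 0"]) auto
  qed (use assms in auto)
  then show "\<exists>C. \<forall>w. (1 + norm w) ^ k * norm (fourier f w) \<le> C" by simp
qed

text \<open>The remainder is controlled by \<open>\<bar>cis \<theta> - 1 - \<i> \<theta>\<bar> \<le> \<theta>\<^sup>2 / 2\<close>, which makes it quadratic
in the increment, with the second moment of \<open>f\<close> as constant.\<close>

lemma fourier_has_derivative:
  fixes f :: "'a::euclidean_space \<Rightarrow> complex"
  assumes f: "f \<in> schwartz"
  shows "(fourier f has_derivative (\<lambda>v. fourier (\<lambda>x. (- 2 * pi * \<i>) * (of_real (x \<bullet> v) * f x)) w)) (at w)"
    (is "(_ has_derivative ?D) _")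
proof (rule has_derivativeI_sandwich[of 1])
  have S: "(\<lambda>x. of_real (x \<bullet> v) * f x) \<in> schwartz" for v using f by (rule schwartz_coordinate)
  have i: "integrable lborel (\<lambda>x. of_real (x \<bullet> v) * f x)" for v by (intro schwartz_integrable S)
  have "linear ?D"
  proof (rule linearI)
    fix u v :: 'a and r :: real
    show "?D (u + v) = ?D u + ?D v"
      by (subst fourier_add[symmetric]) (intro integrable_mult_right i, intro integrable_mult_right i,
        simp add: inner_add_right algebra_simps)
    show "?D (r *\<^sub>R v) = r *\<^sub>R ?D v"
      unfolding scaleR_conv_of_real by (subst fourier_scale[symmetric]) (simp add: algebra_simps)
  qed
  then show "bounded_linear ?D" by (rule linear_conv_bounded_linear[THEN iffD1])
  define H where "H = (\<lambda>x. norm (of_real (norm x ^ 2) * f x))"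
  have rH: "rapid (\<lambda>x. of_real (norm x ^ 2) * f x)"
    by (rule rapid_mult_poly[OF schwartz_rapid[OF f], of _ 1 2])
      (auto simp: norm_mult norm_power intro!: mult_right_mono power_mono)
  note [measurable] = schwartz_measurable[OF f]
  have Hi: "integrable lborel H"
    unfolding H_def by (intro integrable_norm rapid_integrable rH) measurable
  let ?C = "2 * pi\<^sup>2 * (LINT x|lborel. H x)"
  show "norm (fourier f y - fourier f w - ?D (y - w)) / norm (y - w) \<le> ?C * norm (y - w)" if "y \<noteq> w" for y
  proof -
    let ?v = "y - w"
    have "fourier f y - fourier f w - ?D ?v = (LINT x|lborel. f x * modulate w x * (cis (- 2 * pi * (x \<bullet> ?v)) - 1 - \<i> * of_real (- 2 * pi * (x \<bullet> ?v))))"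
    proof -
      have e: "f x * modulate y x - f x * modulate w x - (- 2 * pi * \<i>) * (of_real (x \<bullet> ?v) * f x) * modulate w x =
        f x * modulate w x * (cis (- 2 * pi * (x \<bullet> ?v)) - 1 - \<i> * of_real (- 2 * pi * (x \<bullet> ?v)))" for x
      proof -
        have "modulate y x = modulate w x * cis (- 2 * pi * (x \<bullet> ?v))"
          by (simp add: cis_mult inner_diff_right algebra_simps)
        then show ?thesis by (simp add: algebra_simps)
      qed
      have 1: "integrable lborel (\<lambda>x. f x * modulate y x)" for y
        by (rule integrable_mult_cis[OF schwartz_integrable[OF f]]) simp
      have 2: "integrable lborel (\<lambda>x. (- 2 * pi * \<i>) * (of_real (x \<bullet> ?v) * f x) * modulate w x)"
        by (rule integrable_mult_cis[OF integrable_mult_right[OF i[of ?v]]]) simp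
      show ?thesis unfolding fourier_def e[symmetric]
        by (simp only: Bochner_Integration.integral_diff[OF Bochner_Integration.integrable_diff[OF 1 1] 2]
          Bochner_Integration.integral_diff[OF 1 1])
    qed
    also have "norm \<dots> \<le> (LINT x|lborel. 2 * pi\<^sup>2 * (norm ?v)\<^sup>2 * H x)"
    proof (rule order_trans[OF integral_norm_bound integral_mono'])
      show "integrable lborel (\<lambda>x. 2 * pi\<^sup>2 * (norm ?v)\<^sup>2 * H x)" using Hi by simp
      fix x
      let ?\<theta> = "- 2 * pi * (x \<bullet> ?v)"
      have "norm (cis ?\<theta> - 1 - \<i> * of_real ?\<theta>) \<le> \<bar>?\<theta>\<bar>\<^sup>2 / 2"
        using iexp_approx1[of ?\<theta> 1] by (simp add: cis_conv_exp numeral_2_eq_2 algebra_simps)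
      also have "\<dots> = 2 * pi\<^sup>2 * \<bar>x \<bullet> ?v\<bar>\<^sup>2" by (simp add: power_mult_distrib abs_mult)
      also have "\<dots> \<le> 2 * pi\<^sup>2 * (norm x * norm ?v)\<^sup>2"
        by (intro mult_left_mono power_mono Cauchy_Schwarz_ineq2) auto
      finally have "norm (f x) * norm (cis ?\<theta> - 1 - \<i> * of_real ?\<theta>) \<le> norm (f x) * (2 * pi\<^sup>2 * (norm x * norm ?v)\<^sup>2)"
        by (rule mult_left_mono) simp
      then show "norm (f x * modulate w x * (cis ?\<theta> - 1 - \<i> * of_real ?\<theta>)) \<le> 2 * pi\<^sup>2 * (norm ?v)\<^sup>2 * H x"
        by (simp add: norm_mult norm_power H_def power_mult_distrib mult_ac)
    qed (auto simp: H_def)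
    finally have "norm (fourier f y - fourier f w - ?D ?v) \<le> ?C * norm ?v * norm ?v"
      by (simp add: power2_eq_square mult_ac)
    then show ?thesis using that by (simp add: pos_divide_le_eq)
  qed
  have "((\<lambda>y. ?C * norm (y - w)) \<longlongrightarrow> ?C * norm (w - w)) (at w)" by (intro tendsto_intros)
  then show "((\<lambda>y. ?C * norm (y - w)) \<longlongrightarrow> 0) (at w)" by simp
qed simp

lemma fourier_schwartz:
  assumes "f \<in> schwartz" shows "fourier f \<in> schwartz"
proof (rule schwartz_coinduct[of _ "fourier ` schwartz"])
  fix u :: "'a \<Rightarrow> complex" and x assume "u \<in> fourier ` schwartz"
  then show "u differentiable at x" using fourier_has_derivative unfolding differentiable_def by blast
next
  fix u :: "'a \<Rightarrow> complex" and b :: 'a assume "u \<in> fourier ` schwartz" and b: "b \<in> Basis"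
  then obtain f where f: "u = fourier f" "f \<in> schwartz" by blast
  have "partial b u = fourier (\<lambda>x. (- 2 * pi * \<i>) * (of_real (x \<bullet> b) * f x))"
    unfolding f(1) by (intro ext partial_eqI fourier_has_derivative f)
  then show "partial b u \<in> fourier ` schwartz"
    using schwartz_scale[OF schwartz_coordinate[OF f(2)]] by blast
qed (use assms rapid_fourier in auto)

section \<open>Windowed coefficients and time-frequency shifts\<close>

text \<open>The coefficient of \<open>h\<close> dual to the short-time Fourier transform with window \<open>\<gamma>\<close>: up to conjugations it is the
short-time Fourier transform of \<open>h\<close> at the same point of phase space. The window enters without
conjugation, since it is to meet the conjugate window of \<open>stft\<close>.\<close>

definition window_coeff :: "('a::euclidean_space \<Rightarrow> complex) \<Rightarrow> ('a \<Rightarrow> complex) \<Rightarrow> 'a \<times> 'a \<Rightarrow> complex" where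
  "window_coeff \<gamma> h z = fourier (\<lambda>t. h t * \<gamma> (t - fst z)) (- snd z)"

lemma window_coeff_altdef: "window_coeff \<gamma> h (x, w) = (LINT t|lborel. h t * \<gamma> (t - x) * cis (2 * pi * (t \<bullet> w)))"
  by (simp add: window_coeff_def fourier_def)

lemma borel_measurable_fst_snd[measurable]:
  "(fst :: 'a::second_countable_topology \<times> 'b::second_countable_topology \<Rightarrow> 'a) \<in> borel_measurable borel"
  "(snd :: 'a::second_countable_topology \<times> 'b::second_countable_topology \<Rightarrow> 'b) \<in> borel_measurable borel"
  by (auto intro!: borel_measurable_continuous_onI continuous_intros)

lemma cnj_measurable[measurable]: "cnj \<in> borel_measurable borel"
  by (intro borel_measurable_continuous_onI continuous_intros)

lemma window_coeff_measurable:
  assumes [measurable]: "\<gamma> \<in> borel_measurable borel" "h \<in> borel_measurable borel"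
  shows "window_coeff \<gamma> h \<in> borel_measurable borel"
proof -
  have "(\<lambda>z. LINT t|lborel. h t * \<gamma> (t - fst z) * cis (2 * pi * (t \<bullet> snd z))) \<in> borel_measurable lborel"
    by (rule lborel.borel_measurable_lebesgue_integral) measurable
  then show ?thesis by (simp add: window_coeff_def[abs_def] fourier_def)
qed

lemma norm_prod_bounds:
  fixes z :: "'a::real_normed_vector \<times> 'b::real_normed_vector"
  shows "norm (fst z) \<le> norm z" "norm (snd z) \<le> norm z" "1 + norm z \<le> (1 + norm (fst z)) * (1 + norm (snd z))"
proof -
  show "norm (fst z) \<le> norm z" "norm (snd z) \<le> norm z"
    by (metis norm_fst_le norm_snd_le prod.collapse)+
  have "norm z \<le> norm (fst z) + norm (snd z)" by (metis norm_Pair_le prod.collapse)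
  moreover have "0 \<le> norm (fst z) * norm (snd z)" by simp
  ultimately show "1 + norm z \<le> (1 + norm (fst z)) * (1 + norm (snd z))"
    unfolding distrib_left distrib_right mult_1 mult_1_right by linarith
qed

text \<open>Decay in the frequency comes from integration by parts, decay in space from the overlap
of \<open>h\<close> with the translated window.\<close>

lemma rapid_window_coeff:
  assumes g: "\<gamma> \<in> schwartz" and h: "h \<in> schwartz"
  shows "rapid (window_coeff \<gamma> h)"
  unfolding rapid_def
proof
  fix k
  let ?U = "{\<lambda>x t. h t * \<gamma> (t - x) | h \<gamma>. h \<in> schwartz \<and> \<gamma> \<in> schwartz} :: ('a \<Rightarrow> 'a \<Rightarrow> complex) set"
  have "\<exists>C. \<forall>x w. (1 + norm x) ^ k * (1 + norm w) ^ k * norm (fourier ((\<lambda>x t. h t * \<gamma> (t - x)) x) w) \<le> C"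
  proof (rule fourier_decay_family[where U="?U"])
    fix u and x :: 'a assume "u \<in> ?U"
    then show "u x \<in> schwartz" by (auto intro!: schwartz_mult schwartz_translate)
  next
    fix u and b :: 'a assume "u \<in> ?U" and b: "b \<in> Basis"
    then obtain h \<gamma> where u: "u = (\<lambda>x t. h t * \<gamma> (t - x))" and hg: "h \<in> schwartz" "\<gamma> \<in> schwartz" by blast
    have "partial b (u x) = (\<lambda>t. partial b h t * \<gamma> (t - x) + h t * partial b \<gamma> (t - x))" for x
    proof
      fix t
      have "partial b (u x) t = partial b h t * \<gamma> (t - x) + h t * partial b (\<lambda>t. \<gamma> (t - x)) t"
        unfolding u by (rule partial_mult[OF schwartz_differentiable[OF hg(1)] schwartz_differentiable[OF schwartz_translate[OF hg(2)]]])
      then show "partial b (u x) t = partial b h t * \<gamma> (t - x) + h t * partial b \<gamma> (t - x)"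
        by (simp add: partial_eqI[OF schwartz_translate_has_derivative[OF hg(2)]])
    qed
    moreover have "(\<lambda>x t. partial b h t * \<gamma> (t - x)) \<in> ?U"
      using schwartz_partial[OF hg(1) b] hg by (intro CollectI exI[of _ "partial b h"] exI[of _ \<gamma>]) auto
    moreover have "(\<lambda>x t. h t * partial b \<gamma> (t - x)) \<in> ?U"
      using schwartz_partial[OF hg(2) b] hg by (intro CollectI exI[of _ h] exI[of _ "partial b \<gamma>"]) auto
    ultimately show "\<exists>v\<in>?U. \<exists>v'\<in>?U. \<forall>i. partial b (u i) = (\<lambda>t. v i t + v' i t)"
      by (intro bexI[of _ "\<lambda>x t. partial b h t * \<gamma> (t - x)"] bexI[of _ "\<lambda>x t. h t * partial b \<gamma> (t - x)"]) auto
  next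
    fix u assume "u \<in> ?U"
    then obtain h \<gamma> where u: "u = (\<lambda>x t. h t * \<gamma> (t - x))" and hg: "h \<in> schwartz" "\<gamma> \<in> schwartz" by blast
    obtain C where C: "\<And>x. (1 + norm x) ^ k * norm (\<gamma> x) \<le> C" using rapidD[OF schwartz_rapid[OF hg(2)]] by blast
    note [measurable] = schwartz_measurable[OF hg(1)]
    let ?h = "\<lambda>t. of_real ((1 + norm t) ^ k) * h t"
    have nh: "norm (?h t) = (1 + norm t) ^ k * norm (h t)" for t
      by (simp add: norm_mult del: of_real_power of_real_add)
    have "rapid ?h"
      by (rule rapid_mult_poly[OF schwartz_rapid[OF hg(1)], of _ 1 k])
        (simp add: norm_mult del: of_real_power of_real_add)
    then have hi: "integrable lborel (\<lambda>t. C * norm (?h t))"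
      by (intro integrable_mult_right integrable_norm rapid_integrable) auto
    have "(1 + norm x) ^ k * (LINT t|lborel. norm (u x t)) \<le> (LINT t|lborel. C * norm (?h t))" for x
    proof -
      have "(1 + norm x) ^ k * (LINT t|lborel. norm (u x t)) = (LINT t|lborel. (1 + norm x) ^ k * norm (u x t))" by simp
      also have "\<dots> \<le> (LINT t|lborel. C * norm (?h t))"
      proof (rule integral_mono'[OF hi])
        fix t
        have "(1 + norm x) ^ k \<le> ((1 + norm t) * (1 + norm (x - t))) ^ k" by (intro power_mono Peetre) auto
        then have "(1 + norm x) ^ k * norm (u x t) \<le> ((1 + norm t) * (1 + norm (t - x))) ^ k * norm (u x t)"
          by (intro mult_right_mono) (auto simp: norm_minus_commute)
        also have "\<dots> = norm (?h t) * ((1 + norm (t - x)) ^ k * norm (\<gamma> (t - x)))"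
          unfolding nh by (simp add: u norm_mult power_mult_distrib)
        also have "\<dots> \<le> norm (?h t) * C" by (intro mult_left_mono C) auto
        finally show "(1 + norm x) ^ k * norm (u x t) \<le> C * norm (?h t)" by (simp add: mult.commute)
        show "0 \<le> C * norm (?h t)"
          using order_trans[OF _ C[of 0]] by (intro mult_nonneg_nonneg) auto
      qed
      finally show ?thesis .
    qed
    then show "\<exists>C. \<forall>x. (1 + norm x) ^ k * (LINT t|lborel. norm (u x t)) \<le> C" by blast
  qed (use g h in auto)
  then obtain C where C: "\<And>x w. (1 + norm x) ^ k * (1 + norm w) ^ k * norm (fourier (\<lambda>t. h t * \<gamma> (t - x)) w) \<le> C"
    by blast
  have "(1 + norm z) ^ k * norm (window_coeff \<gamma> h z) \<le> C" for z
  proof -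
    have "(1 + norm z) ^ k * norm (window_coeff \<gamma> h z) \<le> ((1 + norm (fst z)) * (1 + norm (snd z))) ^ k * norm (window_coeff \<gamma> h z)"
      by (intro mult_right_mono power_mono norm_prod_bounds) auto
    also have "\<dots> \<le> C" using C[of "fst z" "- snd z"] by (simp add: window_coeff_def power_mult_distrib)
    finally show ?thesis .
  qed
  then show "\<exists>C. \<forall>z. (1 + norm z) ^ k * norm (window_coeff \<gamma> h z) \<le> C" by blast
qed

lemma integrable_window_coeff:
  "\<gamma> \<in> schwartz \<Longrightarrow> h \<in> schwartz \<Longrightarrow> integrable lborel (window_coeff \<gamma> h)"
  by (intro rapid_integrable window_coeff_measurable rapid_window_coeff schwartz_measurable)

definition tf_shift :: "('a::euclidean_space \<Rightarrow> complex) \<Rightarrow> 'a \<times> 'a \<Rightarrow> 'a \<Rightarrow> complex" where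
  "tf_shift f z = (\<lambda>t. f (t - fst z) * modulate (snd z) t)"

lemma stft_eq: "stft g T z = T (tf_shift (\<lambda>t. cnj (g t)) z)"
  by (simp add: stft_def tf_shift_def case_prod_unfold)

lemma schwartz_tf_shift: "f \<in> schwartz \<Longrightarrow> tf_shift f z \<in> schwartz"
  unfolding tf_shift_def by (intro schwartz_modulate schwartz_translate)

text \<open>Fourier inversion in the frequency variable recovers the product of \<open>h\<close> with the window
translated by \<open>x\<close>; integration over \<open>x\<close> then turns the window into its squared norm.\<close>

lemma window_coeff_reconstruct:
  fixes g h :: "'a::euclidean_space \<Rightarrow> complex"
  assumes g: "g \<in> schwartz" and h: "h \<in> schwartz"
  shows "(LINT z|lborel. window_coeff g h z * tf_shift (\<lambda>t. cnj (g t)) z t) = h t * of_real (LINT x|lborel. (norm (g x))\<^sup>2)"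
proof -
  note [measurable] = schwartz_measurable[OF g] schwartz_measurable[OF h] window_coeff_measurable
  let ?F = "\<lambda>z. window_coeff g h z * tf_shift (\<lambda>t. cnj (g t)) z t"
  obtain C where C: "\<And>x. norm (g x) \<le> C" using rapid_bounded[OF schwartz_rapid[OF g]] by blast
  have "integrable lborel ?F"
    by (rule integrable_mult_bounded[OF integrable_window_coeff[OF g h], where C=C]) (auto simp: tf_shift_def C)
  then have i: "integrable (lborel \<Otimes>\<^sub>M lborel) ?F" unfolding lborel_prod .
  have "(LINT z|lborel. ?F z) = (LINT z|(lborel \<Otimes>\<^sub>M lborel). ?F z)" unfolding lborel_prod ..
  also have "\<dots> = (LINT x|lborel. LINT w|lborel. ?F (x, w))"
    by (rule lborel_pair.integral_fst'[OF i, symmetric])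
  also have "\<dots> = (LINT x|lborel. h t * of_real ((norm (g (t - x)))\<^sup>2))"
  proof (rule Bochner_Integration.integral_cong[OF refl])
    fix x
    let ?k = "\<lambda>t. h t * g (t - x)"
    have k: "?k \<in> schwartz" by (intro schwartz_mult schwartz_translate g h)
    have "(LINT w|lborel. ?F (x, w)) = (LINT w|lborel. cnj (g (t - x)) * (fourier ?k (0 - w) * cis (2 * pi * (t \<bullet> (0 - w)))))"
      by (simp add: window_coeff_def tf_shift_def mult_ac)
    also have "\<dots> = cnj (g (t - x)) * (LINT w|lborel. fourier ?k w * cis (2 * pi * (t \<bullet> w)))"
      using integral_lborel_shift(2)[of "\<lambda>w. fourier ?k w * cis (2 * pi * (t \<bullet> w))" 0] by simp
    also obtain D where D: "\<And>x. norm (?k x) \<le> D" using rapid_bounded[OF schwartz_rapid[OF k]] by blast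
    have "(LINT w|lborel. fourier ?k w * cis (2 * pi * (t \<bullet> w))) = ?k t"
      by (rule fourier_inversion[OF schwartz_continuous[OF k] D])
        (intro schwartz_integrable fourier_schwartz k)+
    finally show "(LINT w|lborel. ?F (x, w)) = h t * of_real ((norm (g (t - x)))\<^sup>2)"
      by (simp add: complex_norm_square mult_ac del: of_real_power)
  qed
  also have "\<dots> = h t * of_real (LINT x|lborel. (norm (g (t - x)))\<^sup>2)"
    by (simp only: integral_mult_right_zero integral_complex_of_real)
  also have "(LINT x|lborel. (norm (g (t - x)))\<^sup>2) = (LINT x|lborel. (norm (g x))\<^sup>2)"
    by (rule integral_lborel_shift(2))
  finally show ?thesis .
qed

lemma iter_partial_add:
  assumes "f \<in> schwartz" "h \<in> schwartz" "bs \<in> lists Basis"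
  shows "iter_partial bs (\<lambda>x. f x + h x) = (\<lambda>x. iter_partial bs f x + iter_partial bs h x)"
  using assms(3)
proof (induction bs)
  case (Cons b bs)
  then have "iter_partial bs f \<in> schwartz" "iter_partial bs h \<in> schwartz"
    using assms by (auto intro: schwartz_iter_partial)
  then show ?case
    using Cons by (simp add: partial_add)
qed simp

lemma iter_partial_scale:
  assumes "f \<in> schwartz" "bs \<in> lists Basis"
  shows "iter_partial bs (\<lambda>x. c * f x) = (\<lambda>x. c * iter_partial bs f x)"
  using assms(2)
proof (induction bs)
  case (Cons b bs)
  then have "iter_partial bs f \<in> schwartz"
    using assms by (auto intro: schwartz_iter_partial)
  then show ?case
    using Cons by (simp add: partial_scale)
qed simp

lemma iter_partial_diff:
  assumes "f \<in> schwartz" "h \<in> schwartz" "bs \<in> lists Basis"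
  shows "iter_partial bs (\<lambda>x. f x - h x) = (\<lambda>x. iter_partial bs f x - iter_partial bs h x)"
  using iter_partial_add[OF assms(1) schwartz_scale[OF assms(2), of "-1"] assms(3)]
    iter_partial_scale[OF assms(2,3), of "-1"] by simp

lemma iter_partial_sum:
  assumes "\<And>i. i \<in> I \<Longrightarrow> f i \<in> schwartz" "bs \<in> lists Basis"
  shows "iter_partial bs (\<lambda>x. \<Sum>i\<in>I. f i x) = (\<lambda>x. \<Sum>i\<in>I. iter_partial bs (f i) x)"
  using assms
proof (induction I rule: infinite_finite_induct)
  case (insert i I)
  then show ?case by (simp add: iter_partial_add schwartz_sum)
qed (use iter_partial_scale[OF schwartz_0 assms(2), of 0] in auto)

text \<open>The innermost derivative is split off, because it acts on the shifted function by a formula that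
stays within time-frequency shifts of Schwartz functions.\<close>

lemma iter_partial_tf_shift:
  assumes f: "f \<in> schwartz" and "b \<in> Basis" "bs \<in> lists Basis"
  shows "iter_partial (bs @ [b]) (tf_shift f z) =
    (\<lambda>t. iter_partial bs (tf_shift (partial b f) z) t + of_real (b \<bullet> snd z) * (- 2 * pi * \<i>) * iter_partial bs (tf_shift f z) t)"
proof -
  have "partial b (tf_shift f z) = (\<lambda>t. (partial b (\<lambda>t. f (t - fst z)) t + of_real (b \<bullet> snd z) * (- 2 * pi * \<i> * f (t - fst z))) * modulate (snd z) t)"
    unfolding tf_shift_def by (rule schwartz_modulate_partial[OF schwartz_translate[OF f]])
  also have "partial b (\<lambda>t. f (t - fst z)) = (\<lambda>t. partial b f (t - fst z))"
    by (intro ext, subst partial_eqI[OF schwartz_translate_has_derivative[OF f]]) simp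
  finally have "partial b (tf_shift f z) = (\<lambda>t. tf_shift (partial b f) z t + of_real (b \<bullet> snd z) * (- 2 * pi * \<i>) * tf_shift f z t)"
    by (simp add: tf_shift_def algebra_simps)
  then show ?thesis
    using assms unfolding iter_partial_snoc
    by (simp only: iter_partial_add iter_partial_scale schwartz_tf_shift schwartz_scale schwartz_partial)
qed

lemma power_add_mono:
  fixes a :: real
  assumes "1 \<le> a" "C \<ge> 0" "m \<le> n" shows "C * a ^ m \<le> C * a ^ n"
  using assms by (intro mult_left_mono power_increasing) auto

lemma norm_modulation_factor:
  fixes b :: "'a::euclidean_space"
  assumes "b \<in> Basis"
  shows "norm (of_real (b \<bullet> w) * (- 2 * pi * \<i>)) \<le> 2 * pi * norm w"
proof -
  have "\<bar>b \<bullet> w\<bar> \<le> norm w" using Basis_le_norm[OF assms, of w] by (simp add: inner_commute)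
  then show ?thesis by (simp add: norm_mult mult_left_mono)
qed

lemma norm_cis_diff_le: "norm (cis a - cis b) \<le> \<bar>a - b\<bar>"
proof -
  have "cis a - cis b = cis b * (cis (a - b) - 1)" by (simp add: right_diff_distrib cis_mult)
  then have "norm (cis a - cis b) = norm (cis (a - b) - 1)" by (simp add: norm_mult)
  also have "\<dots> \<le> \<bar>a - b\<bar>" using iexp_approx1[of "a - b" 0] by (simp add: cis_conv_exp)
  finally show ?thesis .
qed

text \<open>The seminorms of \<open>tf_shift f 0 = f\<close> are finite, so polynomial growth in the shift follows from the
Lipschitz estimate; the induction below needs both at the same time.\<close>

lemma tf_shift_bound_if_lipschitz:
  assumes f: "f \<in> schwartz" "bs \<in> lists Basis"
    and L: "C \<ge> 0" "\<And>z y t. (1 + norm t) ^ k * norm (iter_partial bs (tf_shift f z) t - iter_partial bs (tf_shift f y) t)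
      \<le> C * (1 + norm z + norm y) ^ M * norm (z - y)"
  shows "\<exists>C\<ge>0. \<exists>M. \<forall>z t. (1 + norm t) ^ k * norm (iter_partial bs (tf_shift f z) t) \<le> C * (1 + norm z) ^ M"
proof -
  let ?D = "\<lambda>z t. iter_partial bs (tf_shift f z) t"
  have "rapid (?D 0)" by (intro schwartz_rapid schwartz_iter_partial schwartz_tf_shift f)
  then obtain B where B: "B \<ge> 0" "\<And>t. (1 + norm t) ^ k * norm (?D 0 t) \<le> B" using rapidD by blast
  have "(1 + norm t) ^ k * norm (?D z t) \<le> (C + B) * (1 + norm z) ^ (M + 1)" for z t
  proof -
    have "(1 + norm t) ^ k * norm (?D z t) \<le> (1 + norm t) ^ k * (norm (?D z t - ?D 0 t) + norm (?D 0 t))"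
      using norm_triangle_ineq[of "?D z t - ?D 0 t" "?D 0 t"] by (intro mult_left_mono) auto
    also have "\<dots> \<le> C * (1 + norm z) ^ M * norm z + B * 1"
      using add_mono[OF L(2)[of t z 0] B(2)[of t]] by (simp add: distrib_left)
    also have "\<dots> \<le> C * (1 + norm z) ^ M * (1 + norm z) + B * (1 + norm z) ^ (M + 1)"
      using L(1) B(1) by (intro add_mono mult_left_mono one_le_power) auto
    finally show ?thesis by (simp add: algebra_simps)
  qed
  then show ?thesis using L(1) B(1) by (intro exI[of _ "C + B"] conjI exI[of _ "M + 1"]) auto
qed

text \<open>Translation is controlled by the increment of \<open>f\<close>, modulation by the increment of the exponential, which
costs one power of \<open>1 + \<bar>t\<bar>\<close>. In the induction step the factor produced by differentiating the exponential also
depends on the shift, so the polynomial bound enters. Both estimates together yield growth and continuity of the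
short-time Fourier transform.\<close>

lemma tf_shift_lipschitz:
  assumes "f \<in> schwartz" "bs \<in> lists Basis"
  shows "\<exists>C\<ge>0. \<exists>M. \<forall>z y t. (1 + norm t) ^ k * norm (iter_partial bs (tf_shift f z) t - iter_partial bs (tf_shift f y) t)
    \<le> C * (1 + norm z + norm y) ^ M * norm (z - y)"
  using assms(2,1)
proof (induction bs arbitrary: f rule: rev_induct)
  case Nil
  obtain C where C: "C \<ge> 0" "\<And>t v. (1 + norm t) ^ k * norm (f (t + v) - f t) \<le> C * (1 + norm v) ^ k * norm v"
    using schwartz_increment[OF Nil(2)] by blast
  obtain D where D: "D \<ge> 0" "\<And>x. (1 + norm x) ^ (k + 1) * norm (f x) \<le> D" using rapidD[OF schwartz_rapid[OF Nil(2)]] by blast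
  let ?C = "C + 2 * pi * D" and ?M = "2 * k + 1"
  have "(1 + norm t) ^ k * norm (iter_partial [] (tf_shift f z) t - iter_partial [] (tf_shift f y) t)
    \<le> ?C * (1 + norm z + norm y) ^ ?M * norm (z - y)" for z y t
  proof -
    let ?p = "(1 + norm t) ^ k" and ?R = "1 + norm z + norm y" and ?x = "t - fst y" and ?v = "fst y - fst z"
    have v: "norm ?v \<le> norm (z - y)" "norm (snd z - snd y) \<le> norm (z - y)"
      using norm_prod_bounds(1,2)[of "z - y"] by (auto simp: norm_minus_commute)
    have v': "1 + norm ?v \<le> ?R"
      using norm_triangle_ineq4[of "fst y" "fst z"] norm_prod_bounds(1)[of z] norm_prod_bounds(1)[of y] by linarith
    have y': "1 + norm (fst y) \<le> ?R" using norm_prod_bounds(1)[of y] norm_ge_zero[of z] by linarith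
    have R: "?R \<ge> 1" by simp
    have P: "?p \<le> ?R ^ k * (1 + norm ?x) ^ k"
    proof -
      have "?p \<le> ((1 + norm (fst y)) * (1 + norm ?x)) ^ k" by (intro power_mono Peetre) auto
      also have "\<dots> \<le> (?R * (1 + norm ?x)) ^ k" using y' by (intro power_mono mult_right_mono) auto
      finally show ?thesis by (simp only: power_mult_distrib)
    qed
    have "tf_shift f z t - tf_shift f y t = (f (?x + ?v) - f ?x) * modulate (snd z) t + f ?x * (modulate (snd z) t - modulate (snd y) t)"
      by (simp add: tf_shift_def algebra_simps)
    then have "norm (tf_shift f z t - tf_shift f y t) \<le> norm (f (?x + ?v) - f ?x) + norm (f ?x) * norm (modulate (snd z) t - modulate (snd y) t)"
      by (metis norm_triangle_ineq norm_mult norm_mult_cis)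
    also have "norm (modulate (snd z) t - modulate (snd y) t) \<le> 2 * pi * ((1 + norm t) * norm (z - y))"
    proof -
      have "norm (modulate (snd z) t - modulate (snd y) t) \<le> \<bar>- 2 * pi * (t \<bullet> snd z) - (- 2 * pi * (t \<bullet> snd y))\<bar>"
        by (rule norm_cis_diff_le)
      also have "\<dots> = 2 * pi * \<bar>t \<bullet> (snd z - snd y)\<bar>"
        by (simp add: inner_diff_right abs_mult flip: right_diff_distrib)
      also have "\<bar>t \<bullet> (snd z - snd y)\<bar> \<le> norm t * norm (snd z - snd y)" by (rule Cauchy_Schwarz_ineq2)
      also have "\<dots> \<le> (1 + norm t) * norm (z - y)" by (intro mult_mono v) auto
      finally show ?thesis by simp
    qed
    finally have "norm (tf_shift f z t - tf_shift f y t) \<le> norm (f (?x + ?v) - f ?x) + norm (f ?x) * (2 * pi * ((1 + norm t) * norm (z - y)))"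
      by (simp add: mult_left_mono)
    then have "?p * norm (tf_shift f z t - tf_shift f y t) \<le> ?p * (norm (f (?x + ?v) - f ?x) + norm (f ?x) * (2 * pi * ((1 + norm t) * norm (z - y))))"
      by (rule mult_left_mono) auto
    also have "\<dots> = ?p * norm (f (?x + ?v) - f ?x) + 2 * pi * norm (z - y) * ((1 + norm t) ^ (k + 1) * norm (f ?x))"
      by (simp add: algebra_simps)
    also have "?p * norm (f (?x + ?v) - f ?x) \<le> C * ?R ^ ?M * norm (z - y)"
    proof -
      have "?p * norm (f (?x + ?v) - f ?x) \<le> ?R ^ k * ((1 + norm ?x) ^ k * norm (f (?x + ?v) - f ?x))"
        using mult_right_mono[OF P norm_ge_zero[of "f (?x + ?v) - f ?x"]] by (simp only: mult.assoc)
      also have "\<dots> \<le> ?R ^ k * (C * (1 + norm ?v) ^ k * norm ?v)" by (intro mult_left_mono C) auto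
      also have "\<dots> \<le> ?R ^ k * (C * ?R ^ k * norm (z - y))"
        using C(1) v v' by (intro mult_left_mono mult_mono power_mono) auto
      also have "\<dots> = C * ?R ^ (2 * k) * norm (z - y)" by (simp add: power_add mult_2)
      also have "\<dots> \<le> C * ?R ^ ?M * norm (z - y)" using C(1) R by (intro mult_right_mono power_add_mono) auto
      finally show ?thesis .
    qed
    also have "(1 + norm t) ^ (k + 1) * norm (f ?x) \<le> ?R ^ ?M * D"
    proof -
      have "(1 + norm t) ^ (k + 1) \<le> ((1 + norm (fst y)) * (1 + norm ?x)) ^ (k + 1)" by (intro power_mono Peetre) auto
      also have "\<dots> \<le> (?R * (1 + norm ?x)) ^ (k + 1)" using y' by (intro power_mono mult_right_mono) auto
      also have "\<dots> = ?R ^ (k + 1) * (1 + norm ?x) ^ (k + 1)" by (simp only: power_mult_distrib)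
      finally have "(1 + norm t) ^ (k + 1) * norm (f ?x) \<le> ?R ^ (k + 1) * (1 + norm ?x) ^ (k + 1) * norm (f ?x)"
        by (rule mult_right_mono) simp
      also have "\<dots> = ?R ^ (k + 1) * ((1 + norm ?x) ^ (k + 1) * norm (f ?x))" by (simp only: mult.assoc)
      also have "\<dots> \<le> ?R ^ ?M * D" using R by (intro mult_mono D power_increasing) auto
      finally show ?thesis .
    qed
    finally have "?p * norm (tf_shift f z t - tf_shift f y t) \<le> C * ?R ^ ?M * norm (z - y) + 2 * pi * norm (z - y) * (?R ^ ?M * D)"
      by (simp add: mult_left_mono)
    then show ?thesis by (simp add: algebra_simps)
  qed
  moreover have "?C \<ge> 0" using C(1) D(1) by simp
  ultimately show ?case by blast
next
  case (snoc b bs)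
  have b: "b \<in> Basis" "bs \<in> lists Basis" using snoc.prems by auto
  obtain C1 M1 where 1: "C1 \<ge> 0" "\<And>z y t. (1 + norm t) ^ k * norm (iter_partial bs (tf_shift (partial b f) z) t - iter_partial bs (tf_shift (partial b f) y) t)
      \<le> C1 * (1 + norm z + norm y) ^ M1 * norm (z - y)"
    using snoc.IH[OF b(2) schwartz_partial[OF snoc.prems(2) b(1)]] by blast
  obtain C2 M2 where 2: "C2 \<ge> 0" "\<And>z y t. (1 + norm t) ^ k * norm (iter_partial bs (tf_shift f z) t - iter_partial bs (tf_shift f y) t)
      \<le> C2 * (1 + norm z + norm y) ^ M2 * norm (z - y)"
    using snoc.IH[OF b(2) snoc.prems(2)] by blast
  obtain C3 M3 where 3: "C3 \<ge> 0" "\<And>z t. (1 + norm t) ^ k * norm (iter_partial bs (tf_shift f z) t) \<le> C3 * (1 + norm z) ^ M3"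
    using tf_shift_bound_if_lipschitz[OF snoc.prems(2) b(2) 2] by blast
  let ?M = "M1 + M2 + M3 + 1" and ?C = "C1 + 2 * pi * C2 + 2 * pi * C3"
  have "(1 + norm t) ^ k * norm (iter_partial (bs @ [b]) (tf_shift f z) t - iter_partial (bs @ [b]) (tf_shift f y) t)
     \<le> ?C * (1 + norm z + norm y) ^ ?M * norm (z - y)" for z y t
  proof -
    let ?p = "(1 + norm t) ^ k" and ?c = "\<lambda>w. of_real (b \<bullet> w) * (- 2 * pi * \<i>) :: complex" and ?R = "1 + norm z + norm y"
    let ?A = "\<lambda>z. iter_partial bs (tf_shift (partial b f) z) t" and ?B = "\<lambda>z. iter_partial bs (tf_shift f z) t"
    have R: "?R \<ge> 1" by simp
    have c: "norm (?c (snd z)) \<le> 2 * pi * ?R"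
      using norm_modulation_factor[OF b(1), of "snd z"] 
      by (rule order_trans) (use norm_prod_bounds(2)[of z] norm_ge_zero[of y] in \<open>intro mult_left_mono; linarith?\<close>, simp)
    have cd: "norm (?c (snd z - snd y)) \<le> 2 * pi * norm (z - y)"
      using norm_modulation_factor[OF b(1), of "snd z - snd y"] 
      by (rule order_trans) (use norm_prod_bounds(2)[of "z - y"] in \<open>auto intro!: mult_left_mono\<close>)
    have "iter_partial (bs @ [b]) (tf_shift f z) t - iter_partial (bs @ [b]) (tf_shift f y) t =
      (?A z - ?A y) + (?c (snd z) * (?B z - ?B y) + ?c (snd z - snd y) * ?B y)"
      unfolding iter_partial_tf_shift[OF snoc.prems(2) b] by (simp add: inner_diff_right algebra_simps)
    then have "norm (iter_partial (bs @ [b]) (tf_shift f z) t - iter_partial (bs @ [b]) (tf_shift f y) t) \<le>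
      norm (?A z - ?A y) + (norm (?c (snd z)) * norm (?B z - ?B y) + norm (?c (snd z - snd y)) * norm (?B y))"
      unfolding norm_mult[symmetric] by (metis norm_triangle_le norm_triangle_ineq add_left_mono)
    then have "?p * norm (iter_partial (bs @ [b]) (tf_shift f z) t - iter_partial (bs @ [b]) (tf_shift f y) t) \<le>
      ?p * (norm (?A z - ?A y) + (norm (?c (snd z)) * norm (?B z - ?B y) + norm (?c (snd z - snd y)) * norm (?B y)))"
      by (rule mult_left_mono) simp
    also have "\<dots> = ?p * norm (?A z - ?A y) + (norm (?c (snd z)) * (?p * norm (?B z - ?B y)) + norm (?c (snd z - snd y)) * (?p * norm (?B y)))"
      by (simp only: distrib_left mult.left_commute)
    also have "\<dots> \<le> C1 * ?R ^ M1 * norm (z - y) + ((2 * pi * ?R) * (C2 * ?R ^ M2 * norm (z - y)) + (2 * pi * norm (z - y)) * (C3 * (1 + norm y) ^ M3))"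
      by (intro add_mono mult_mono 1 2 3 c cd) auto
    also have "\<dots> \<le> C1 * ?R ^ ?M * norm (z - y) + ((2 * pi * C2) * ?R ^ ?M * norm (z - y) + (2 * pi * C3) * ?R ^ ?M * norm (z - y))"
    proof (intro add_mono)
      show "C1 * ?R ^ M1 * norm (z - y) \<le> C1 * ?R ^ ?M * norm (z - y)"
        using 1(1) R by (intro mult_right_mono power_add_mono) auto
      have "(2 * pi * ?R) * (C2 * ?R ^ M2 * norm (z - y)) = (2 * pi * C2) * ?R ^ (M2 + 1) * norm (z - y)" by simp
      also have "\<dots> \<le> (2 * pi * C2) * ?R ^ ?M * norm (z - y)"
        using 2(1) R by (intro mult_right_mono power_add_mono) auto
      finally show "(2 * pi * ?R) * (C2 * ?R ^ M2 * norm (z - y)) \<le> (2 * pi * C2) * ?R ^ ?M * norm (z - y)" .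
      have "(1 + norm y) ^ M3 \<le> ?R ^ M3" by (intro power_mono) auto
      also have "\<dots> \<le> ?R ^ ?M" using R by (intro power_increasing) auto
      finally have "(2 * pi * C3 * norm (z - y)) * (1 + norm y) ^ M3 \<le> (2 * pi * C3 * norm (z - y)) * ?R ^ ?M"
        using 3(1) by (intro mult_left_mono) auto
      then show "(2 * pi * norm (z - y)) * (C3 * (1 + norm y) ^ M3) \<le> (2 * pi * C3) * ?R ^ ?M * norm (z - y)"
        by (simp only: ac_simps)
    qed
    finally show ?thesis by (simp only: distrib_right add.assoc)
  qed
  moreover have "?C \<ge> 0" using 1(1) 2(1) 3(1) by simp
  ultimately show ?case by blast
qed

lemma tf_shift_bound:
  assumes "f \<in> schwartz" "bs \<in> lists Basis"
  shows "\<exists>C\<ge>0. \<exists>M. \<forall>z t. (1 + norm t) ^ k * norm (iter_partial bs (tf_shift f z) t) \<le> C * (1 + norm z) ^ M"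
  using tf_shift_lipschitz[OF assms, of k] tf_shift_bound_if_lipschitz[OF assms, where k=k] by blast

section \<open>Tempered distributions and the short-time Fourier transform\<close>

lemma rapid_mult_integrable:
  fixes a :: "'a::euclidean_space \<Rightarrow> 'b::{real_normed_field,banach,second_countable_topology}"
  assumes [measurable]: "a \<in> borel_measurable borel" and a: "rapid a"
    and [measurable]: "q \<in> borel_measurable borel" and q: "\<And>z. norm (q z) \<le> C * (1 + norm z) ^ M"
  shows "integrable lborel (\<lambda>z. a z * q z)"
  by (intro rapid_integrable rapid_mult_poly[OF a, of _ C M])
    (use q in \<open>auto simp: norm_mult mult.commute[of "norm (a _)"] intro!: mult_right_mono\<close>)

lemma rapid_mult_tendsto:
  fixes a :: "'a::euclidean_space \<Rightarrow> 'b::{real_normed_field,banach,second_countable_topology}"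
  assumes [measurable]: "a \<in> borel_measurable borel" and a: "rapid a"
    and [measurable]: "\<And>n. q n \<in> borel_measurable borel" and q: "\<And>n z. norm (q n z) \<le> C * (1 + norm z) ^ M"
    and lim: "\<And>z. (\<lambda>n. q n z) \<longlonglongrightarrow> p z"
  shows "(\<lambda>n. LINT z|lborel. a z * q n z) \<longlonglongrightarrow> (LINT z|lborel. a z * p z)"
proof (rule integral_dominated_convergence)
  have [measurable]: "p \<in> borel_measurable borel" by (rule borel_measurable_LIMSEQ_metric[OF _ lim]) measurable
  show "(\<lambda>z. a z * p z) \<in> borel_measurable lborel" by measurable
  have "integrable lborel (\<lambda>z. a z * of_real (C * (1 + norm z) ^ M))"
    by (rule rapid_mult_integrable[OF _ a, of _ "\<bar>C\<bar>" M]) (auto simp: abs_mult simp del: of_real_mult of_real_power of_real_add)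
  then show "integrable lborel (\<lambda>z. norm (a z * of_real (C * (1 + norm z) ^ M)))" by (rule integrable_norm)
  show "AE z in lborel. norm (a z * q n z) \<le> norm (a z * of_real (C * (1 + norm z) ^ M))" for n
    unfolding norm_mult norm_of_real by (intro AE_I2 mult_left_mono order_trans[OF q abs_ge_self]) auto
qed (measurable, intro AE_I2 tendsto_mult_left lim)

text \<open>Makes the constants and exponents of polynomial bounds uniform over the finitely many derivatives
in a Schwartz seminorm.\<close>

lemma finite_uniform_power_bound:
  fixes p :: "'i \<Rightarrow> 'a \<Rightarrow> real"
  assumes I: "finite I" and r: "\<And>a. r a \<ge> 1" and q: "\<And>a. q a \<ge> 0"
    and b: "\<And>i. i \<in> I \<Longrightarrow> \<exists>C\<ge>0. \<exists>M::nat. \<forall>a. p i a \<le> C * r a ^ M * q a"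
  shows "\<exists>C\<ge>0. \<exists>M::nat. \<forall>i\<in>I. \<forall>a. p i a \<le> C * r a ^ M * q a"
proof -
  obtain C M where CM: "\<And>i. i \<in> I \<Longrightarrow> C i \<ge> 0" "\<And>i a. i \<in> I \<Longrightarrow> p i a \<le> C i * r a ^ M i * q a"
    using b by metis
  have "p i a \<le> sum C I * r a ^ sum M I * q a" if i: "i \<in> I" for i a
  proof -
    have "p i a \<le> C i * r a ^ M i * q a" by (rule CM(2)[OF i])
    also have "\<dots> \<le> sum C I * r a ^ sum M I * q a"
      using I i r[of a] q CM(1)
      by (intro mult_right_mono mult_mono power_increasing member_le_sum sum_nonneg) auto
    finally show ?thesis .
  qed
  moreover have "sum C I \<ge> 0" using CM(1) by (rule sum_nonneg)
  ultimately show ?thesis by blast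
qed

abbreviation multi_indices :: "nat \<Rightarrow> 'a::euclidean_space list set" where
  "multi_indices N \<equiv> {bs. set bs \<subseteq> Basis \<and> length bs \<le> N}"

lemma finite_multi_indices: "finite (multi_indices N)"
  by (rule finite_lists_length_le) simp

text \<open>The seminorm is a sum of suprema; this form, with one uniform bound \<open>B\<close> in place of the suprema, is
easier to feed with estimates.\<close>

lemma tempered_bound:
  assumes "T \<in> tempered"
  shows "\<exists>C\<ge>0. \<exists>N. \<forall>f\<in>schwartz. \<forall>B.
    (\<forall>bs\<in>multi_indices N. \<forall>x. (1 + norm x) ^ N * norm (iter_partial bs f x) \<le> B) \<longrightarrow> norm (T f) \<le> C * B"
proof -
  obtain C N where CN: "\<And>f. f \<in> schwartz \<Longrightarrow> norm (T f) \<le> C * schwartz_seminorm N f"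
    using assms unfolding tempered_def by blast
  have "norm (T f) \<le> (\<bar>C\<bar> * card (multi_indices N :: 'a list set)) * B"
    if f: "f \<in> schwartz" and B: "\<And>bs x. bs \<in> multi_indices N \<Longrightarrow> (1 + norm x) ^ N * norm (iter_partial bs f x) \<le> B" for f B
  proof -
    let ?s = "\<lambda>bs. SUP x. (1 + norm x) ^ N * norm (iter_partial bs f x)"
    have "?s bs \<le> B" if "bs \<in> multi_indices N" for bs
      using B[OF that] by (intro cSUP_least) auto
    then have le: "schwartz_seminorm N f \<le> card (multi_indices N :: 'a list set) * B"
      unfolding schwartz_seminorm_def by (intro order_trans[OF sum_bounded_above]) auto
    have "0 \<le> ?s bs" if "bs \<in> multi_indices N" for bs
      by (rule cSUP_upper2[of _ _ 0]) (use B[OF that] in \<open>auto intro!: bdd_aboveI\<close>)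
    then have "0 \<le> schwartz_seminorm N f" unfolding schwartz_seminorm_def by (rule sum_nonneg)
    then have "C * schwartz_seminorm N f \<le> \<bar>C\<bar> * (card (multi_indices N :: 'a list set) * B)"
      using le by (intro mult_mono) auto
    then show ?thesis using CN[OF f] by simp
  qed
  then show ?thesis by (intro exI[of _ "\<bar>C\<bar> * card (multi_indices N :: 'a list set)"] conjI exI[of _ N]) auto
qed

lemma temperedD:
  assumes "T \<in> tempered"
  shows "f \<in> schwartz \<Longrightarrow> h \<in> schwartz \<Longrightarrow> T (\<lambda>x. f x + h x) = T f + T h"
    and "f \<in> schwartz \<Longrightarrow> T (\<lambda>x. c * f x) = c * T f"
    and "f \<notin> schwartz \<Longrightarrow> T f = 0"
  using assms by (auto simp: tempered_def)

lemma tempered_diff: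
  assumes "T \<in> tempered" "f \<in> schwartz" "h \<in> schwartz"
  shows "T (\<lambda>x. f x - h x) = T f - T h"
  using temperedD(1)[OF assms(1,2) schwartz_scale[OF assms(3), of "-1"]] temperedD(2)[OF assms(1,3), of "-1"] by simp

lemma tempered_sum:
  assumes T: "T \<in> tempered" and "\<And>i. i \<in> I \<Longrightarrow> f i \<in> schwartz"
  shows "T (\<lambda>x. \<Sum>i\<in>I. f i x) = (\<Sum>i\<in>I. T (f i))"
  using assms(2)
proof (induction I rule: infinite_finite_induct)
  case (insert i I)
  then show ?case by (simp add: temperedD(1)[OF T] schwartz_sum)
qed (use temperedD(2)[OF T schwartz_0, of 0] in auto)

lemma stft_growth:
  assumes T: "T \<in> tempered" and g: "g \<in> schwartz"
  shows "\<exists>C\<ge>0. \<exists>M. \<forall>z. norm (stft g T z) \<le> C * (1 + norm z) ^ M"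
proof -
  let ?g = "\<lambda>t. cnj (g t)"
  have g': "?g \<in> schwartz" by (rule schwartz_cnj[OF g])
  obtain C N where C: "C \<ge> 0" "\<And>f B. f \<in> schwartz \<Longrightarrow>
    (\<And>bs x. bs \<in> multi_indices N \<Longrightarrow> (1 + norm x) ^ N * norm (iter_partial bs f x) \<le> B) \<Longrightarrow> norm (T f) \<le> C * B"
    using tempered_bound[OF T] by blast
  have "\<exists>D\<ge>0. \<exists>M::nat. \<forall>bs\<in>multi_indices N. \<forall>a. (\<lambda>bs (z, t). (1 + norm t) ^ N * norm (iter_partial bs (tf_shift ?g z) t)) bs a
      \<le> D * (\<lambda>(z, t). 1 + norm z) a ^ M * (\<lambda>_. 1) a"
    by (rule finite_uniform_power_bound[OF finite_multi_indices])
      (use tf_shift_bound[OF g', of _ N] in auto)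
  then obtain D M where D0: "D \<ge> 0" and DM: "\<forall>bs\<in>multi_indices N. \<forall>a. (\<lambda>bs (z, t). (1 + norm t) ^ N * norm (iter_partial bs (tf_shift ?g z) t)) bs a
      \<le> D * (\<lambda>(z, t). 1 + norm z) a ^ M * (\<lambda>_. 1) a" by blast
  have D: "D \<ge> 0" "(1 + norm t) ^ N * norm (iter_partial bs (tf_shift ?g z) t) \<le> D * (1 + norm z) ^ M"
    if "bs \<in> multi_indices N" for bs z t
    using D0 DM[rule_format, OF that, of "(z, t)"] by simp_all
  have "norm (stft g T z) \<le> C * (D * (1 + norm z) ^ M)" for z
    unfolding stft_eq by (intro C(2) schwartz_tf_shift g' D(2))
  then show ?thesis using C(1) D0
    by (intro exI[of _ "C * D"] conjI exI[of _ M]) (auto simp: mult.assoc)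
qed

lemma tf_shift_lipschitz_uniform:
  assumes f: "f \<in> schwartz"
  shows "\<exists>D\<ge>0. \<exists>M. \<forall>bs\<in>multi_indices N. \<forall>z y t.
    (1 + norm t) ^ N * norm (iter_partial bs (tf_shift f z) t - iter_partial bs (tf_shift f y) t)
      \<le> D * (1 + norm z + norm y) ^ M * norm (z - y)"
proof -
  have "\<exists>D\<ge>0. \<exists>M::nat. \<forall>bs\<in>multi_indices N. \<forall>a. (\<lambda>bs (z, y, t). (1 + norm t) ^ N * norm (iter_partial bs (tf_shift f z) t - iter_partial bs (tf_shift f y) t)) bs a
      \<le> D * (\<lambda>(z, y, t). 1 + norm z + norm y) a ^ M * (\<lambda>(z, y, t). norm (z - y)) a"
    by (rule finite_uniform_power_bound[OF finite_multi_indices])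
      (use tf_shift_lipschitz[OF f, of _ N] in auto)
  then show ?thesis by (elim exE conjE, intro exI conjI) (assumption, fastforce)
qed

lemma stft_continuous:
  fixes T :: "'a::euclidean_space distribution"
  assumes T: "T \<in> tempered" and g: "g \<in> schwartz"
  shows "continuous_on UNIV (stft g T)"
proof -
  let ?g = "\<lambda>t. cnj (g t)"
  have g': "?g \<in> schwartz" by (rule schwartz_cnj[OF g])
  obtain C N where C: "C \<ge> 0" "\<And>f B. f \<in> schwartz \<Longrightarrow>
    (\<And>bs x. bs \<in> multi_indices N \<Longrightarrow> (1 + norm x) ^ N * norm (iter_partial bs f x) \<le> B) \<Longrightarrow> norm (T f) \<le> C * B"
    using tempered_bound[OF T] by blast
  obtain D M where D: "\<And>bs z y t. bs \<in> multi_indices N \<Longrightarrow>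
      (1 + norm t) ^ N * norm (iter_partial bs (tf_shift ?g z) t - iter_partial bs (tf_shift ?g y) t)
        \<le> D * (1 + norm z + norm y) ^ M * norm (z - y)"
    using tf_shift_lipschitz_uniform[OF g', of N] by blast
  have le: "norm (stft g T z - stft g T y) \<le> C * (D * (1 + norm z + norm y) ^ M * norm (z - y))" for z y
  proof -
    have S: "tf_shift ?g z \<in> schwartz" "tf_shift ?g y \<in> schwartz" by (intro schwartz_tf_shift g')+
    have "norm (T (\<lambda>t. tf_shift ?g z t - tf_shift ?g y t)) \<le> C * (D * (1 + norm z + norm y) ^ M * norm (z - y))"
      by (intro C(2) schwartz_diff S) (use D in \<open>simp add: iter_partial_diff S in_lists_conv_set subset_iff\<close>)
    then show ?thesis by (simp add: stft_eq tempered_diff[OF T] S)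
  qed
  show ?thesis
    unfolding continuous_on_eq_continuous_at[OF open_UNIV] continuous_at
  proof
    fix y :: "'a \<times> 'a"
    have "((\<lambda>z. C * (D * (1 + norm z + norm y) ^ M * norm (z - y))) \<longlongrightarrow> C * (D * (1 + norm y + norm y) ^ M * norm (y - y))) (at y)"
      by (intro tendsto_intros)
    then have "((\<lambda>z. C * (D * (1 + norm z + norm y) ^ M * norm (z - y))) \<longlongrightarrow> 0) (at y)" by simp
    then have "((\<lambda>z. stft g T z - stft g T y) \<longlongrightarrow> 0) (at y)"
      by (rule Lim_null_comparison[rotated]) (simp add: le)
    then show "(stft g T \<longlongrightarrow> stft g T y) (at y)" by (rule LIM_zero_cancel)
  qed
qed

lemma stft_measurable: "T \<in> tempered \<Longrightarrow> g \<in> schwartz \<Longrightarrow> stft g T \<in> borel_measurable borel"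
  by (intro borel_measurable_continuous_onI stft_continuous)

lemma iter_partial_tf_shift_continuous:
  fixes f :: "'a::euclidean_space \<Rightarrow> complex"
  assumes "f \<in> schwartz" "bs \<in> lists Basis"
  shows "continuous_on UNIV (\<lambda>z. iter_partial bs (tf_shift f z) t)"
proof -
  obtain D M where D: "\<And>z y t. norm (iter_partial bs (tf_shift f z) t - iter_partial bs (tf_shift f y) t)
        \<le> D * (1 + norm z + norm y) ^ M * norm (z - y)"
    using tf_shift_lipschitz[OF assms, of 0] unfolding power_0 mult_1 by blast
  show ?thesis
    unfolding continuous_on_eq_continuous_at[OF open_UNIV] continuous_at
  proof
    fix y :: "'a \<times> 'a"
    have "((\<lambda>z. D * (1 + norm z + norm y) ^ M * norm (z - y)) \<longlongrightarrow> D * (1 + norm y + norm y) ^ M * norm (y - y)) (at y)"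
      by (intro tendsto_intros)
    then have "((\<lambda>z. D * (1 + norm z + norm y) ^ M * norm (z - y)) \<longlongrightarrow> 0) (at y)" by simp
    then have "((\<lambda>z. iter_partial bs (tf_shift f z) t - iter_partial bs (tf_shift f y) t) \<longlongrightarrow> 0) (at y)"
      by (rule Lim_null_comparison[rotated]) (simp add: D)
    then show "((\<lambda>z. iter_partial bs (tf_shift f z) t) \<longlongrightarrow> iter_partial bs (tf_shift f y) t) (at y)"
      by (rule LIM_zero_cancel)
  qed
qed

lemma partial_increment_le:
  assumes f: "f \<in> schwartz" and B: "\<And>x. norm (partial b f x) \<le> B"
  shows "norm (f (t + s *\<^sub>R b) - f t) \<le> \<bar>s\<bar> * B"
proof -
  let ?\<phi> = "\<lambda>r. f (t + r *\<^sub>R b)"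
  have d: "(?\<phi> has_derivative (\<lambda>h. h *\<^sub>R partial b f (t + r *\<^sub>R b))) (at r)" for r
  proof -
    have "((\<lambda>r. t + r *\<^sub>R b) has_derivative (\<lambda>h. h *\<^sub>R b)) (at r)" by (auto intro!: derivative_eq_intros)
    from has_derivative_compose[OF this schwartz_has_derivative[OF f]]
    show ?thesis
      by (rule has_derivative_eq_rhs)
        (use linear_scale[OF has_derivative_linear[OF schwartz_has_derivative[OF f]]] in auto)
  qed
  have "norm (?\<phi> (0 + s) - ?\<phi> 0) \<le> norm s * B"
    by (rule differentiable_bound_segment[where G=UNIV and f'="\<lambda>r h. h *\<^sub>R partial b f (t + r *\<^sub>R b)"])
      (use d B in \<open>auto intro!: onorm_le simp: mult.commute[of B] mult_left_mono\<close>)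
  then show ?thesis by simp
qed

text \<open>The reconstruction formula may be differentiated under the integral. The left-hand side is
smooth, so its partial derivative is the limit of difference quotients, and these pass under the integral by
dominated convergence.\<close>

lemma iter_partial_window_coeff_reconstruct:
  fixes g h :: "'a::euclidean_space \<Rightarrow> complex"
  assumes g: "g \<in> schwartz" and h: "h \<in> schwartz" and bs: "bs \<in> lists Basis"
  defines "N \<equiv> of_real (LINT x|lborel. (norm (g x))\<^sup>2)"
  shows "iter_partial bs (\<lambda>t. N * h t) t = (LINT z|lborel. window_coeff g h z * iter_partial bs (tf_shift (\<lambda>t. cnj (g t)) z) t)"
  using bs
proof (induction bs arbitrary: t)
  case Nil
  then show ?case by (simp add: window_coeff_reconstruct[OF g h] N_def mult.commute)
next
  case (Cons b bs)
  then have b: "b \<in> Basis" and bs: "bs \<in> lists Basis" and bbs: "b # bs \<in> lists Basis" by auto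
  let ?g = "\<lambda>t. cnj (g t)" and ?a = "window_coeff g h" and ?e = "\<lambda>n. 1 / real (Suc n)"
  have g': "?g \<in> schwartz" by (rule schwartz_cnj[OF g])
  have am[measurable]: "?a \<in> borel_measurable borel" and ar: "rapid ?a"
    using g h by (auto intro: window_coeff_measurable schwartz_measurable rapid_window_coeff)
  let ?u = "iter_partial bs (\<lambda>t. N * h t)" and ?w = "\<lambda>z. iter_partial bs (tf_shift ?g z)"
  have u: "?u \<in> schwartz" and w: "?w z \<in> schwartz" for z
    using schwartz_iter_partial[OF schwartz_scale[OF h] bs] schwartz_iter_partial[OF schwartz_tf_shift[OF g'] bs] by auto
  have wm[measurable]: "(\<lambda>z. ?w z t) \<in> borel_measurable borel" for t
    by (intro borel_measurable_continuous_onI iter_partial_tf_shift_continuous g' bs)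
  have pm[measurable]: "(\<lambda>z. partial b (?w z) t) \<in> borel_measurable borel" for t
    using borel_measurable_continuous_onI[OF iter_partial_tf_shift_continuous[OF g' bbs]] by simp
  obtain D L where D: "\<And>z t. norm (?w z t) \<le> D * (1 + norm z) ^ L"
    using tf_shift_bound[OF g' bs, of 0] unfolding power_0 mult_1 by blast
  obtain C M where C: "\<And>z t. norm (partial b (?w z) t) \<le> C * (1 + norm z) ^ M"
    using tf_shift_bound[OF g' bbs, of 0] unfolding power_0 mult_1 iter_partial.simps by blast
  have wi: "integrable lborel (\<lambda>z. ?a z * ?w z t)" for t
    by (rule rapid_mult_integrable[OF am ar wm D])
  let ?q = "\<lambda>n z. of_nat (Suc n) * (?w z (t + ?e n *\<^sub>R b) - ?w z t)"
  have "(\<lambda>n. LINT z|lborel. ?a z * ?q n z) \<longlonglongrightarrow> (LINT z|lborel. ?a z * partial b (?w z) t)"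
  proof (rule rapid_mult_tendsto[OF am ar])
    show "(\<lambda>n. ?q n z) \<longlonglongrightarrow> partial b (?w z) t" for z
      using b by (intro difference_quotient_tendsto_partial schwartz_differentiable w) auto
    fix n z
    have "norm (?q n z) = real (Suc n) * norm (?w z (t + ?e n *\<^sub>R b) - ?w z t)"
      by (simp only: norm_mult norm_of_nat)
    also have "\<dots> \<le> real (Suc n) * (\<bar>?e n\<bar> * (C * (1 + norm z) ^ M))"
      by (intro mult_left_mono partial_increment_le w C) auto
    finally show "norm (?q n z) \<le> C * (1 + norm z) ^ M" by (simp del: of_nat_Suc)
  qed measurable
  moreover have "(LINT z|lborel. ?a z * ?q n z) = of_nat (Suc n) * (?u (t + ?e n *\<^sub>R b) - ?u t)" for n
  proof -
    have "(LINT z|lborel. ?a z * ?q n z) = (LINT z|lborel. of_nat (Suc n) * (?a z * ?w z (t + ?e n *\<^sub>R b) - ?a z * ?w z t))"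
      by (simp add: algebra_simps)
    also have "\<dots> = of_nat (Suc n) * ((LINT z|lborel. ?a z * ?w z (t + ?e n *\<^sub>R b)) - (LINT z|lborel. ?a z * ?w z t))"
      by (simp only: integral_mult_right_zero Bochner_Integration.integral_diff[OF wi wi])
    finally show ?thesis by (simp only: Cons.IH)
  qed
  moreover have "(\<lambda>n. of_nat (Suc n) * (?u (t + ?e n *\<^sub>R b) - ?u t)) \<longlonglongrightarrow> partial b ?u t"
    using b by (intro difference_quotient_tendsto_partial schwartz_differentiable u) auto
  ultimately show ?case using LIMSEQ_unique by fastforce
qed

text \<open>Formally \<open>T\<close> is applied under the integral in the reconstruction formula for \<open>h\<close>. The exchange is
justified by replacing the shift \<open>z\<close> with a simple function \<open>F i z\<close> of \<open>z\<close> while keeping the coefficients: the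
integral becomes a finite sum, which linearity handles, and the error tends to 0 in every seminorm by the Lipschitz bound
and dominated convergence.\<close>

theorem stft_pairing:
  fixes T :: "'a::euclidean_space distribution"
  assumes T: "T \<in> tempered" and g: "g \<in> schwartz" and h: "h \<in> schwartz"
  shows "integrable lborel (\<lambda>z. window_coeff g h z * stft g T z)"
    and "(LINT z|lborel. window_coeff g h z * stft g T z) = of_real (LINT x|lborel. (norm (g x))\<^sup>2) * T h"
proof -
  let ?g = "\<lambda>t. cnj (g t)" and ?a = "window_coeff g h" and ?N = "of_real (LINT x|lborel. (norm (g x))\<^sup>2) :: complex"
  let ?V = "stft g T" and ?h = "\<lambda>t. of_real (LINT x|lborel. (norm (g x))\<^sup>2) * h t"
  have g': "?g \<in> schwartz" by (rule schwartz_cnj[OF g])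
  have h': "?h \<in> schwartz" by (rule schwartz_scale[OF h])
  have am[measurable]: "?a \<in> borel_measurable borel" and ar: "rapid ?a"
    using g h by (auto intro: window_coeff_measurable schwartz_measurable rapid_window_coeff)
  note Vm[measurable] = stft_measurable[OF T g]
  obtain C1 M1 where V: "C1 \<ge> 0" "\<And>z. norm (?V z) \<le> C1 * (1 + norm z) ^ M1" using stft_growth[OF T g] by blast
  show "integrable lborel (\<lambda>z. ?a z * ?V z)"
    by (rule rapid_mult_integrable[OF am ar Vm V(2)])
  obtain C N where C: "C \<ge> 0" "\<And>f B. f \<in> schwartz \<Longrightarrow>
    (\<And>bs x. bs \<in> multi_indices N \<Longrightarrow> (1 + norm x) ^ N * norm (iter_partial bs f x) \<le> B) \<Longrightarrow> norm (T f) \<le> C * B"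
    using tempered_bound[OF T] by blast
  obtain D M where D0: "D \<ge> 0" and D: "\<And>bs z y t. bs \<in> multi_indices N \<Longrightarrow>
      (1 + norm t) ^ N * norm (iter_partial bs (tf_shift ?g z) t - iter_partial bs (tf_shift ?g y) t)
        \<le> D * (1 + norm z + norm y) ^ M * norm (z - y)"
    using tf_shift_lipschitz_uniform[OF g', of N] by blast
  \<comment> \<open>simple functions converging to the identity of phase space, at most doubling norms\<close>
  obtain F :: "nat \<Rightarrow> 'a \<times> 'a \<Rightarrow> 'a \<times> 'a" where F: "\<And>i. simple_function lborel (F i)"
      "\<And>x. (\<lambda>i. F i x) \<longlonglongrightarrow> x" "\<And>i x. dist (F i x) 0 \<le> 2 * dist x 0"
    using borel_measurable_implies_sequence_metric[of "\<lambda>z. z" "lborel :: ('a \<times> 'a) measure" 0] by auto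
  have Fm[measurable]: "F i \<in> borel_measurable borel" for i using borel_measurable_simple_function[OF F(1)] by simp
  have Fn: "norm (F i z) \<le> 2 * norm z" for i z using F(3)[of i z] by simp
  have Fd: "norm (z - F i z) \<le> 3 * norm z" for i z using norm_triangle_ineq4[of z "F i z"] Fn[of i z] by linarith
  have ai: "integrable lborel ?a" by (rule rapid_integrable[OF am ar])
  \<comment> \<open>the total coefficient of all points that \<open>F i\<close> sends to \<open>y\<close>\<close>
  define c where "c i y = (LINT z|lborel. ?a z * indicator {y} (F i z))" for i y
  have fin: "finite (range (F i))" for i using simple_functionD(1)[OF F(1)] by simp
  have split: "(LINT z|lborel. ?a z * q (F i z)) = (\<Sum>y\<in>range (F i). c i y * q y)"
    "integrable lborel (\<lambda>z. ?a z * q (F i z))" for i and q :: "'a \<times> 'a \<Rightarrow> complex"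
  proof -
    have e: "?a z * q (F i z) = (\<Sum>y\<in>range (F i). ?a z * indicator {y} (F i z) * q y)" for z
    proof -
      have "(\<Sum>y\<in>range (F i). ?a z * indicator {y} (F i z) * q y) = (\<Sum>y\<in>{F i z}. ?a z * indicator {y} (F i z) * q y)"
        by (rule sum.mono_neutral_right[OF fin]) auto
      then show ?thesis by simp
    qed
    have i: "integrable lborel (\<lambda>z. ?a z * indicator {y} (F i z) * q y)" for y
    proof -
      have "integrable lborel (\<lambda>z. ?a z * indicator {y} (F i z))"
      proof (rule integrable_mult_bounded[OF ai, where C=1])
        have "(\<lambda>z. indicator {y} (F i z) :: complex) \<in> borel_measurable borel"
          by (rule measurable_compose[OF Fm]) simp
        then show "(\<lambda>z. indicator {y} (F i z) :: complex) \<in> borel_measurable lborel" by simp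
      qed (auto simp: indicator_def)
      then show ?thesis by simp
    qed
    show "integrable lborel (\<lambda>z. ?a z * q (F i z))" unfolding e by (intro Bochner_Integration.integrable_sum i)
    show "(LINT z|lborel. ?a z * q (F i z)) = (\<Sum>y\<in>range (F i). c i y * q y)"
      unfolding e c_def by (subst Bochner_Integration.integral_sum[OF i]) simp
  qed
  define H where "H i t = (\<Sum>y\<in>range (F i). c i y * tf_shift ?g y t)" for i t
  have S: "tf_shift ?g y \<in> schwartz" for y by (rule schwartz_tf_shift[OF g'])
  have HS: "H i \<in> schwartz" for i
    unfolding H_def[abs_def] by (intro schwartz_sum schwartz_scale S)
  have TH: "T (H i) = (LINT z|lborel. ?a z * ?V (F i z))" for i
    unfolding H_def[abs_def] stft_eq split(1)[of "\<lambda>y. T (tf_shift ?g y)"]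
    by (subst tempered_sum[OF T]) (auto intro!: schwartz_scale S sum.cong simp: temperedD(2)[OF T S])
  have IH: "iter_partial bs (H i) t = (LINT z|lborel. ?a z * iter_partial bs (tf_shift ?g (F i z)) t)" if "bs \<in> lists Basis" for bs i t
  proof -
    have "iter_partial bs (H i) t = (\<Sum>y\<in>range (F i). c i y * iter_partial bs (tf_shift ?g y) t)"
      unfolding H_def[abs_def]
      by (subst iter_partial_sum[OF _ that]) (auto intro!: schwartz_scale S sum.cong simp: iter_partial_scale[OF S that])
    then show ?thesis by (simp add: split(1)[where q="\<lambda>y. iter_partial bs (tf_shift ?g y) t"])
  qed
  define q where "q i z = D * (1 + norm z + norm (F i z)) ^ M * norm (z - F i z)" for i z
  have q0: "q i z \<ge> 0" for i z using D0 by (simp add: q_def)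
  have [measurable]: "q i \<in> borel_measurable borel" for i unfolding q_def by measurable
  \<comment> \<open>\<open>3\<close> because \<open>norm z + norm (F i z) \<le> 3 * norm z\<close>\<close>
  have qb: "norm (q i z) \<le> (D * 3 ^ (M + 1)) * (1 + norm z) ^ (M + 1)" for i z
  proof -
    have "norm (q i z) = D * (1 + norm z + norm (F i z)) ^ M * norm (z - F i z)"
      using D0 by (simp add: q_def abs_mult)
    also have "\<dots> \<le> D * (3 * (1 + norm z)) ^ M * (3 * (1 + norm z))"
      using D0 Fn[of i z] Fd[of z i] by (intro mult_mono mult_left_mono power_mono) auto
    also have "\<dots> = (D * 3 ^ (M + 1)) * (1 + norm z) ^ (M + 1)"
      by (simp only: power_mult_distrib power_add power_one_right ac_simps)
    finally show ?thesis .
  qed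
  have nm: "(\<lambda>z. norm (?a z)) \<in> borel_measurable borel" "rapid (\<lambda>z. norm (?a z))"
    using ar by (auto simp: rapid_def)
  define B where "B i = (LINT z|lborel. norm (?a z) * q i z)" for i
  have Bi: "integrable lborel (\<lambda>z. norm (?a z) * q i z)" for i
    by (rule rapid_mult_integrable[OF nm _ qb]) measurable
  have "B \<longlonglongrightarrow> (LINT z|lborel. norm (?a z) * (D * (1 + norm z + norm z) ^ M * norm (z - z)))"
    unfolding B_def
    by (rule rapid_mult_tendsto[OF nm _ qb]) (measurable, unfold q_def, intro tendsto_intros F)
  then have Blim: "B \<longlonglongrightarrow> 0" by simp
  have diff: "norm (T ?h - T (H i)) \<le> C * B i" for i
  proof -
    have "norm (T (\<lambda>t. ?h t - H i t)) \<le> C * B i"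
    proof (rule C(2)[OF schwartz_diff[OF h' HS]])
      fix bs :: "'a list" and t assume bs: "bs \<in> multi_indices N"
      then have bs': "bs \<in> lists Basis" by auto
      let ?w = "\<lambda>z. iter_partial bs (tf_shift ?g z) t"
      have wm[measurable]: "?w \<in> borel_measurable borel"
        by (intro borel_measurable_continuous_onI iter_partial_tf_shift_continuous g' bs')
      obtain E L where E: "\<And>z t. norm (iter_partial bs (tf_shift ?g z) t) \<le> E * (1 + norm z) ^ L"
        using tf_shift_bound[OF g' bs', of 0] unfolding power_0 mult_1 by blast
      have i1: "integrable lborel (\<lambda>z. ?a z * ?w z)" by (rule rapid_mult_integrable[OF am ar wm E])
      have i2: "integrable lborel (\<lambda>z. ?a z * ?w (F i z))" by (rule split(2))
      have "iter_partial bs (\<lambda>t. ?h t - H i t) t = (LINT z|lborel. ?a z * ?w z) - (LINT z|lborel. ?a z * ?w (F i z))"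
        by (simp only: iter_partial_diff[OF h' HS bs'] iter_partial_window_coeff_reconstruct[OF g h bs'] IH[OF bs'])
      also have "\<dots> = (LINT z|lborel. ?a z * (?w z - ?w (F i z)))"
        by (simp only: right_diff_distrib Bochner_Integration.integral_diff[OF i1 i2])
      finally have "(1 + norm t) ^ N * norm (iter_partial bs (\<lambda>t. ?h t - H i t) t)
          \<le> (1 + norm t) ^ N * (LINT z|lborel. norm (?a z * (?w z - ?w (F i z))))"
        by (simp only:) (intro mult_left_mono integral_norm_bound, simp)
      also have "\<dots> = (LINT z|lborel. norm (?a z) * ((1 + norm t) ^ N * norm (?w z - ?w (F i z))))"
        by (simp add: norm_mult mult.left_commute flip: integral_mult_right_zero)
      also have "\<dots> \<le> B i"
        unfolding B_def
        by (rule integral_mono'[OF Bi]) (auto simp only: q_def intro!: mult_left_mono D[OF bs] norm_ge_zero, simp add: D0)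
      finally show "(1 + norm t) ^ N * norm (iter_partial bs (\<lambda>t. ?h t - H i t) t) \<le> B i" .
    qed
    then show ?thesis by (simp only: tempered_diff[OF T h' HS])
  qed
  have "(\<lambda>i. T ?h - T (H i)) \<longlonglongrightarrow> 0"
  proof (rule Lim_null_comparison)
    show "(\<lambda>i. C * B i) \<longlonglongrightarrow> 0" using tendsto_mult_left[OF Blim, of C] by simp
  qed (simp add: diff)
  then have "(\<lambda>i. T ?h - (T ?h - T (H i))) \<longlonglongrightarrow> T ?h - 0" by (intro tendsto_intros)
  then have "(\<lambda>i. LINT z|lborel. ?a z * ?V (F i z)) \<longlonglongrightarrow> T ?h" by (simp add: TH)
  moreover have "(\<lambda>i. LINT z|lborel. ?a z * ?V (F i z)) \<longlonglongrightarrow> (LINT z|lborel. ?a z * ?V z)"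
  proof (rule rapid_mult_tendsto[OF am ar])
    show "(\<lambda>i. ?V (F i z)) \<longlonglongrightarrow> ?V z" for z
      by (rule isCont_tendsto_compose[OF _ F(2)])
        (rule continuous_on_eq_continuous_at[OF open_UNIV, THEN iffD1, rule_format, OF stft_continuous[OF T g] UNIV_I])
    fix i z
    have "norm (?V (F i z)) \<le> C1 * (1 + norm (F i z)) ^ M1" by (rule V)
    also have "\<dots> \<le> C1 * (2 * (1 + norm z)) ^ M1" using V(1) Fn[of i z] by (intro mult_left_mono power_mono) auto
    also have "\<dots> = (C1 * 2 ^ M1) * (1 + norm z) ^ M1" by (simp only: power_mult_distrib ac_simps)
    finally show "norm (?V (F i z)) \<le> (C1 * 2 ^ M1) * (1 + norm z) ^ M1" .
  qed measurable
  ultimately have "(LINT z|lborel. ?a z * ?V z) = T ?h" using LIMSEQ_unique by blast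
  then show "(LINT z|lborel. ?a z * ?V z) = ?N * T h" by (simp only: temperedD(2)[OF T h])
qed

lemma continuous_AE_eq_0:
  fixes f :: "'a::euclidean_space \<Rightarrow> 'b::real_normed_vector"
  assumes f: "continuous_on UNIV f" and z: "AE x in lborel. f x = 0"
  shows "f x = 0"
proof -
  have o: "open {x. f x \<noteq> 0}" using f by (intro open_Collect_neq continuous_intros)
  have "{x. f x \<noteq> 0} \<in> null_sets lborel"
    using z o by (subst AE_iff_null_sets) auto
  then have "negligible {x. f x \<noteq> 0}" by (simp add: negligible_iff_null_sets null_sets_completionI)
  then show ?thesis using open_not_negligible[OF o] by auto
qed

lemma schwartz_square_integrable:
  assumes "f \<in> schwartz" shows "integrable lborel (\<lambda>x. (norm (f x))\<^sup>2)"
  using rapid_bounded[OF schwartz_rapid[OF assms]] square_integrable_bounded[OF schwartz_integrable[OF assms]] by blast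

lemma schwartz_norm_pos:
  assumes g: "g \<in> schwartz" and nz: "g \<noteq> (\<lambda>_. 0)"
  shows "(LINT x|lborel. (norm (g x))\<^sup>2) > 0"
proof -
  have "(LINT x|lborel. (norm (g x))\<^sup>2) \<noteq> 0"
  proof
    assume "(LINT x|lborel. (norm (g x))\<^sup>2) = 0"
    then have "AE x in lborel. g x = 0"
      by (subst (asm) integral_nonneg_eq_0_iff_AE) (auto intro: schwartz_square_integrable g)
    then show False using continuous_AE_eq_0[OF schwartz_continuous[OF g]] nz by blast
  qed
  moreover have "(LINT x|lborel. (norm (g x))\<^sup>2) \<ge> 0" by (intro integral_nonneg_AE) auto
  ultimately show ?thesis by linarith
qed

lemma stft_injective:
  assumes T: "T \<in> tempered" and g: "g \<in> schwartz" "g \<noteq> (\<lambda>_. 0)" and z: "AE z in lborel. stft g T z = 0"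
  shows "T = (\<lambda>_. 0)"
proof
  fix h
  show "T h = 0"
  proof (cases "h \<in> schwartz")
    case True
    have "(LINT z|lborel. window_coeff g h z * stft g T z) = 0"
      using z by (intro integral_eq_zero_AE) auto
    then show ?thesis using stft_pairing(2)[OF T g(1) True] schwartz_norm_pos[OF g] by auto
  qed (rule temperedD(3)[OF T])
qed

text \<open>The difference of two densities, multiplied by a translated window, is integrable with vanishing Fourier
transform. Countably many translates of the set where the window does not vanish cover the space.\<close>

lemma represents_unique:
  fixes u v g :: "'a::euclidean_space \<Rightarrow> complex"
  assumes u: "represents u T" and v: "represents v T" and g: "g \<in> schwartz" "g \<noteq> (\<lambda>_. 0)"
  shows "AE x in lborel. u x = v x"
proof -
  obtain p where p: "g p \<noteq> 0" using g(2) by auto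
  have "open {x. g x \<noteq> 0}" using schwartz_continuous[OF g(1)] by (intro open_Collect_neq continuous_intros)
  then obtain r where r: "r > 0" "ball p r \<subseteq> {x. g x \<noteq> 0}" using p by (metis mem_Collect_eq openE)
  have local: "AE t in lborel. (u t - v t) * g (t - x) = 0" for x
  proof (rule fourier_zero_imp_AE_zero)
    let ?k = "\<lambda>w. tf_shift g (x, w)"
    have S: "?k w \<in> schwartz" for w by (rule schwartz_tf_shift[OF g(1)])
    have i: "integrable lborel (\<lambda>t. u t * ?k w t)" "integrable lborel (\<lambda>t. v t * ?k w t)"
        and e: "(LINT t|lborel. u t * ?k w t) = (LINT t|lborel. v t * ?k w t)" for w
      using u v S[of w] unfolding represents_def by auto
    have "integrable lborel (\<lambda>t. u t * ?k 0 t - v t * ?k 0 t)" by (intro Bochner_Integration.integrable_diff i)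
    then show "integrable lborel (\<lambda>t. (u t - v t) * g (t - x))" by (simp add: tf_shift_def algebra_simps)
    fix w
    have "fourier (\<lambda>t. (u t - v t) * g (t - x)) w = (LINT t|lborel. u t * ?k w t - v t * ?k w t)"
      unfolding fourier_def by (simp add: tf_shift_def algebra_simps)
    also have "\<dots> = 0" using e by (simp add: Bochner_Integration.integral_diff[OF i])
    finally show "fourier (\<lambda>t. (u t - v t) * g (t - x)) w = 0" .
  qed
  obtain X :: "'a set" where X: "countable X" "\<And>U. open U \<Longrightarrow> U \<noteq> {} \<Longrightarrow> \<exists>x\<in>X. x \<in> U"
    using countable_dense_setE by blast
  have "AE t in lborel. \<forall>x\<in>X. (u t - v t) * g (t - x) = 0"
    by (rule AE_ball_countable[OF X(1), THEN iffD2]) (intro ballI local)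
  then show ?thesis
  proof eventually_elim
    case (elim t)
    obtain x where x: "x \<in> X" "x \<in> ball (t - p) r" using X(2)[of "ball (t - p) r"] r(1) by auto
    then have "t - x \<in> ball p r" by (simp add: dist_norm algebra_simps norm_minus_commute)
    then have "g (t - x) \<noteq> 0" using r(2) by auto
    then show ?case using elim x(1) by auto
  qed
qed

section \<open>Square-integrable densities of distributions\<close>

text \<open>Completeness of \<open>L2\<close> with a rate: the limit inherits the Cauchy estimate.\<close>

lemma L2_complete:
  fixes U :: "nat \<Rightarrow> 'a \<Rightarrow> complex"
  assumes [measurable]: "\<And>n. U n \<in> borel_measurable M"
    and bound: "\<And>n k. n \<le> k \<Longrightarrow> (\<integral>\<^sup>+x. ennreal ((norm (U k x - U n x))\<^sup>2) \<partial>M) \<le> e n"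
    and e: "e \<longlonglongrightarrow> 0"
  shows "\<exists>V\<in>borel_measurable M. \<forall>n. (\<integral>\<^sup>+x. ennreal ((norm (V x - U n x))\<^sup>2) \<partial>M) \<le> e n"
proof -
  have "\<exists>N. \<forall>n\<ge>N. e n \<le> ennreal (1 / 16 ^ j)" for j :: nat
    using order_tendstoD(2)[OF e, of "ennreal (1 / 16 ^ j)"]
    unfolding eventually_sequentially by (meson ennreal_less_zero_iff less_imp_le zero_less_divide_1_iff zero_less_power zero_less_numeral)
  then obtain N where N: "\<And>j n. N j \<le> n \<Longrightarrow> e n \<le> ennreal (1 / 16 ^ j)" by metis
  \<comment> \<open>a sum instead of \<open>N j\<close>, plus \<open>j\<close>, makes the sequence increasing and unbounded\<close>
  define r where "r j = (\<Sum>i\<le>j. N i) + j" for j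
  have rN: "N j \<le> r j" for j unfolding r_def by (simp add: member_le_sum trans_le_add1)
  have rS: "r j \<le> r (Suc j)" and rj: "j \<le> r j" for j by (simp_all add: r_def)
  define D where "D j x = (norm (U (r (Suc j)) x - U (r j) x))\<^sup>2" for j x
  have [measurable]: "D j \<in> borel_measurable M" for j unfolding D_def by measurable
  \<comment> \<open>the factor \<open>4 ^ j\<close> spends the square root of the decay \<open>1 / 16 ^ j\<close>: it keeps the sum finite and forces geometric decay of the increments pointwise\<close>
  have "(\<integral>\<^sup>+x. (\<Sum>j. ennreal (4 ^ j * D j x)) \<partial>M) = (\<Sum>j. \<integral>\<^sup>+x. ennreal (4 ^ j * D j x) \<partial>M)"
    by (rule nn_integral_suminf) measurable
  also have "\<dots> \<le> (\<Sum>j. ennreal ((1 / 4) ^ j))"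
  proof (intro suminf_le allI)
    fix j
    have "(\<integral>\<^sup>+x. ennreal (4 ^ j * D j x) \<partial>M) = ennreal (4 ^ j) * (\<integral>\<^sup>+x. ennreal (D j x) \<partial>M)"
      by (simp add: ennreal_mult D_def nn_integral_cmult)
    also have "\<dots> \<le> ennreal (4 ^ j) * ennreal (1 / 16 ^ j)"
      unfolding D_def by (intro mult_left_mono order_trans[OF bound[OF rS] N[OF rN]]) auto
    also have "\<dots> = ennreal ((1 / 4) ^ j)"
      by (simp add: ennreal_mult[symmetric] power_divide flip: power_mult_distrib) (simp add: field_simps flip: power_mult_distrib)
    finally show "(\<integral>\<^sup>+x. ennreal (4 ^ j * D j x) \<partial>M) \<le> ennreal ((1 / 4) ^ j)" .
  qed auto
  also have "\<dots> = ennreal (\<Sum>j. (1 / 4) ^ j)" by (rule suminf_ennreal2) (auto intro: summable_geometric)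
  also have "\<dots> < \<infinity>" by simp
  finally have "AE x in M. (\<Sum>j. ennreal (4 ^ j * D j x)) \<noteq> \<infinity>"
    by (intro nn_integral_PInf_AE) auto
  then have conv: "AE x in M. convergent (\<lambda>j. U (r j) x)"
  proof eventually_elim
    case (elim x)
    then obtain B where B: "(\<Sum>j. ennreal (4 ^ j * D j x)) = ennreal B" "B \<ge> 0" by (cases "\<Sum>j. ennreal (4 ^ j * D j x)") auto
    have "norm (U (r (Suc j)) x - U (r j) x) \<le> sqrt B * (1 / 2) ^ j" for j
    proof -
      have "(\<Sum>i\<in>{j}. ennreal (4 ^ i * D i x)) \<le> (\<Sum>i. ennreal (4 ^ i * D i x))" by (rule sum_le_suminf) auto
      then have "4 ^ j * D j x \<le> B" using B by simp
      moreover have "4 ^ j * D j x = (2 ^ j * norm (U (r (Suc j)) x - U (r j) x))\<^sup>2"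
        by (simp add: D_def power_mult_distrib power_mult[symmetric] mult.commute[of j]) (simp add: power_mult)
      ultimately have "2 ^ j * norm (U (r (Suc j)) x - U (r j) x) \<le> sqrt B" by (simp add: real_le_rsqrt)
      then show ?thesis by (simp add: power_divide field_simps)
    qed
    then have "summable (\<lambda>j. U (r (Suc j)) x - U (r j) x)"
      by (intro summable_comparison_test[OF _ summable_mult[OF summable_geometric]]) auto
    then have "convergent (\<lambda>n. \<Sum>j<n. U (r (Suc j)) x - U (r j) x)" by (simp add: summable_iff_convergent)
    then have "convergent (\<lambda>n. U (r n) x - U (r 0) x)"
      using sum_lessThan_telescope[of "\<lambda>j. U (r j) x"] by simp
    then have "convergent (\<lambda>n. (U (r n) x - U (r 0) x) + U (r 0) x)" by (intro convergent_add convergent_const)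
    then show ?case by simp
  qed
  define V where "V x = lim (\<lambda>j. U (r j) x)" for x
  have [measurable]: "V \<in> borel_measurable M" unfolding V_def by measurable
  have "(\<integral>\<^sup>+x. ennreal ((norm (V x - U n x))\<^sup>2) \<partial>M) \<le> e n" for n
  proof -
    have "(\<integral>\<^sup>+x. ennreal ((norm (V x - U n x))\<^sup>2) \<partial>M) = (\<integral>\<^sup>+x. liminf (\<lambda>j. ennreal ((norm (U (r j) x - U n x))\<^sup>2)) \<partial>M)"
    proof (rule nn_integral_cong_AE, use conv in eventually_elim)
      case (elim x)
      then have "(\<lambda>j. U (r j) x) \<longlonglongrightarrow> V x" unfolding V_def by (simp add: convergent_LIMSEQ_iff)
      then have "(\<lambda>j. ennreal ((norm (U (r j) x - U n x))\<^sup>2)) \<longlonglongrightarrow> ennreal ((norm (V x - U n x))\<^sup>2)"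
        by (intro tendsto_intros tendsto_ennrealI)
      from lim_imp_Liminf[OF _ this] show ?case by simp
    qed
    also have "\<dots> \<le> liminf (\<lambda>j. \<integral>\<^sup>+x. ennreal ((norm (U (r j) x - U n x))\<^sup>2) \<partial>M)"
      by (rule nn_integral_liminf) measurable
    also have "\<dots> \<le> liminf (\<lambda>j::nat. e n)"
    proof (rule Liminf_mono, rule eventually_sequentiallyI)
      fix j assume "n \<le> j"
      then show "(\<integral>\<^sup>+x. ennreal ((norm (U (r j) x - U n x))\<^sup>2) \<partial>M) \<le> e n" using rj[of j] by (intro bound) simp
    qed
    also have "\<dots> = e n" by (simp add: Liminf_const)
    finally show ?thesis .
  qed
  then show ?thesis by (intro bexI[of _ V]) auto
qed

text \<open>The density that belongs to phase-space data \<open>G\<close>; as an operator it is the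
transpose of \<open>window_coeff\<close>.\<close>

definition synth :: "('a::euclidean_space \<Rightarrow> complex) \<Rightarrow> ('a \<times> 'a \<Rightarrow> complex) \<Rightarrow> 'a \<Rightarrow> complex" where
  "synth \<gamma> G t = (LINT z|lborel. G z * (\<gamma> (t - fst z) * cis (2 * pi * (t \<bullet> snd z))))"

text \<open>Integrating first over the frequency turns \<open>synth\<close> into \<open>\<integral> \<gamma> (t - x) P\<^sub>x t dx\<close>, where \<open>P\<^sub>x\<close> is an inverse Fourier
transform of the slice of \<open>G\<close> at \<open>x\<close>. Moderateness moves the weight from \<open>t\<close> to \<open>x\<close> at the price of a polynomial,
which the window absorbs into the kernel \<open>\<kappa>\<close>. The Cauchy-Schwarz inequality for this kernel and Bessel's
inequality for \<open>P\<^sub>x\<close> give the estimate. The constant is the same for all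
bounds and supports of \<open>G\<close>, as truncations of growing size are to be compared.\<close>

lemma synth_bound:
  fixes \<gamma> :: "'a::euclidean_space \<Rightarrow> complex" and w :: "'a \<Rightarrow> real"
  assumes \<gamma>m[measurable]: "\<gamma> \<in> borel_measurable borel" and \<gamma>: "rapid \<gamma>"
    and wm[measurable]: "w \<in> borel_measurable borel" and wpos: "\<And>x. w x > 0"
    and K: "K \<ge> 0" and mod: "\<And>x y. w (x + y) \<le> K * w x * (1 + norm y) ^ n"
  shows "\<exists>C\<ge>0. \<forall>G\<in>borel_measurable borel. \<forall>B R. (\<forall>z. norm (G z) \<le> B) \<longrightarrow> (\<forall>z. norm z > R \<longrightarrow> G z = 0) \<longrightarrow>
    (\<integral>\<^sup>+t. ennreal ((w t * norm (synth \<gamma> G t))\<^sup>2) \<partial>lborel) \<le> ennreal C * (\<integral>\<^sup>+z. ennreal ((w (fst z) * norm (G z))\<^sup>2) \<partial>lborel)"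
proof -
  define \<kappa> where "\<kappa> y = (1 + norm y) ^ n * norm (\<gamma> y)" for y
  have \<kappa>0: "\<kappa> y \<ge> 0" for y by (simp add: \<kappa>_def)
  have [measurable]: "\<kappa> \<in> borel_measurable borel" unfolding \<kappa>_def by measurable
  have "rapid \<kappa>" by (rule rapid_mult_poly[OF \<gamma>, of _ 1 n]) (simp add: \<kappa>_def)
  then have \<kappa>i: "integrable lborel \<kappa>" by (intro rapid_integrable) auto
  obtain b where b: "b \<ge> 0" "\<And>y. \<kappa> y \<le> b" using rapidD[OF \<gamma>, of n] by (auto simp: \<kappa>_def)
  obtain c where c: "\<And>y. norm (\<gamma> y) \<le> c" using rapid_bounded[OF \<gamma>] by blast
  define a where "a = (LINT y|lborel. \<kappa> y)"
  have a: "a \<ge> 0" unfolding a_def by (intro integral_nonneg_AE) (simp add: \<kappa>0)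
  let ?C = "a * (K\<^sup>2 * b)"
  have "(\<integral>\<^sup>+t. ennreal ((w t * norm (synth \<gamma> G t))\<^sup>2) \<partial>lborel) \<le> ennreal ?C * (\<integral>\<^sup>+z. ennreal ((w (fst z) * norm (G z))\<^sup>2) \<partial>lborel)"
    if Gm[measurable]: "G \<in> borel_measurable borel" and B: "\<And>z. norm (G z) \<le> B" and R: "\<And>z. norm z > R \<Longrightarrow> G z = 0" for G B R
  proof -
    have [measurable]: "G \<in> borel_measurable (borel \<Otimes>\<^sub>M borel)" using Gm by (simp add: borel_prod)
    have Gi: "integrable lborel G" by (rule bounded_support_integrable[OF Gm B R])
    have slice: "integrable lborel (\<lambda>\<omega>. G (x, \<omega>))" "integrable lborel (\<lambda>\<omega>. (norm (G (x, \<omega>)))\<^sup>2)" for x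
    proof -
      have 0: "G (x, \<omega>) = 0" if "norm \<omega> > R" for \<omega> :: 'a
        using that norm_prod_bounds(2)[of "(x, \<omega>)"] by (intro R) simp
      show i: "integrable lborel (\<lambda>\<omega>. G (x, \<omega>))"
        by (rule bounded_support_integrable[OF _ B 0]) auto
      show "integrable lborel (\<lambda>\<omega>. (norm (G (x, \<omega>)))\<^sup>2)"
        by (rule square_integrable_bounded[OF i B])
    qed
    define p where "p x t = norm (fourier (\<lambda>\<omega>. G (x, \<omega>)) (- t))" for x t
    let ?s = "\<lambda>t. ennreal ((w t * norm (synth \<gamma> G t))\<^sup>2)"
    let ?J = "\<lambda>x t. ennreal (sqrt (\<kappa> (t - x))) * ennreal (K * sqrt (\<kappa> (t - x)) * (w x * p x t))"
    let ?W = "\<lambda>x. (\<integral>\<^sup>+\<omega>. ennreal ((w x * norm (G (x, \<omega>)))\<^sup>2) \<partial>lborel)"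
    let ?S = "\<lambda>x. (\<integral>\<^sup>+\<omega>. ennreal ((norm (G (x, \<omega>)))\<^sup>2) \<partial>lborel)"
    let ?I = "\<lambda>x t. ennreal (K\<^sup>2) * ennreal (\<kappa> (t - x)) * ennreal ((w x)\<^sup>2 * (p x t)\<^sup>2)"
    have [measurable]: "(\<lambda>(x, t). p x t) \<in> borel_measurable (borel \<Otimes>\<^sub>M borel)"
      unfolding p_def fourier_def by measurable
    have bess: "(\<integral>\<^sup>+t. ennreal ((p x t)\<^sup>2) \<partial>lborel) \<le> ?S x" for x
    proof -
      have [measurable]: "fourier (\<lambda>\<omega>. G (x, \<omega>)) \<in> borel_measurable borel" by (rule fourier_measurable) measurable
      have "(\<integral>\<^sup>+t. ennreal ((p x t)\<^sup>2) \<partial>lborel) = (\<integral>\<^sup>+t. ennreal ((norm (fourier (\<lambda>\<omega>. G (x, \<omega>)) t))\<^sup>2) \<partial>lborel)"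
        unfolding p_def
        using nn_integral_lborel_shift(2)[of "\<lambda>t. ennreal ((norm (fourier (\<lambda>\<omega>. G (x, \<omega>)) t))\<^sup>2)" 0] by simp
      then show ?thesis using fourier_bessel[OF slice[of x]] by simp
    qed
    have pt: "ennreal (w t * norm (synth \<gamma> G t)) \<le> (\<integral>\<^sup>+x. ?J x t \<partial>lborel)" for t
    proof -
      let ?F = "\<lambda>z. G z * (\<gamma> (t - fst z) * cis (2 * pi * (t \<bullet> snd z)))"
      have "integrable lborel ?F" by (rule integrable_mult_bounded[OF Gi, where C=c]) (use c in auto)
      then have "integrable (lborel \<Otimes>\<^sub>M lborel) ?F" unfolding lborel_prod .
      from lborel_pair.integral_fst'[OF this]
      have "synth \<gamma> G t = (LINT x|lborel. LINT \<omega>|lborel. ?F (x, \<omega>))"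
        unfolding synth_def lborel_prod by simp
      also have "\<dots> = (LINT x|lborel. \<gamma> (t - x) * fourier (\<lambda>\<omega>. G (x, \<omega>)) (- t))"
      proof (rule Bochner_Integration.integral_cong[OF refl])
        fix x
        have "(LINT \<omega>|lborel. ?F (x, \<omega>)) = (LINT \<omega>|lborel. \<gamma> (t - x) * (G (x, \<omega>) * cis (- 2 * pi * (\<omega> \<bullet> (- t)))))"
          by (simp add: mult_ac inner_commute)
        then show "(LINT \<omega>|lborel. ?F (x, \<omega>)) = \<gamma> (t - x) * fourier (\<lambda>\<omega>. G (x, \<omega>)) (- t)"
          by (simp only: integral_mult_right_zero fourier_def)
      qed
      finally have "ennreal (norm (synth \<gamma> G t)) \<le> (\<integral>\<^sup>+x. ennreal (norm (\<gamma> (t - x)) * p x t) \<partial>lborel)"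
        using norm_integral_le_nn_integral[of lborel "\<lambda>x. \<gamma> (t - x) * fourier (\<lambda>\<omega>. G (x, \<omega>)) (- t)"] by (simp add: p_def norm_mult)
      then have "ennreal (w t) * ennreal (norm (synth \<gamma> G t)) \<le> ennreal (w t) * (\<integral>\<^sup>+x. ennreal (norm (\<gamma> (t - x)) * p x t) \<partial>lborel)"
        by (rule mult_left_mono) simp
      also have "\<dots> = (\<integral>\<^sup>+x. ennreal (w t) * ennreal (norm (\<gamma> (t - x)) * p x t) \<partial>lborel)"
        by (rule nn_integral_cmult[symmetric]) measurable
      also have "\<dots> \<le> (\<integral>\<^sup>+x. ?J x t \<partial>lborel)"
      proof (rule nn_integral_mono)
        fix x
        have p0: "p x t \<ge> 0" by (simp add: p_def)
        have "w t \<le> K * w x * (1 + norm (t - x)) ^ n" using mod[of x "t - x"] by simp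
        then have "w t * (norm (\<gamma> (t - x)) * p x t) \<le> (K * w x * (1 + norm (t - x)) ^ n) * (norm (\<gamma> (t - x)) * p x t)"
          using p0 by (intro mult_right_mono) auto
        also have "\<dots> = K * \<kappa> (t - x) * (w x * p x t)" by (simp add: \<kappa>_def mult_ac)
        also have "\<dots> = sqrt (\<kappa> (t - x)) * (K * sqrt (\<kappa> (t - x)) * (w x * p x t))"
        proof -
          have "\<kappa> (t - x) = sqrt (\<kappa> (t - x)) * sqrt (\<kappa> (t - x))" using \<kappa>0 by simp
          then show ?thesis by (metis mult.assoc mult.left_commute)
        qed
        finally show "ennreal (w t) * ennreal (norm (\<gamma> (t - x)) * p x t) \<le> ?J x t"
          using wpos[of t] wpos[of x] K p0 \<kappa>0[of "t - x"]
          by (simp only: ennreal_mult[symmetric] less_imp_le mult_nonneg_nonneg real_sqrt_ge_zero norm_ge_zero ennreal_leI)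
      qed
      finally show ?thesis using wpos[of t] by (simp add: ennreal_mult less_imp_le)
    qed
    have sq: "?s t \<le> ennreal a * (\<integral>\<^sup>+x. ?I x t \<partial>lborel)" for t
    proof -
      \<comment> \<open>half of the kernel goes to each factor of the Cauchy-Schwarz inequality\<close>
      let ?f = "\<lambda>x. ennreal (sqrt (\<kappa> (t - x)))" and ?g = "\<lambda>x. ennreal (K * sqrt (\<kappa> (t - x)) * (w x * p x t))"
      have "?s t = (ennreal (w t * norm (synth \<gamma> G t)))\<^sup>2"
        using wpos[of t] by (simp add: ennreal_power less_imp_le)
      also have "\<dots> \<le> (\<integral>\<^sup>+x. ?f x * ?g x \<partial>lborel)\<^sup>2" by (intro power_mono pt) simp
      also have "\<dots> \<le> (\<integral>\<^sup>+x. (?f x)\<^sup>2 \<partial>lborel) * (\<integral>\<^sup>+x. (?g x)\<^sup>2 \<partial>lborel)"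
        by (rule Cauchy_Schwarz_nn_integral) measurable
      also have "(\<lambda>x. (?f x)\<^sup>2) = (\<lambda>x. ennreal (\<kappa> (t - x)))" using \<kappa>0 by (simp add: ennreal_power)
      also have "(\<integral>\<^sup>+x. ennreal (\<kappa> (t - x)) \<partial>lborel) = ennreal a"
        using nn_integral_lborel_shift(2)[of "\<lambda>y. ennreal (\<kappa> y)" t] \<kappa>i \<kappa>0 by (simp add: a_def nn_integral_eq_integral)
      also have "(\<lambda>x. (?g x)\<^sup>2) = (\<lambda>x. ?I x t)"
        using K \<kappa>0 wpos by (simp add: ennreal_power power_mult_distrib ennreal_mult[symmetric] less_imp_le p_def)
      finally show ?thesis .
    qed
    have "(\<integral>\<^sup>+t. ?s t \<partial>lborel)
       \<le> (\<integral>\<^sup>+t. ennreal a * (\<integral>\<^sup>+x. ?I x t \<partial>lborel) \<partial>lborel)"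
      by (rule nn_integral_mono[OF sq])
    also have "\<dots> = ennreal a * (\<integral>\<^sup>+t. (\<integral>\<^sup>+x. ?I x t \<partial>lborel) \<partial>lborel)"
      by (rule nn_integral_cmult) measurable
    also have "(\<integral>\<^sup>+t. (\<integral>\<^sup>+x. ?I x t \<partial>lborel) \<partial>lborel)
       = (\<integral>\<^sup>+x. (\<integral>\<^sup>+t. ?I x t \<partial>lborel) \<partial>lborel)"
      by (rule lborel_pair.Fubini') measurable
    also have "\<dots> \<le> (\<integral>\<^sup>+x. (\<integral>\<^sup>+t. ennreal (K\<^sup>2 * b) * ennreal ((w x)\<^sup>2) * ennreal ((p x t)\<^sup>2) \<partial>lborel) \<partial>lborel)"
    proof (intro nn_integral_mono)
      fix x t
      have "K\<^sup>2 * \<kappa> (t - x) * ((w x)\<^sup>2 * (p x t)\<^sup>2) \<le> K\<^sup>2 * b * ((w x)\<^sup>2 * (p x t)\<^sup>2)"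
        by (intro mult_right_mono mult_left_mono b) auto
      then show "?I x t \<le> ennreal (K\<^sup>2 * b) * ennreal ((w x)\<^sup>2) * ennreal ((p x t)\<^sup>2)"
        using \<kappa>0 b(1) by (simp add: ennreal_mult[symmetric] ennreal_leI mult.assoc)
    qed
    also have "\<dots> = (\<integral>\<^sup>+x. ennreal (K\<^sup>2 * b) * ennreal ((w x)\<^sup>2) * (\<integral>\<^sup>+t. ennreal ((p x t)\<^sup>2) \<partial>lborel) \<partial>lborel)"
      by (intro nn_integral_cong nn_integral_cmult) measurable
    also have "\<dots> \<le> (\<integral>\<^sup>+x. ennreal (K\<^sup>2 * b) * ennreal ((w x)\<^sup>2) * ?S x \<partial>lborel)"
      by (intro nn_integral_mono mult_left_mono bess) simp
    also have "\<dots> = (\<integral>\<^sup>+x. ennreal (K\<^sup>2 * b) * ?W x \<partial>lborel)"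
    proof (rule nn_integral_cong)
      fix x
      have "?W x = ennreal ((w x)\<^sup>2) * ?S x"
        by (subst nn_integral_cmult[symmetric]) (auto simp: power_mult_distrib ennreal_mult)
      then show "ennreal (K\<^sup>2 * b) * ennreal ((w x)\<^sup>2) * ?S x
        = ennreal (K\<^sup>2 * b) * ?W x" by (simp only: mult.assoc)
    qed
    also have "\<dots> = ennreal (K\<^sup>2 * b) * (\<integral>\<^sup>+x. ?W x \<partial>lborel)"
      by (rule nn_integral_cmult) measurable
    also have "(\<integral>\<^sup>+x. ?W x \<partial>lborel) = (\<integral>\<^sup>+z. ennreal ((w (fst z) * norm (G z))\<^sup>2) \<partial>lborel)"
      using lborel.nn_integral_fst[of "\<lambda>z. ennreal ((w (fst z) * norm (G z))\<^sup>2)" lborel] unfolding lborel_prod by simp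
    finally show ?thesis using a b(1) by (simp add: ennreal_mult mult_left_mono mult.assoc)
  qed
  moreover have "?C \<ge> 0" using a b(1) by simp
  ultimately show ?thesis by (intro exI[of _ ?C]) blast
qed

lemma integrable_mult_L2:
  fixes f h :: "'a \<Rightarrow> complex"
  assumes [measurable]: "f \<in> borel_measurable M" "h \<in> borel_measurable M"
    and f: "integrable M (\<lambda>x. (norm (f x))\<^sup>2)" and h: "integrable M (\<lambda>x. (norm (h x))\<^sup>2)"
  shows "integrable M (\<lambda>x. f x * h x)"
proof (rule Bochner_Integration.integrable_bound)
  show "integrable M (\<lambda>x. (norm (f x))\<^sup>2 + (norm (h x))\<^sup>2)" using f h by simp
  have "norm (f x * h x) \<le> (norm (f x))\<^sup>2 + (norm (h x))\<^sup>2" for x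
  proof -
    have "2 * (norm (f x) * norm (h x)) \<le> (norm (f x))\<^sup>2 + (norm (h x))\<^sup>2"
      using sum_squares_bound[of "norm (f x)" "norm (h x)"] by simp
    moreover have "0 \<le> norm (f x) * norm (h x)" by simp
    ultimately show ?thesis unfolding norm_mult by linarith
  qed
  then show "AE x in M. norm (f x * h x) \<le> norm ((norm (f x))\<^sup>2 + (norm (h x))\<^sup>2)" by simp
qed measurable

lemma square_integrable_add:
  fixes f h :: "'a \<Rightarrow> complex"
  assumes [measurable]: "f \<in> borel_measurable M" "h \<in> borel_measurable M"
    and f: "integrable M (\<lambda>x. (norm (f x))\<^sup>2)" and h: "integrable M (\<lambda>x. (norm (h x))\<^sup>2)"
  shows "integrable M (\<lambda>x. (norm (f x + h x))\<^sup>2)"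
proof (rule Bochner_Integration.integrable_bound)
  show "integrable M (\<lambda>x. 2 * (norm (f x))\<^sup>2 + 2 * (norm (h x))\<^sup>2)" using f h by simp
  have "(norm (f x + h x))\<^sup>2 \<le> 2 * (norm (f x))\<^sup>2 + 2 * (norm (h x))\<^sup>2" for x
  proof -
    have "(norm (f x + h x))\<^sup>2 \<le> (norm (f x) + norm (h x))\<^sup>2" by (intro power_mono norm_triangle_ineq) auto
    then show ?thesis using sum_squares_bound[of "norm (f x)" "norm (h x)"] by (simp add: power2_sum)
  qed
  then show "AE x in M. norm ((norm (f x + h x))\<^sup>2) \<le> norm (2 * (norm (f x))\<^sup>2 + 2 * (norm (h x))\<^sup>2)" by simp
qed measurable

lemma integrable_nn_integral_le:
  fixes f :: "'a \<Rightarrow> real"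
  assumes "f \<in> borel_measurable M" "\<And>x. f x \<ge> 0" "(\<integral>\<^sup>+x. ennreal (f x) \<partial>M) \<le> ennreal c"
  shows "integrable M f"
  using assms by (intro integrableI_bounded) (auto intro: le_less_trans)

lemma synth_measurable:
  assumes [measurable]: "\<gamma> \<in> borel_measurable borel" "G \<in> borel_measurable borel"
  shows "synth \<gamma> G \<in> borel_measurable borel"
proof -
  have "(\<lambda>t. LINT z|lborel. G z * (\<gamma> (t - fst z) * cis (2 * pi * (t \<bullet> snd z)))) \<in> borel_measurable lborel"
    by (rule lborel.borel_measurable_lebesgue_integral) measurable
  then show ?thesis by (simp add: synth_def[abs_def])
qed

lemma synth_pairing:
  fixes \<gamma> :: "'a::euclidean_space \<Rightarrow> complex"
  assumes [measurable]: "\<gamma> \<in> borel_measurable borel" and \<gamma>: "\<And>y. norm (\<gamma> y) \<le> c"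
    and G: "integrable lborel G" and h: "integrable lborel h"
  shows "(LINT t|lborel. synth \<gamma> G t * h t) = (LINT z|lborel. window_coeff \<gamma> h z * G z)"
proof -
  note [measurable] = borel_measurable_integrable[OF G, simplified] borel_measurable_integrable[OF h, simplified]
  let ?k = "\<lambda>z t. G z * h t * (\<gamma> (t - fst z) * cis (2 * pi * (t \<bullet> snd z)))"
  have "integrable (lborel \<Otimes>\<^sub>M lborel) (\<lambda>p. (case p of (z, t) \<Rightarrow> G z * h t) * (\<gamma> (snd p - fst (fst p)) * cis (2 * pi * (snd p \<bullet> snd (fst p)))))"
    by (rule integrable_mult_bounded[OF integrable_prod_mult[OF G h], where C=c]) (use \<gamma> in auto)
  then have i: "integrable (lborel \<Otimes>\<^sub>M lborel) (\<lambda>(z, t). ?k z t)" by (simp add: case_prod_unfold)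
  have "(LINT t|lborel. synth \<gamma> G t * h t) = (LINT t|lborel. LINT z|lborel. ?k z t)"
    unfolding synth_def integral_mult_left_zero[symmetric] by (simp only: ac_simps)
  also have "\<dots> = (LINT z|lborel. LINT t|lborel. ?k z t)" by (rule lborel_pair.Fubini_integral[OF i])
  also have "\<dots> = (LINT z|lborel. window_coeff \<gamma> h z * G z)"
  proof (rule Bochner_Integration.integral_cong[OF refl])
    fix z
    have "(LINT t|lborel. ?k z t) = (LINT t|lborel. (h t * \<gamma> (t - fst z) * cis (2 * pi * (t \<bullet> snd z))) * G z)"
      by (simp only: ac_simps)
    also have "\<dots> = window_coeff \<gamma> h (fst z, snd z) * G z" by (simp only: integral_mult_left_zero window_coeff_altdef)
    finally show "(LINT t|lborel. ?k z t) = window_coeff \<gamma> h z * G z" by simp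
  qed
  finally show ?thesis .
qed

text \<open>The data \<open>F\<close> are truncated to balls. By \<open>synth_bound\<close> the densities of the truncations, multiplied by \<open>w\<close>, are
Cauchy in \<open>L2\<close>, with the tails of the weighted integral of \<open>F\<close> as rate. Dividing the limit by \<open>w\<close> gives the density: pairing
with a Schwartz function passes to the limit because \<open>1 / w\<close> grows at most polynomially.\<close>

theorem L2_representation:
  fixes \<gamma> :: "'a::euclidean_space \<Rightarrow> complex" and w :: "'a \<Rightarrow> real"
  assumes \<gamma>m[measurable]: "\<gamma> \<in> borel_measurable borel" and \<gamma>: "rapid \<gamma>"
    and wm[measurable]: "w \<in> borel_measurable borel" and wpos: "\<And>x. w x > 0"
    and K: "K \<ge> 0" and mod: "\<And>x y. w (x + y) \<le> K * w x * (1 + norm y) ^ n"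
    and Fc: "continuous_on UNIV F" and F2: "integrable lborel (\<lambda>z. (w (fst z) * norm (F z))\<^sup>2)"
    and \<Phi>: "\<And>h. h \<in> schwartz \<Longrightarrow> integrable lborel (\<lambda>z. window_coeff \<gamma> h z * F z)"
      "\<And>h. h \<in> schwartz \<Longrightarrow> \<Phi> h = (LINT z|lborel. window_coeff \<gamma> h z * F z)"
  shows "\<exists>u. represents u \<Phi> \<and> integrable lborel (\<lambda>x. (w x * norm (u x))\<^sup>2)"
proof -
  have Fm[measurable]: "F \<in> borel_measurable borel" by (rule borel_measurable_continuous_onI[OF Fc])
  obtain c where c: "\<And>y. norm (\<gamma> y) \<le> c" using rapid_bounded[OF \<gamma>] by blast
  define Fn where "Fn k z = indicator (cball 0 (real k)) z * F z" for k z
  have Fnm[measurable]: "Fn k \<in> borel_measurable borel" for k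
    unfolding Fn_def by (intro borel_measurable_times borel_measurable_indicator Fm) auto
  have Fn0: "Fn k z = 0" if "norm z > real k" for k z using that by (simp add: Fn_def)
  have "\<exists>B. \<forall>z. norm (Fn k z) \<le> B" for k
  proof -
    have "bounded (F ` cball 0 (real k))"
      by (intro compact_imp_bounded compact_continuous_image continuous_on_subset[OF Fc]) auto
    then obtain B where "\<And>z. z \<in> cball 0 (real k) \<Longrightarrow> norm (F z) \<le> B" unfolding bounded_iff by blast
    then have "norm (Fn k z) \<le> max B 0" for z by (cases "z \<in> cball 0 (real k)") (simp_all add: Fn_def le_max_iff_disj)
    then show ?thesis by blast
  qed
  then obtain B where B: "\<And>k z. norm (Fn k z) \<le> B k" by metis
  have Fni: "integrable lborel (Fn k)" for k
    by (rule bounded_support_integrable[OF Fnm B Fn0])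
  obtain C where C: "C \<ge> 0" and Cb: "\<And>G B R. G \<in> borel_measurable borel \<Longrightarrow> (\<And>z. norm (G z) \<le> B) \<Longrightarrow> (\<And>z. norm z > R \<Longrightarrow> G z = 0) \<Longrightarrow>
    (\<integral>\<^sup>+t. ennreal ((w t * norm (synth \<gamma> G t))\<^sup>2) \<partial>lborel) \<le> ennreal C * (\<integral>\<^sup>+z. ennreal ((w (fst z) * norm (G z))\<^sup>2) \<partial>lborel)"
    using synth_bound[OF \<gamma>m \<gamma> wm wpos K mod] by blast
  define U where "U k t = of_real (w t) * synth \<gamma> (Fn k) t" for k t
  have Um[measurable]: "U k \<in> borel_measurable borel" for k
    using synth_measurable[OF \<gamma>m Fnm[of k]] unfolding U_def by measurable
  let ?q = "\<lambda>z. (w (fst z) * norm (F z))\<^sup>2"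
  define T where "T k = (LINT z|lborel. indicator {z. norm z > real k} z * ?q z)" for k :: nat
  have qi: "integrable lborel (\<lambda>z. indicator {z. norm z > real k} z * ?q z)" for k :: nat
    using integrable_mult_indicator[OF _ F2, of "{z. norm z > real k}"] by simp
  have Tlim: "T \<longlonglongrightarrow> 0"
  proof -
    have "T \<longlonglongrightarrow> (LINT z|lborel. 0 * ?q z)" unfolding T_def
    proof (rule integral_dominated_convergence[OF _ _ F2])
      show "AE z in lborel. (\<lambda>k. indicator {z. norm z > real k} z * ?q z) \<longlonglongrightarrow> 0 * ?q z"
      proof (intro AE_I2 tendsto_intros tendsto_eventually eventually_sequentiallyI)
        fix z :: "'a \<times> 'a" and k assume "nat \<lceil>norm z\<rceil> \<le> k"
        then show "indicator {z. norm z > real k} z = (0::real)" by (auto simp: indicator_def)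
      qed
      show "AE z in lborel. norm (indicator {z. norm z > real k} z * ?q z) \<le> ?q z" for k
        by (intro AE_I2) (auto simp: indicator_def)
    qed measurable
    then show ?thesis by simp
  qed
  define e where "e k = ennreal C * ennreal (T k)" for k
  have elim: "e \<longlonglongrightarrow> 0"
  proof -
    have "(\<lambda>k. ennreal (C * T k)) \<longlonglongrightarrow> ennreal (C * 0)" by (intro tendsto_ennrealI tendsto_mult_left Tlim)
    then show ?thesis using C unfolding e_def by (simp add: ennreal_mult')
  qed
  have Ub: "(\<integral>\<^sup>+t. ennreal ((norm (U k t - U j t))\<^sup>2) \<partial>lborel) \<le> e j" if jk: "j \<le> k" for j k
  proof -
    let ?G = "\<lambda>z. Fn k z - Fn j z"
    have "synth \<gamma> ?G t = synth \<gamma> (Fn k) t - synth \<gamma> (Fn j) t" for t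
    proof -
      have i: "integrable lborel (\<lambda>z. Fn k z * (\<gamma> (t - fst z) * cis (2 * pi * (t \<bullet> snd z))))" for k
        by (rule integrable_mult_bounded[OF Fni, where C=c]) (use c in auto)
      show ?thesis unfolding synth_def left_diff_distrib by (rule Bochner_Integration.integral_diff[OF i i])
    qed
    then have "norm (U k t - U j t) = w t * norm (synth \<gamma> ?G t)" for t
      using wpos[of t] by (simp add: U_def norm_mult flip: right_diff_distrib)
    then have "(\<integral>\<^sup>+t. ennreal ((norm (U k t - U j t))\<^sup>2) \<partial>lborel) \<le> ennreal C * (\<integral>\<^sup>+z. ennreal ((w (fst z) * norm (?G z))\<^sup>2) \<partial>lborel)"
      by (simp only:) (rule Cb[of _ "B k + B j" "real k"], use jk Fn0 B in \<open>auto intro!: order_trans[OF norm_triangle_ineq4] add_mono\<close>)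
    also have "\<dots> \<le> ennreal C * (\<integral>\<^sup>+z. ennreal (indicator {z. norm z > real j} z * ?q z) \<partial>lborel)"
    proof (intro mult_left_mono nn_integral_mono ennreal_leI)
      fix z
      show "(w (fst z) * norm (?G z))\<^sup>2 \<le> indicator {z. norm z > real j} z * ?q z"
        using jk by (auto simp: Fn_def indicator_def)
    qed simp
    also have "\<dots> = e j" unfolding e_def T_def using qi by (subst nn_integral_eq_integral) auto
    finally show ?thesis .
  qed
  obtain V where Vm: "V \<in> borel_measurable lborel" and V: "\<And>k. (\<integral>\<^sup>+t. ennreal ((norm (V t - U k t))\<^sup>2) \<partial>lborel) \<le> e k"
    using L2_complete[of U lborel e, OF _ Ub elim] by auto
  have Vm'[measurable]: "V \<in> borel_measurable borel" using Vm by simp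
  have U2: "integrable lborel (\<lambda>t. (norm (U k t))\<^sup>2)" for k
  proof (rule integrable_nn_integral_le)
    have "(\<integral>\<^sup>+t. ennreal ((norm (U k t))\<^sup>2) \<partial>lborel) = (\<integral>\<^sup>+t. ennreal ((w t * norm (synth \<gamma> (Fn k) t))\<^sup>2) \<partial>lborel)"
      using wpos by (simp add: U_def norm_mult less_imp_le)
    also have "\<dots> \<le> ennreal C * (\<integral>\<^sup>+z. ennreal ((w (fst z) * norm (Fn k z))\<^sup>2) \<partial>lborel)"
      by (rule Cb[OF Fnm B Fn0])
    also have "\<dots> \<le> ennreal C * (\<integral>\<^sup>+z. ennreal (?q z) \<partial>lborel)"
      by (intro mult_left_mono nn_integral_mono ennreal_leI) (auto simp: Fn_def indicator_def)
    also have "\<dots> = ennreal (C * (LINT z|lborel. ?q z))"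
      using F2 C by (subst nn_integral_eq_integral) (auto simp: ennreal_mult')
    finally show "(\<integral>\<^sup>+t. ennreal ((norm (U k t))\<^sup>2) \<partial>lborel) \<le> ennreal (C * (LINT z|lborel. ?q z))" .
  qed auto
  have VU2: "integrable lborel (\<lambda>t. (norm (V t - U k t))\<^sup>2)" for k
    using V[of k] C by (intro integrable_nn_integral_le[of _ _ "C * T k"]) (auto simp: e_def ennreal_mult')
  have V2: "integrable lborel (\<lambda>t. (norm (V t))\<^sup>2)"
    using square_integrable_add[OF _ _ VU2[of 0] U2[of 0]] by simp
  define u where "u t = V t / of_real (w t)" for t
  have um[measurable]: "u \<in> borel_measurable borel" unfolding u_def by measurable
  have rep: "integrable lborel (\<lambda>t. u t * h t) \<and> \<Phi> h = (LINT t|lborel. u t * h t)" if h: "h \<in> schwartz" for h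
  proof -
    note hm[measurable] = schwartz_measurable[OF h]
    \<comment> \<open>the weight is shared out: \<open>u t * h t = V t * k t\<close> with both factors in \<open>L2\<close>\<close>
    define k where "k t = h t / of_real (w t)" for t
    have km[measurable]: "k \<in> borel_measurable borel" unfolding k_def by measurable
    have "rapid k"
    proof (rule rapid_mult_poly[OF schwartz_rapid[OF h]])
      fix t
      have "w 0 \<le> K * w t * (1 + norm t) ^ n" using mod[of t "- t"] by simp
      then have "1 / w t \<le> (K / w 0) * (1 + norm t) ^ n" using wpos[of 0] wpos[of t] by (simp add: field_simps)
      then have "norm (h t) * (1 / w t) \<le> norm (h t) * ((K / w 0) * (1 + norm t) ^ n)" by (rule mult_left_mono) simp
      then show "norm (k t) \<le> (K / w 0) * (1 + norm t) ^ n * norm (h t)"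
        using wpos[of t] by (simp add: k_def norm_divide mult_ac)
    qed
    then have ki: "integrable lborel k" and "\<exists>c. \<forall>t. norm (k t) \<le> c" by (auto intro: rapid_integrable rapid_bounded)
    then obtain c' where c': "\<And>t. norm (k t) \<le> c'" by blast
    have k2: "integrable lborel (\<lambda>t. (norm (k t))\<^sup>2)" by (rule square_integrable_bounded[OF ki c'])
    have Vk: "integrable lborel (\<lambda>t. V t * k t)" by (rule integrable_mult_L2[OF _ _ V2 k2]) auto
    have Uk: "integrable lborel (\<lambda>t. U j t * k t)" for j by (rule integrable_mult_L2[OF _ _ U2 k2]) auto
    have uh: "u t * h t = V t * k t" for t by (simp add: u_def k_def)
    have e1: "(LINT t|lborel. U j t * k t) = (LINT z|lborel. window_coeff \<gamma> h z * Fn j z)" for j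
    proof -
      have "U j t * k t = synth \<gamma> (Fn j) t * h t" for t using wpos[of t] by (simp add: U_def k_def)
      then show ?thesis by (simp only: synth_pairing[OF \<gamma>m c Fni schwartz_integrable[OF h]])
    qed
    have "(\<lambda>j. LINT z|lborel. window_coeff \<gamma> h z * Fn j z) \<longlonglongrightarrow> (LINT z|lborel. window_coeff \<gamma> h z * F z)"
    proof (rule integral_dominated_convergence[OF _ _ integrable_norm[OF \<Phi>(1)[OF h]]])
      show "AE z in lborel. (\<lambda>j. window_coeff \<gamma> h z * Fn j z) \<longlonglongrightarrow> window_coeff \<gamma> h z * F z"
      proof (intro AE_I2 tendsto_intros tendsto_eventually eventually_sequentiallyI)
        fix z :: "'a \<times> 'a" and j assume "nat \<lceil>norm z\<rceil> \<le> j"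
        then have "norm z \<le> real j" by linarith
        then show "Fn j z = F z" by (simp add: Fn_def)
      qed
      show "AE z in lborel. norm (window_coeff \<gamma> h z * Fn j z) \<le> norm (window_coeff \<gamma> h z * F z)" for j
        by (intro AE_I2) (auto simp: Fn_def indicator_def)
    qed (use window_coeff_measurable[OF \<gamma>m hm] in measurable)
    then have lim1: "(\<lambda>j. LINT t|lborel. U j t * k t) \<longlonglongrightarrow> \<Phi> h" by (simp only: e1 \<Phi>(2)[OF h])
    let ?d = "\<lambda>j. (LINT t|lborel. V t * k t) - (LINT t|lborel. U j t * k t)"
    define Q where "Q = (LINT t|lborel. (norm (k t))\<^sup>2)"
    have le: "(norm (?d j))\<^sup>2 \<le> C * T j * Q" for j
    proof -
      have T0: "T j \<ge> 0" unfolding T_def by (intro integral_nonneg_AE) (auto simp: indicator_def)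
      have Q0: "Q \<ge> 0" unfolding Q_def by (intro integral_nonneg_AE) auto
      have "?d j = (LINT t|lborel. (V t - U j t) * k t)"
        unfolding left_diff_distrib by (rule Bochner_Integration.integral_diff[OF Vk Uk, symmetric])
      then have "ennreal (norm (?d j)) \<le> (\<integral>\<^sup>+t. ennreal (norm (V t - U j t)) * ennreal (norm (k t)) \<partial>lborel)"
        using norm_integral_le_nn_integral[of lborel "\<lambda>t. (V t - U j t) * k t"] by (simp add: norm_mult ennreal_mult)
      then have "(ennreal (norm (?d j)))\<^sup>2 \<le> (\<integral>\<^sup>+t. ennreal (norm (V t - U j t)) * ennreal (norm (k t)) \<partial>lborel)\<^sup>2"
        by (intro power_mono) auto
      also have "\<dots> \<le> (\<integral>\<^sup>+t. (ennreal (norm (V t - U j t)))\<^sup>2 \<partial>lborel) * (\<integral>\<^sup>+t. (ennreal (norm (k t)))\<^sup>2 \<partial>lborel)"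
        by (rule Cauchy_Schwarz_nn_integral) measurable
      also have "\<dots> \<le> e j * ennreal Q"
        unfolding Q_def using V[of j] nn_integral_eq_integral[OF k2] by (simp add: ennreal_power mult_right_mono)
      also have "\<dots> = ennreal (C * T j * Q)" unfolding e_def using C T0 Q0 by (simp add: ennreal_mult')
      finally show ?thesis using C T0 Q0 by (simp add: ennreal_power)
    qed
    have "(\<lambda>j. (norm (?d j))\<^sup>2) \<longlonglongrightarrow> 0"
    proof (rule Lim_null_comparison)
      have "(\<lambda>j. C * T j * Q) \<longlonglongrightarrow> C * 0 * Q" by (intro tendsto_intros Tlim)
      then show "(\<lambda>j. C * T j * Q) \<longlonglongrightarrow> 0" by simp
    qed (use le in simp)
    then have "(\<lambda>j. sqrt ((norm (?d j))\<^sup>2)) \<longlonglongrightarrow> sqrt 0"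
      by (intro tendsto_intros)
    then have "(\<lambda>j. ?d j) \<longlonglongrightarrow> 0"
      using tendsto_norm_zero_iff by fastforce
    then have "(\<lambda>j. (LINT t|lborel. V t * k t) - (?d j)) \<longlonglongrightarrow> (LINT t|lborel. V t * k t) - 0"
      by (intro tendsto_intros)
    then have "(\<lambda>j. LINT t|lborel. U j t * k t) \<longlonglongrightarrow> (LINT t|lborel. V t * k t)" by simp
    with lim1 have "\<Phi> h = (LINT t|lborel. V t * k t)" using LIMSEQ_unique by blast
    then show ?thesis using Vk by (simp add: uh)
  qed
  have "represents u \<Phi>" unfolding represents_def using rep by simp
  moreover have "(w t * norm (u t))\<^sup>2 = (norm (V t))\<^sup>2" for t using wpos[of t] by (simp add: u_def norm_divide)
  then have "integrable lborel (\<lambda>x. (w x * norm (u x))\<^sup>2)" using V2 by simp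
  ultimately show ?thesis by blast
qed

section \<open>Densities in space and in frequency\<close>

lemma weights_PD:
  assumes "m \<in> weights_P"
  shows "continuous_on UNIV m" "\<And>z. m z > 0"
    "\<exists>K>0. \<exists>n::nat. \<forall>z y. m (z + y) \<le> K * m z * (1 + norm y) ^ n"
proof -
  show "continuous_on UNIV m" and pos: "m z > 0" for z using assms by (auto simp: weights_P_def weight_def)
  obtain s C where s: "C > 0" "\<And>x y. m (x + y) \<le> C * m x * (1 + norm y) powr s"
    using assms by (auto simp: weights_P_def moderate_def poly_weight_def)
  have "m (z + y) \<le> C * m z * (1 + norm y) ^ nat \<lceil>s\<rceil>" for z y
  proof -
    have "(1 + norm y) powr s \<le> (1 + norm y) powr real (nat \<lceil>s\<rceil>)" by (intro powr_mono) (auto, linarith)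
    also have "\<dots> = (1 + norm y) ^ nat \<lceil>s\<rceil>" by (intro powr_realpow) (simp add: add_pos_nonneg)
    finally have "C * m z * (1 + norm y) powr s \<le> C * m z * (1 + norm y) ^ nat \<lceil>s\<rceil>"
      using s(1) pos[of z] by (intro mult_left_mono) auto
    then show ?thesis using s(2)[of z y] by simp
  qed
  then show "\<exists>K>0. \<exists>n::nat. \<forall>z y. m (z + y) \<le> K * m z * (1 + norm y) ^ n" using s(1) by blast
qed

text \<open>Taking the infimum over \<open>\<omega>\<close> leaves a weight in the space variable alone, as the frequency variable is
integrated away in \<open>synth_bound\<close>. Moderateness survives with the same constants; measurability holds because an infimum of
continuous functions is upper semicontinuous.\<close>

lemma infimum_weight:
  fixes m :: "'a::euclidean_space \<times> 'b::euclidean_space \<Rightarrow> real"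
  assumes cont: "continuous_on UNIV m" and pos: "\<And>z. m z > 0"
    and K: "K > 0" "\<And>z y. m (z + y) \<le> K * m z * (1 + norm y) ^ n"
  defines "w \<equiv> \<lambda>x. INF \<omega>. m (x, \<omega>)"
  shows "w \<in> borel_measurable borel" "\<And>x \<omega>. w x \<le> m (x, \<omega>)" "\<And>x y. w (x + y) \<le> K * w x * (1 + norm y) ^ n"
    "\<And>c x. (\<And>\<omega>. c \<le> m (x, \<omega>)) \<Longrightarrow> c \<le> w x"
proof -
  have bdd: "bdd_below (range (\<lambda>\<omega>. m (x, \<omega>)))" for x using pos by (auto intro!: bdd_belowI[of _ 0] less_imp_le)
  show le: "w x \<le> m (x, \<omega>)" for x \<omega> unfolding w_def by (intro cINF_lower bdd) simp
  show ge: "c \<le> w x" if "\<And>\<omega>. c \<le> m (x, \<omega>)" for c x unfolding w_def by (intro cINF_greatest that) simp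
  show "w \<in> borel_measurable borel"
  proof (rule borel_measurableI_less)
    fix a
    have "{x. w x < a} = (\<Union>\<omega>. {x. m (x, \<omega>) < a})"
      unfolding w_def by (auto simp: cINF_less_iff[OF _ bdd])
    moreover have "open {x. m (x, \<omega>) < a}" for \<omega>
      by (intro open_Collect_less continuous_intros continuous_on_compose2[OF cont]) auto
    ultimately have "open {x. w x < a}" by (simp add: open_UN)
    then show "{x \<in> space borel. w x < a} \<in> sets borel" by simp
  qed
  show "w (x + y) \<le> K * w x * (1 + norm y) ^ n" for x y
  proof -
    let ?p = "K * (1 + norm y) ^ n"
    have p: "?p > 0" using K(1) by (simp add: add_pos_nonneg)
    have "w (x + y) / ?p \<le> w x"
    proof (rule ge)
      fix \<omega>
      have "w (x + y) \<le> m ((x, \<omega>) + (y, 0))" using le[of "x + y" \<omega>] by simp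
      also have "\<dots> \<le> K * m (x, \<omega>) * (1 + norm (y, 0::'b)) ^ n" by (rule K)
      also have "\<dots> = m (x, \<omega>) * ?p" by simp
      finally show "w (x + y) / ?p \<le> m (x, \<omega>)" using p by (simp only: pos_divide_le_eq)
    qed
    then have "w (x + y) \<le> w x * ?p" using p by (simp only: pos_divide_le_eq)
    then show ?thesis by (simp only: ac_simps)
  qed
qed

text \<open>The infimum of \<open>m\<close> over an unbounded set may vanish, but moderateness spreads positivity from the one point
where \<open>\<psi>\<close> is nonzero to the whole space.\<close>

lemma positive_infimum_weight:
  fixes m :: "'a::euclidean_space \<times> 'b::euclidean_space \<Rightarrow> real" and \<psi> :: "'a \<Rightarrow> complex"
  assumes cont: "continuous_on UNIV m" and pos: "\<And>z. m z > 0"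
    and K: "K > 0" "\<And>z y. m (z + y) \<le> K * m z * (1 + norm y) ^ n"
    and \<psi>: "\<And>x \<omega>. norm (\<psi> x) \<le> m (x, \<omega>)" and nz: "\<psi> \<noteq> (\<lambda>_. 0)"
  shows "\<exists>w. w \<in> borel_measurable borel \<and> (\<forall>x. w x > 0) \<and> (\<forall>x \<omega>. w x \<le> m (x, \<omega>)) \<and>
    (\<forall>x y. w (x + y) \<le> K * w x * (1 + norm y) ^ n) \<and> (\<forall>x. norm (\<psi> x) \<le> w x)"
proof -
  define w where "w x = (INF \<omega>. m (x, \<omega>))" for x
  note W = infimum_weight[OF cont pos K, folded w_def]
  have \<psi>w: "norm (\<psi> x) \<le> w x" for x by (rule W(4)) (rule \<psi>)
  obtain x0 where "\<psi> x0 \<noteq> 0" using nz by auto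
  then have "w x0 > 0" using \<psi>w[of x0] by (meson less_le_trans zero_less_norm_iff)
  have "w x > 0" for x
  proof (rule ccontr)
    assume "\<not> w x > 0"
    then have "K * w x \<le> 0" using K(1) by (simp add: mult_le_0_iff)
    then have "K * w x * (1 + norm (x0 - x)) ^ n \<le> 0" by (rule mult_nonpos_nonneg) simp
    then show False using W(3)[of x "x0 - x"] \<open>w x0 > 0\<close> by simp
  qed
  then show ?thesis using W \<psi>w by blast
qed

text \<open>The infimum weight depends on the space variable alone, as \<open>L2_representation\<close> requires; it lies
between \<open>\<psi>\<close> and \<open>m\<close>, so the hypothesis on \<open>F\<close> is passed to it and the conclusion is passed on to \<open>\<psi>\<close>.\<close>

lemma weighted_representation:
  fixes m :: "'a::euclidean_space \<times> 'a \<Rightarrow> real" and \<psi> :: "'a \<Rightarrow> complex"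
  assumes \<gamma>: "\<gamma> \<in> schwartz" and m: "continuous_on UNIV m" "\<And>z. m z > 0"
    and K: "K > 0" "\<And>z y. m (z + y) \<le> K * m z * (1 + norm y) ^ n"
    and \<psi>: "\<And>x \<omega>. norm (\<psi> x) \<le> m (x, \<omega>)" "\<psi> \<noteq> (\<lambda>_. 0)" "continuous_on UNIV \<psi>"
    and F: "continuous_on UNIV F" "integrable lborel (\<lambda>z. (m z * norm (F z))\<^sup>2)"
    and \<Phi>: "\<And>h. h \<in> schwartz \<Longrightarrow> integrable lborel (\<lambda>z. window_coeff \<gamma> h z * F z)"
      "\<And>h. h \<in> schwartz \<Longrightarrow> \<Phi> h = (LINT z|lborel. window_coeff \<gamma> h z * F z)"
  shows "\<exists>u. represents u \<Phi> \<and> integrable lborel (\<lambda>x. (norm (\<psi> x * u x))\<^sup>2)"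
proof -
  obtain w where w: "w \<in> borel_measurable borel" "\<And>x. w x > 0" "\<And>x \<omega>. w x \<le> m (x, \<omega>)"
      "\<And>x y. w (x + y) \<le> K * w x * (1 + norm y) ^ n" "\<And>x. norm (\<psi> x) \<le> w x"
    using positive_infimum_weight[OF m K \<psi>(1,2)] by blast
  note [measurable] = w(1) borel_measurable_continuous_onI[OF \<psi>(3)] borel_measurable_continuous_onI[OF F(1)]
  have "integrable lborel (\<lambda>z. (w (fst z) * norm (F z))\<^sup>2)"
  proof (rule Bochner_Integration.integrable_bound[OF F(2)])
    have "norm ((w (fst z) * norm (F z))\<^sup>2) \<le> norm ((m z * norm (F z))\<^sup>2)" for z
      using w(2)[of "fst z"] w(3)[of "fst z" "snd z"] by (auto intro!: power_mono mult_right_mono)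
    then show "AE z in lborel. norm ((w (fst z) * norm (F z))\<^sup>2) \<le> norm ((m z * norm (F z))\<^sup>2)" by simp
  qed measurable
  then obtain u where u: "represents u \<Phi>" "integrable lborel (\<lambda>x. (w x * norm (u x))\<^sup>2)"
    using L2_representation[OF schwartz_measurable[OF \<gamma>] schwartz_rapid[OF \<gamma>] w(1,2) less_imp_le[OF K(1)] w(4) F(1) _ \<Phi>]
    by blast
  have [measurable]: "u \<in> borel_measurable borel" using u(1) by (simp add: represents_def)
  have "integrable lborel (\<lambda>x. (norm (\<psi> x * u x))\<^sup>2)"
  proof (rule Bochner_Integration.integrable_bound[OF u(2)])
    show "AE x in lborel. norm ((norm (\<psi> x * u x))\<^sup>2) \<le> norm ((w x * norm (u x))\<^sup>2)"
      using w(5) by (intro AE_I2) (auto simp: norm_mult intro!: power_mono mult_right_mono)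
  qed measurable
  then show ?thesis using u(1) by blast
qed

lemma lborel_distr_reflect: "distr lborel borel uminus = (lborel :: 'a::euclidean_space measure)"
proof -
  have "lborel = density (distr lborel borel (\<lambda>x::'a. 0 + (-1) *\<^sub>R x)) (\<lambda>_. ennreal (\<bar>-1\<bar> ^ DIM('a)))"
    by (rule lborel_affine) simp
  also have "\<dots> = distr lborel borel (uminus :: 'a \<Rightarrow> 'a)" by (simp add: density_1)
  finally show ?thesis ..
qed

text \<open>The Fourier transform acts on phase space by this rotation.\<close>

definition quarter_turn :: "'a::euclidean_space \<times> 'a \<Rightarrow> 'a \<times> 'a" where
  "quarter_turn z = (snd z, - fst z)"

lemma quarter_turn_measurable[measurable]: "quarter_turn \<in> borel_measurable borel"
  unfolding quarter_turn_def[abs_def] by (intro borel_measurable_continuous_onI continuous_intros)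

lemma lborel_distr_quarter_turn:
  "distr lborel borel quarter_turn = (lborel :: ('a::euclidean_space \<times> 'a) measure)"
proof -
  have sf: "sigma_finite_measure (distr lborel borel (uminus :: 'a \<Rightarrow> 'a))"
    unfolding lborel_distr_reflect by (rule sigma_finite_lborel)
  have "(lborel :: ('a \<times> 'a) measure) = distr lborel borel id \<Otimes>\<^sub>M distr lborel borel uminus"
    unfolding lborel_distr_reflect by (simp add: lborel_prod distr_id2 id_def)
  also have "\<dots> = distr (lborel \<Otimes>\<^sub>M lborel) (borel \<Otimes>\<^sub>M borel) (\<lambda>(x, y). (id x, - y))"
    by (rule pair_measure_distr) (auto simp: sf)
  also have "lborel \<Otimes>\<^sub>M lborel = distr (lborel \<Otimes>\<^sub>M lborel) (lborel \<Otimes>\<^sub>M lborel) (\<lambda>(x::'a, y::'a). (y, x))"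
    by (rule lborel_pair.distr_pair_swap)
  finally have "(lborel :: ('a \<times> 'a) measure) = distr (distr lborel lborel (\<lambda>(x, y). (y, x))) borel (\<lambda>(x, y). (id x, - y))"
    by (simp add: lborel_prod borel_prod)
  also have "\<dots> = distr lborel borel quarter_turn"
    by (subst distr_distr) (auto simp: comp_def quarter_turn_def[abs_def] case_prod_unfold intro!: borel_measurable_continuous_onI continuous_intros)
  finally show ?thesis ..
qed

lemma integral_quarter_turn:
  fixes f :: "'a::euclidean_space \<times> 'a \<Rightarrow> 'b::{banach,second_countable_topology}"
  assumes "f \<in> borel_measurable borel"
  shows "(LINT z|lborel. f (quarter_turn z)) = (LINT z|lborel. f z)"
    and "integrable lborel (\<lambda>z. f (quarter_turn z)) \<longleftrightarrow> integrable lborel f"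
  using integral_distr[of quarter_turn lborel borel f] integrable_distr_eq[of quarter_turn lborel borel f] assms
  by (simp_all add: lborel_distr_quarter_turn)

text \<open>Fourier transforms are moved from \<open>h\<close> to the window by the multiplication formula; modulation and translation
exchange their roles.\<close>

lemma window_coeff_fourier:
  fixes g h :: "'a::euclidean_space \<Rightarrow> complex"
  assumes g: "g \<in> schwartz" and h: "h \<in> schwartz"
  shows "window_coeff g (fourier h) z = cis (2 * pi * (fst z \<bullet> snd z)) * window_coeff (fourier g) h (quarter_turn z)"
proof -
  obtain x \<omega> where z: "z = (x, \<omega>)" by (cases z)
  let ?k = "\<lambda>t. g (t - x) * cis (2 * pi * (t \<bullet> \<omega>))"
  note [measurable] = schwartz_measurable[OF g] schwartz_measurable[OF h]
  have ki: "integrable lborel ?k"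
    by (rule integrable_mult_cis[OF schwartz_integrable[OF schwartz_translate[OF g]]]) measurable
  have hi: "integrable lborel h" by (rule schwartz_integrable[OF h])
  have fk: "fourier ?k s = cis (2 * pi * (x \<bullet> \<omega>)) * (fourier g (s - \<omega>) * cis (2 * pi * (s \<bullet> (- x))))" for s
  proof -
    have "fourier ?k s = (LINT t|lborel. g (x + t - x) * cis (2 * pi * ((x + t) \<bullet> \<omega>)) * cis (- 2 * pi * ((x + t) \<bullet> s)))"
      unfolding fourier_def by (rule integral_lborel_shift(1)[symmetric])
    also have "\<dots> = (LINT t|lborel. cis (2 * pi * (x \<bullet> \<omega>)) * cis (2 * pi * (s \<bullet> (- x))) * (g t * cis (- 2 * pi * (t \<bullet> (s - \<omega>)))))"
    proof (rule Bochner_Integration.integral_cong[OF refl])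
      fix t
      have "cis (2 * pi * ((x + t) \<bullet> \<omega>)) * cis (- 2 * pi * ((x + t) \<bullet> s)) =
        cis (2 * pi * (x \<bullet> \<omega>)) * cis (2 * pi * (s \<bullet> (- x))) * cis (- 2 * pi * (t \<bullet> (s - \<omega>)))"
        by (simp add: cis_mult inner_add_left inner_diff_right inner_commute[of s x] algebra_simps)
      then show "g (x + t - x) * cis (2 * pi * ((x + t) \<bullet> \<omega>)) * cis (- 2 * pi * ((x + t) \<bullet> s)) =
        cis (2 * pi * (x \<bullet> \<omega>)) * cis (2 * pi * (s \<bullet> (- x))) * (g t * cis (- 2 * pi * (t \<bullet> (s - \<omega>))))"
        by (simp add: mult.assoc mult.left_commute)
    qed
    also have "\<dots> = cis (2 * pi * (x \<bullet> \<omega>)) * cis (2 * pi * (s \<bullet> (- x))) * fourier g (s - \<omega>)"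
      by (simp only: integral_mult_right_zero fourier_def)
    finally show ?thesis by (simp only: ac_simps)
  qed
  have "window_coeff g (fourier h) z = (LINT t|lborel. fourier h t * ?k t)"
    by (simp add: z window_coeff_altdef mult.assoc)
  also have "\<dots> = (LINT s|lborel. h s * fourier ?k s)" by (rule fourier_multiplication_formula[OF hi ki])
  also have "\<dots> = (LINT s|lborel. cis (2 * pi * (x \<bullet> \<omega>)) * (h s * fourier g (s - \<omega>) * cis (2 * pi * (s \<bullet> (- x)))))"
    unfolding fk by (simp only: ac_simps)
  also have "\<dots> = cis (2 * pi * (x \<bullet> \<omega>)) * window_coeff (fourier g) h (\<omega>, - x)"
    by (simp only: integral_mult_right_zero window_coeff_altdef)
  finally show ?thesis by (simp add: z quarter_turn_def)
qed

lemma M2D: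
  assumes "T \<in> M2 g m"
  shows "T \<in> tempered" "integrable lborel (\<lambda>z. (norm (of_real (m z) * stft g T z))\<^sup>2)"
  using assms by (auto simp: M2_def)

text \<open>Here \<open>stft_pairing\<close> exhibits \<open>T\<close> as a superposition of windowed coefficients with data \<open>stft g T\<close>.\<close>

lemma represents_space_density:
  fixes m :: "'a::euclidean_space \<times> 'a \<Rightarrow> real" and \<psi> :: "'a \<Rightarrow> complex"
  assumes g: "g \<in> schwartz" "g \<noteq> (\<lambda>_. 0)" and m: "m \<in> weights_P"
    and \<psi>: "\<And>x \<omega>. norm (\<psi> x) \<le> m (x, \<omega>)" "\<psi> \<noteq> (\<lambda>_. 0)" "continuous_on UNIV \<psi>"
    and T: "T \<in> M2 g m"
  shows "\<exists>u. represents u T \<and> integrable lborel (\<lambda>x. (norm (\<psi> x * u x))\<^sup>2)"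
proof -
  obtain K n where K: "K > 0" "\<And>z y. m (z + y) \<le> K * m z * (1 + norm y) ^ n" using weights_PD(3)[OF m] by blast
  note T' = M2D[OF T]
  define N where "N = (LINT x|lborel. (norm (g x))\<^sup>2)"
  have N: "N > 0" unfolding N_def by (rule schwartz_norm_pos[OF g])
  let ?F = "\<lambda>z. of_real (1 / N) * stft g T z"
  show ?thesis
  proof (rule weighted_representation[OF g(1) weights_PD(1,2)[OF m] K \<psi>])
    show "continuous_on UNIV ?F" by (intro continuous_intros stft_continuous T' g)
    have "(m z * norm (?F z))\<^sup>2 = (1 / N)\<^sup>2 * (norm (of_real (m z) * stft g T z))\<^sup>2" for z
      by (simp add: norm_mult power_mult_distrib norm_divide power_divide)
    then show "integrable lborel (\<lambda>z. (m z * norm (?F z))\<^sup>2)" using T'(2) by simp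
    fix h :: "'a \<Rightarrow> complex" assume h: "h \<in> schwartz"
    have e: "window_coeff g h z * ?F z = of_real (1 / N) * (window_coeff g h z * stft g T z)" for z by (simp only: ac_simps)
    show "integrable lborel (\<lambda>z. window_coeff g h z * ?F z)"
      unfolding e by (intro integrable_mult_right stft_pairing T' g h)
    show "T h = (LINT z|lborel. window_coeff g h z * ?F z)"
      unfolding e integral_mult_right_zero stft_pairing(2)[OF T'(1) g(1) h] using N by (simp add: N_def[symmetric])
  qed
qed

text \<open>The identity \<open>stft_pairing\<close> for \<open>fourier h\<close>, rewritten by \<open>window_coeff_fourier\<close>, has the same shape
after a quarter turn: the window is \<open>fourier g\<close>, and the first variable of the data is the frequency.\<close>

lemma represents_frequency_density:
  fixes m :: "'a::euclidean_space \<times> 'a \<Rightarrow> real" and \<phi> :: "'a \<Rightarrow> complex"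
  assumes g: "g \<in> schwartz" "g \<noteq> (\<lambda>_. 0)" and m: "m \<in> weights_P"
    and \<phi>: "\<And>x \<omega>. norm (\<phi> \<omega>) \<le> m (x, \<omega>)" "\<phi> \<noteq> (\<lambda>_. 0)" "continuous_on UNIV \<phi>"
    and T: "T \<in> M2 g m"
  shows "\<exists>u. represents u (dist_fourier T) \<and> integrable lborel (\<lambda>x. (norm (\<phi> x * u x))\<^sup>2)"
proof -
  obtain K n where K: "K > 0" "\<And>z y. m (z + y) \<le> K * m z * (1 + norm y) ^ n" using weights_PD(3)[OF m] by blast
  \<comment> \<open>the weight seen from the frequency side: \<open>?m \<circ> quarter_turn = m\<close>\<close>
  let ?m = "\<lambda>z. m (- snd z, fst z)"
  have m': "continuous_on UNIV ?m"
    by (intro continuous_on_compose2[OF weights_PD(1)[OF m]] continuous_intros) auto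
  have K': "?m (z + y) \<le> K * ?m z * (1 + norm y) ^ n" for z y
    using K(2)[of "(- snd z, fst z)" "(- snd y, fst y)"] by (simp add: norm_prod_def add.commute)
  note T' = M2D[OF T]
  define N where "N = (LINT x|lborel. (norm (g x))\<^sup>2)"
  have N: "N > 0" unfolding N_def by (rule schwartz_norm_pos[OF g])
  let ?F = "\<lambda>z. of_real (1 / N) * (cis (- 2 * pi * (snd z \<bullet> fst z)) * stft g T (- snd z, fst z))"
  have Fc: "continuous_on UNIV ?F"
    by (intro continuous_intros continuous_on_compose2[OF stft_continuous[OF T'(1) g(1)]]) auto
  note [measurable] = borel_measurable_continuous_onI[OF Fc] borel_measurable_continuous_onI[OF m']
  have Fq: "?F (quarter_turn z) = of_real (1 / N) * (cis (2 * pi * (fst z \<bullet> snd z)) * stft g T z)" for z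
    by (simp add: quarter_turn_def)
  note g' = fourier_schwartz[OF g(1)]
  show ?thesis
  proof (rule weighted_representation[OF g' m' weights_PD(2)[OF m] K(1) K' _ \<phi>(2,3) Fc])
    have "(?m (quarter_turn z) * norm (?F (quarter_turn z)))\<^sup>2 = (1 / N)\<^sup>2 * (norm (of_real (m z) * stft g T z))\<^sup>2" for z
      unfolding Fq by (simp add: quarter_turn_def norm_mult power_mult_distrib norm_divide power_divide)
    then have "integrable lborel (\<lambda>z. (?m (quarter_turn z) * norm (?F (quarter_turn z)))\<^sup>2)" using T'(2) by simp
    then show "integrable lborel (\<lambda>z. (?m z * norm (?F z))\<^sup>2)"
      by (subst (asm) integral_quarter_turn(2)) measurable
    fix h :: "'a \<Rightarrow> complex" assume h: "h \<in> schwartz"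
    note h' = fourier_schwartz[OF h]
    have cm[measurable]: "window_coeff (fourier g) h \<in> borel_measurable borel"
      by (rule window_coeff_measurable[OF schwartz_measurable[OF g'] schwartz_measurable[OF h]])
    have e: "window_coeff (fourier g) h (quarter_turn z) * ?F (quarter_turn z) = of_real (1 / N) * (window_coeff g (fourier h) z * stft g T z)" for z
      unfolding Fq window_coeff_fourier[OF g(1) h] by (simp only: ac_simps)
    have pm: "(\<lambda>z. window_coeff (fourier g) h z * ?F z) \<in> borel_measurable borel" by measurable
    have "integrable lborel (\<lambda>z. window_coeff (fourier g) h (quarter_turn z) * ?F (quarter_turn z))"
      unfolding e by (intro integrable_mult_right stft_pairing T' g h')
    then show "integrable lborel (\<lambda>z. window_coeff (fourier g) h z * ?F z)"
      unfolding integral_quarter_turn(2)[OF pm] .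
    have "(LINT z|lborel. window_coeff (fourier g) h z * ?F z) = (LINT z|lborel. window_coeff (fourier g) h (quarter_turn z) * ?F (quarter_turn z))"
      by (rule integral_quarter_turn(1)[OF pm, symmetric])
    also have "\<dots> = T (fourier h)"
      unfolding e integral_mult_right_zero stft_pairing(2)[OF T'(1) g(1) h'] using N by (simp add: N_def[symmetric])
    finally show "dist_fourier T h = (LINT z|lborel. window_coeff (fourier g) h z * ?F z)"
      using h by (simp add: dist_fourier_def)
  qed (simp add: \<phi>(1))
qed

section \<open>Positive Hermitian forms and the Rayleigh quotient\<close>

definition pos_form :: "('b \<Rightarrow> complex) set \<Rightarrow> (('b \<Rightarrow> complex) \<Rightarrow> ('b \<Rightarrow> complex) \<Rightarrow> complex) \<Rightarrow> bool" where
  "pos_form V B \<longleftrightarrow>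
     (\<forall>u\<in>V. \<forall>v\<in>V. \<forall>w\<in>V. B (\<lambda>h. u h + v h) w = B u w + B v w) \<and>
     (\<forall>u\<in>V. \<forall>v\<in>V. \<forall>c. B (\<lambda>h. c * u h) v = c * B u v) \<and>
     (\<forall>u\<in>V. \<forall>v\<in>V. B v u = cnj (B u v)) \<and>
     (\<forall>u\<in>V. 0 \<le> Re (B u u))"

lemma pos_formD:
  assumes "pos_form V B"
  shows "u \<in> V \<Longrightarrow> v \<in> V \<Longrightarrow> w \<in> V \<Longrightarrow> B (\<lambda>h. u h + v h) w = B u w + B v w"
    and "u \<in> V \<Longrightarrow> v \<in> V \<Longrightarrow> B (\<lambda>h. c * u h) v = c * B u v"
    and "u \<in> V \<Longrightarrow> v \<in> V \<Longrightarrow> B v u = cnj (B u v)"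
    and "u \<in> V \<Longrightarrow> 0 \<le> Re (B u u)"
  using assms unfolding pos_form_def by blast+

lemma pos_form_add:
  assumes B: "pos_form V B" and F: "pos_form V F"
  shows "pos_form V (\<lambda>u v. B u v + F u v)"
  unfolding pos_form_def
proof (intro conjI ballI allI)
  fix u v w c assume u: "u \<in> V" and v: "v \<in> V"
  show "B (\<lambda>h. c * u h) v + F (\<lambda>h. c * u h) v = c * (B u v + F u v)"
    by (simp only: pos_formD(2)[OF B u v] pos_formD(2)[OF F u v] distrib_left)
  show "B v u + F v u = cnj (B u v + F u v)"
    unfolding pos_formD(3)[OF B u v] pos_formD(3)[OF F u v] by simp
  assume w: "w \<in> V"
  show "B (\<lambda>h. u h + v h) w + F (\<lambda>h. u h + v h) w = (B u w + F u w) + (B v w + F v w)"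
    by (simp only: pos_formD(1)[OF B u v w] pos_formD(1)[OF F u v w] add_ac)
next
  fix u assume "u \<in> V"
  then show "0 \<le> Re (B u u + F u u)" using pos_formD(4)[OF B] pos_formD(4)[OF F] by simp
qed

text \<open>Distributions are functions on test functions, without a vector space type class; linear operations are pointwise.\<close>

definition function_subspace :: "('b \<Rightarrow> complex) set \<Rightarrow> bool" where
  "function_subspace V \<longleftrightarrow> (\<forall>u\<in>V. \<forall>v\<in>V. (\<lambda>h. u h + v h) \<in> V) \<and> (\<forall>u\<in>V. \<forall>c. (\<lambda>h. c * u h) \<in> V)"

lemma function_subspaceD:
  assumes "function_subspace V"
  shows "u \<in> V \<Longrightarrow> v \<in> V \<Longrightarrow> (\<lambda>h. u h + v h) \<in> V" "u \<in> V \<Longrightarrow> (\<lambda>h. c * u h) \<in> V"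
  using assms by (auto simp: function_subspace_def)

lemma pos_form_diag_real: "pos_form V B \<Longrightarrow> u \<in> V \<Longrightarrow> B u u = of_real (Re (B u u))"
  using pos_formD(3)[of V B u u] by (metis complex_cnj_cancel_iff Reals_cnj_iff of_real_Re)

lemma pos_form_scale_diag:
  assumes B: "pos_form V B" and V: "function_subspace V" and u: "u \<in> V"
  shows "B (\<lambda>h. c * u h) (\<lambda>h. c * u h) = of_real ((norm c)\<^sup>2) * B u u"
proof -
  note cu = function_subspaceD(2)[OF V u, of c]
  have "B (\<lambda>h. c * u h) (\<lambda>h. c * u h) = c * B u (\<lambda>h. c * u h)" by (rule pos_formD(2)[OF B u cu])
  also have "B u (\<lambda>h. c * u h) = cnj (B (\<lambda>h. c * u h) u)" by (rule pos_formD(3)[OF B cu u])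
  also have "\<dots> = cnj c * cnj (B u u)" by (simp add: pos_formD(2)[OF B u u])
  also have "cnj (B u u) = B u u" by (rule pos_formD(3)[OF B u u, symmetric])
  finally show ?thesis by (simp add: complex_norm_square mult.assoc del: of_real_power)
qed

text \<open>The value of the form on \<open>c f + v\<close> is real-affine in \<open>c\<close>, so it would become negative for a suitable \<open>c\<close>
if \<open>B f v\<close> were nonzero.\<close>

lemma pos_form_isotropic:
  assumes B: "pos_form V B" and V: "function_subspace V" and f: "f \<in> V" "Re (B f f) = 0" and v: "v \<in> V"
  shows "B f v = 0"
proof (rule ccontr)
  assume z: "B f v \<noteq> 0"
  \<comment> \<open>chosen so that the form takes the value \<open>- 1\<close> at \<open>c f + v\<close>\<close>
  define r where "r = (Re (B v v) + 1) / (2 * (norm (B f v))\<^sup>2)"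
  define c where "c = - of_real r * cnj (B f v)"
  let ?cf = "\<lambda>h. c * f h" and ?u = "\<lambda>h. c * f h + v h"
  note cf = function_subspaceD(2)[OF V f(1), of c]
  note u = function_subspaceD(1)[OF V cf v]
  have "B f f = 0" using pos_form_diag_real[OF B f(1)] f(2) by simp
  have 1: "B ?cf ?u = cnj (B ?u ?cf)" by (rule pos_formD(3)[OF B u cf])
  have 2: "B ?u ?cf = B ?cf ?cf + B v ?cf" by (rule pos_formD(1)[OF B cf v cf])
  have 3: "B ?cf ?cf = 0" using pos_form_scale_diag[OF B V f(1)] \<open>B f f = 0\<close> by simp
  have 4: "B v ?cf = cnj (B ?cf v)" by (rule pos_formD(3)[OF B cf v])
  have 5: "B ?cf v = c * B f v" by (rule pos_formD(2)[OF B f(1) v])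
  have 6: "B v ?u = cnj (B ?u v)" by (rule pos_formD(3)[OF B u v])
  have 7: "B ?u v = B ?cf v + B v v" by (rule pos_formD(1)[OF B cf v v])
  have "B ?u ?u = B ?cf ?u + B v ?u" by (rule pos_formD(1)[OF B cf v u])
  then have "B ?u ?u = c * B f v + cnj (c * B f v) + cnj (B v v)"
    by (simp only: 1 2 3 4 5 6 7 complex_cnj_cnj complex_cnj_add add_0 add.assoc)
  then have "Re (B ?u ?u) = 2 * Re (c * B f v) + Re (B v v)" by simp
  also have "c * B f v = - of_real (r * (norm (B f v))\<^sup>2)"
    by (simp add: c_def complex_norm_square mult.assoc mult.commute[of "cnj _"] del: of_real_power)
  also have "r * (norm (B f v))\<^sup>2 = (Re (B v v) + 1) / 2" using z by (simp add: r_def)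
  finally have "Re (B ?u ?u) = - 1" by (simp add: field_simps)
  then show False using pos_formD(4)[OF B u] by simp
qed

text \<open>Minimality extends by scaling to \<open>\<lambda> B v v \<le> F v v\<close> on the whole space, so \<open>F - \<lambda> B\<close> is positive
with the isotropic vector \<open>f0\<close>. The Hermitian form \<open>B + F\<close> then vanishes identically on \<open>f0 - (\<lambda> + 1) A f0\<close>.\<close>

theorem rayleigh_minimizer:
  fixes V :: "'a::euclidean_space distribution set"
  assumes V: "function_subspace V" and B: "pos_form V B" and F: "pos_form V F"
    and def: "\<And>u. u \<in> V \<Longrightarrow> Re (B u u) = 0 \<Longrightarrow> u = (\<lambda>_. 0)"
    and AV: "\<And>u. u \<in> V \<Longrightarrow> A u \<in> V"
    and A: "\<And>u v. u \<in> V \<Longrightarrow> v \<in> V \<Longrightarrow> B u v = B (A u) v + F (A u) v"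
    and f0: "f0 \<in> V" "Re (B f0 f0) = 1"
    and min: "\<And>v. v \<in> V \<Longrightarrow> Re (B v v) = 1 \<Longrightarrow> Re (F f0 f0) \<le> Re (F v v)"
  defines "lam \<equiv> Re (F f0 f0)"
  shows "A f0 = (\<lambda>h. of_real (1 / (lam + 1)) * f0 h) \<and> largest_eigenvalue_on V A (1 / (lam + 1))"
proof -
  have lam0: "lam \<ge> 0" unfolding lam_def by (rule pos_formD(4)[OF F f0(1)])
  have zero: "H (\<lambda>_. 0) (\<lambda>_. 0) = 0" if "pos_form V H" for H
    using pos_form_scale_diag[OF that V f0(1), of 0] by simp
  have Bpos: "Re (B u u) > 0" if "u \<in> V" "u \<noteq> (\<lambda>_. 0)" for u
    using def[OF that(1)] pos_formD(4)[OF B that(1)] that(2) by linarith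
  have ray: "lam * Re (B v v) \<le> Re (F v v)" if v: "v \<in> V" for v
  proof (cases "Re (B v v) = 0")
    case True
    then show ?thesis using pos_formD(4)[OF F v] by simp
  next
    case False
    then have b: "Re (B v v) > 0" using pos_formD(4)[OF B v] by linarith
    define c where "c = complex_of_real (1 / sqrt (Re (B v v)))"
    have c2: "(norm c)\<^sup>2 = 1 / Re (B v v)" using b by (simp add: c_def norm_divide power_divide)
    note cv = function_subspaceD(2)[OF V v, of c]
    have "Re (B (\<lambda>h. c * v h) (\<lambda>h. c * v h)) = 1" using b by (simp add: pos_form_scale_diag[OF B V v] c2)
    from min[OF cv this] have "lam \<le> Re (F v v) / Re (B v v)"
      by (simp add: pos_form_scale_diag[OF F V v] c2 lam_def)
    then show ?thesis using b by (simp add: pos_le_divide_eq)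
  qed
  define G where "G u v = F u v + of_real (- lam) * B u v" for u v
  have G: "pos_form V G"
    unfolding pos_form_def
  proof (intro conjI ballI allI)
    fix u v w c assume u: "u \<in> V" and v: "v \<in> V"
    show "G (\<lambda>h. c * u h) v = c * G u v"
      unfolding G_def pos_formD(2)[OF F u v] pos_formD(2)[OF B u v] by (simp add: algebra_simps)
    show "G v u = cnj (G u v)"
      unfolding G_def pos_formD(3)[OF F u v] pos_formD(3)[OF B u v] by simp
    assume w: "w \<in> V"
    show "G (\<lambda>h. u h + v h) w = G u w + G v w"
      unfolding G_def pos_formD(1)[OF F u v w] pos_formD(1)[OF B u v w] by (simp add: algebra_simps)
  next
    fix u assume "u \<in> V"
    then show "0 \<le> Re (G u u)" using ray[of u] by (simp add: G_def)
  qed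
  have "Re (G f0 f0) = 0" using f0(2) by (simp add: G_def lam_def)
  then have G0: "G f0 v = 0" if "v \<in> V" for v
    by (rule pos_form_isotropic[OF G V f0(1) _ that])
  let ?l = "complex_of_real (lam + 1)"
  have l0: "?l \<noteq> 0" using lam0 by (metis add_nonneg_eq_0_iff of_real_eq_0_iff zero_le_one zero_neq_one)
  have Q: "pos_form V (\<lambda>u v. B u v + F u v)" by (rule pos_form_add[OF B F])
  let ?w = "\<lambda>h. f0 h + (- ?l) * A f0 h"
  note Af = AV[OF f0(1)]
  note lAf = function_subspaceD(2)[OF V Af, of "- ?l"]
  note w = function_subspaceD(1)[OF V f0(1) lAf]
  \<comment> \<open>\<open>?w\<close> is \<open>f0 - (lam + 1) A f0\<close>\<close>
  have "B ?w v + F ?w v = 0" if v: "v \<in> V" for v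
  proof -
    have "B ?w v + F ?w v = (B f0 v + F f0 v) + (- ?l) * (B (A f0) v + F (A f0) v)"
      using pos_formD(1)[OF Q f0(1) lAf v] pos_formD(2)[OF Q Af v, of "- ?l"] by simp
    also have "\<dots> = G f0 v" unfolding A[OF f0(1) v, symmetric] by (simp add: G_def algebra_simps)
    finally show ?thesis using G0[OF v] by simp
  qed
  then have "B ?w ?w + F ?w ?w = 0" using w by blast
  then have "Re (B ?w ?w) + Re (F ?w ?w) = 0" by (metis plus_complex.simps(1) zero_complex.simps(1))
  then have "Re (B ?w ?w) = 0" using pos_formD(4)[OF B w] pos_formD(4)[OF F w] by linarith
  then have "?w = (\<lambda>_. 0)" by (rule def[OF w])
  from fun_cong[OF this] have "f0 h - ?l * A f0 h = 0" for h
    by (simp only: mult_minus_left diff_conv_add_uminus)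
  then have "f0 h = ?l * A f0 h" for h by (simp only: right_minus_eq)
  then have eig: "A f0 = (\<lambda>h. of_real (1 / (lam + 1)) * f0 h)"
    using l0 by (auto simp: fun_eq_iff simp del: of_real_add)
  have "f0 \<noteq> (\<lambda>_. 0)" using f0(2) zero[OF B] by auto
  then have mem: "of_real (1 / (lam + 1)) \<in> eigenvalues_on V A"
    unfolding eigenvalues_on_def using f0(1) eig by blast
  have "\<mu> \<in> \<real> \<and> Re \<mu> \<le> 1 / (lam + 1)" if "\<mu> \<in> eigenvalues_on V A" for \<mu>
  proof -
    obtain u where u: "u \<in> V" "u \<noteq> (\<lambda>_. 0)" "A u = (\<lambda>h. \<mu> * u h)" using \<open>\<mu> \<in> eigenvalues_on V A\<close> unfolding eigenvalues_on_def by blast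
    let ?b = "Re (B u u)" and ?f = "Re (F u u)"
    have b: "?b > 0" by (rule Bpos[OF u(1,2)])
    have q: "?b + ?f > 0" using b pos_formD(4)[OF F u(1)] by linarith
    have "B u u = \<mu> * (B u u + F u u)"
      using A[OF u(1,1)] pos_formD(2)[OF Q u(1,1), of \<mu>] by (simp add: u(3))
    then have "complex_of_real ?b = \<mu> * of_real (?b + ?f)"
      using pos_form_diag_real[OF B u(1)] pos_form_diag_real[OF F u(1)] by (metis of_real_add)
    then have \<mu>: "\<mu> = of_real (?b / (?b + ?f))" using q by (simp add: field_simps del: of_real_add)
    have "?b / (?b + ?f) \<le> 1 / (lam + 1)"
    proof -
      have "?b * (lam + 1) \<le> ?b + ?f" using ray[OF u(1)] by (simp add: algebra_simps)
      then have "?b \<le> 1 / (lam + 1) * (?b + ?f)" using lam0 by (simp add: pos_le_divide_eq)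
      then show ?thesis using q by (simp only: pos_divide_le_eq)
    qed
    then show ?thesis unfolding \<mu> by simp
  qed
  then show ?thesis using eig mem unfolding largest_eigenvalue_on_def by blast
qed

section \<open>The forms of the modulation space\<close>

text \<open>Each of the three terms of the mixed inner product is of this kind, for the maps \<open>J\<close> sending a distribution to
\<open>m0\<close> times its short-time Fourier transform, to \<open>\<psi>\<close> times its density, and to \<open>\<phi>\<close> times the density of its
Fourier transform. Linearity almost everywhere is what densities offer.\<close>

lemma L2_pos_form:
  fixes J :: "('b \<Rightarrow> complex) \<Rightarrow> 'c \<Rightarrow> complex"
  assumes m: "\<And>u. u \<in> V \<Longrightarrow> J u \<in> borel_measurable M"
    and i: "\<And>u. u \<in> V \<Longrightarrow> integrable M (\<lambda>x. (norm (J u x))\<^sup>2)"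
    and add: "\<And>u v. u \<in> V \<Longrightarrow> v \<in> V \<Longrightarrow> AE x in M. J (\<lambda>h. u h + v h) x = J u x + J v x"
    and scale: "\<And>u c. u \<in> V \<Longrightarrow> AE x in M. J (\<lambda>h. c * u h) x = c * J u x"
    and V: "function_subspace V"
  shows "pos_form V (\<lambda>u v. LINT x|M. J u x * cnj (J v x))"
    and "u \<in> V \<Longrightarrow> Re (LINT x|M. J u x * cnj (J u x)) = (LINT x|M. (norm (J u x))\<^sup>2)"
proof -
  have cm[measurable]: "(\<lambda>x. cnj (J v x)) \<in> borel_measurable M" if "v \<in> V" for v
    by (rule measurable_compose[OF m[OF that] cnj_measurable])
  have I: "integrable M (\<lambda>x. J u x * cnj (J v x))" if "u \<in> V" "v \<in> V" for u v
    by (rule integrable_mult_L2) (use that m i cm in auto)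
  have diag: "(LINT x|M. J u x * cnj (J u x)) = of_real (LINT x|M. (norm (J u x))\<^sup>2)" for u
    by (simp only: complex_norm_square[symmetric] integral_complex_of_real)
  show "Re (LINT x|M. J u x * cnj (J u x)) = (LINT x|M. (norm (J u x))\<^sup>2)" by (simp only: diag Re_complex_of_real)
  show "pos_form V (\<lambda>u v. LINT x|M. J u x * cnj (J v x))"
    unfolding pos_form_def
  proof (intro conjI ballI allI)
    fix u v c assume u: "u \<in> V" and v: "v \<in> V"
    have "(LINT x|M. J (\<lambda>h. c * u h) x * cnj (J v x)) = (LINT x|M. c * (J u x * cnj (J v x)))"
      using scale[OF u, of c] m[OF function_subspaceD(2)[OF V u]] m[OF u] cm[OF v]
      by (intro integral_cong_AE) (auto simp: mult.assoc)
    then show "(LINT x|M. J (\<lambda>h. c * u h) x * cnj (J v x)) = c * (LINT x|M. J u x * cnj (J v x))" by simp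
    show "(LINT x|M. J v x * cnj (J u x)) = cnj (LINT x|M. J u x * cnj (J v x))"
      by (simp add: mult.commute flip: Bochner_Integration.integral_cnj)
    fix w assume w: "w \<in> V"
    have "(LINT x|M. J (\<lambda>h. u h + v h) x * cnj (J w x)) = (LINT x|M. J u x * cnj (J w x) + J v x * cnj (J w x))"
      using add[OF u v] m[OF function_subspaceD(1)[OF V u v]] m[OF u] m[OF v] cm[OF w]
      by (intro integral_cong_AE) (auto simp: distrib_right)
    also have "\<dots> = (LINT x|M. J u x * cnj (J w x)) + (LINT x|M. J v x * cnj (J w x))"
      by (rule Bochner_Integration.integral_add[OF I[OF u w] I[OF v w]])
    finally show "(LINT x|M. J (\<lambda>h. u h + v h) x * cnj (J w x)) = (LINT x|M. J u x * cnj (J w x)) + (LINT x|M. J v x * cnj (J w x))" .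
  next
    fix u show "0 \<le> Re (LINT x|M. J u x * cnj (J u x))"
      unfolding diag Re_complex_of_real by (intro integral_nonneg_AE) simp
  qed
qed

lemma represents_add:
  assumes "represents u S" "represents v T"
  shows "represents (\<lambda>x. u x + v x) (\<lambda>h. S h + T h)"
  using assms unfolding represents_def
  by (auto simp: distrib_right intro!: Bochner_Integration.integral_add[symmetric])

lemma represents_scale:
  assumes "represents u S" shows "represents (\<lambda>x. c * u x) (\<lambda>h. c * S h)"
  using assms unfolding represents_def by (auto simp: mult.assoc)

lemma density_of_represents: "represents u T \<Longrightarrow> represents (density_of T) T"
  unfolding density_of_def using someI_ex[of "\<lambda>u. represents u T"] by auto

lemma density_of_AE:
  fixes u g :: "'a::euclidean_space \<Rightarrow> complex"
  assumes "represents u T" "g \<in> schwartz" "g \<noteq> (\<lambda>_. 0)"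
  shows "AE x in lborel. density_of T x = u x"
  by (rule represents_unique[OF density_of_represents[OF assms(1)] assms(1,2,3)])

text \<open>The case distinction on \<open>\<psi>\<close> is essential: if \<open>\<psi>\<close> vanishes, a density need not exist, but the form is 0.\<close>

lemma density_pos_form:
  fixes V :: "'a::euclidean_space distribution set" and g \<psi> :: "'a \<Rightarrow> complex"
    and D :: "'a distribution \<Rightarrow> 'a distribution"
  assumes g: "g \<in> schwartz" "g \<noteq> (\<lambda>_. 0)" and V: "function_subspace V"
    and \<psi>: "continuous_on UNIV \<psi>"
    and rep: "\<And>T. \<psi> \<noteq> (\<lambda>_. 0) \<Longrightarrow> T \<in> V \<Longrightarrow> \<exists>u. represents u (D T) \<and> integrable lborel (\<lambda>x. (norm (\<psi> x * u x))\<^sup>2)"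
    and D_add: "\<And>S T. S \<in> V \<Longrightarrow> T \<in> V \<Longrightarrow> D (\<lambda>h. S h + T h) = (\<lambda>h. D S h + D T h)"
    and D_scale: "\<And>T c. T \<in> V \<Longrightarrow> D (\<lambda>h. c * T h) = (\<lambda>h. c * D T h)"
  shows "pos_form V (\<lambda>S T. LINT x|lborel. (\<psi> x * density_of (D S) x) * cnj (\<psi> x * density_of (D T) x))"
    and "T \<in> V \<Longrightarrow> Re (LINT x|lborel. (\<psi> x * density_of (D T) x) * cnj (\<psi> x * density_of (D T) x)) = (LINT x|lborel. (norm (\<psi> x * density_of (D T) x))\<^sup>2)"
proof -
  note \<psi>m[measurable] = borel_measurable_continuous_onI[OF \<psi>]
  let ?J = "\<lambda>T x. \<psi> x * density_of (D T) x"
  have dens: "represents (density_of (D T)) (D T)" "integrable lborel (\<lambda>x. (norm (?J T x))\<^sup>2)"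
    if nz: "\<psi> \<noteq> (\<lambda>_. 0)" and T: "T \<in> V" for T
  proof -
    obtain u where u: "represents u (D T)" "integrable lborel (\<lambda>x. (norm (\<psi> x * u x))\<^sup>2)" using rep[OF nz T] by blast
    show r: "represents (density_of (D T)) (D T)" by (rule density_of_represents[OF u(1)])
    then have [measurable]: "density_of (D T) \<in> borel_measurable borel" "u \<in> borel_measurable borel" using u(1) by (auto simp: represents_def)
    have "AE x in lborel. (norm (\<psi> x * u x))\<^sup>2 = (norm (?J T x))\<^sup>2"
      using density_of_AE[OF u(1) g] by eventually_elim simp
    with u(2) show "integrable lborel (\<lambda>x. (norm (?J T x))\<^sup>2)"
      by (subst (asm) integrable_cong_AE[of _ _ "\<lambda>x. (norm (?J T x))\<^sup>2"]) auto
  qed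
  have m: "?J T \<in> borel_measurable lborel" if T: "T \<in> V" for T
  proof (cases "\<psi> = (\<lambda>_. 0)")
    case False
    then have [measurable]: "density_of (D T) \<in> borel_measurable borel" using dens(1)[OF _ T] by (auto simp: represents_def)
    show ?thesis by measurable
  qed simp
  have i: "integrable lborel (\<lambda>x. (norm (?J T x))\<^sup>2)" if "T \<in> V" for T
    by (cases "\<psi> = (\<lambda>_. 0)") (use dens(2)[OF _ that] in auto)
  have add: "AE x in lborel. ?J (\<lambda>h. S h + T h) x = ?J S x + ?J T x" if S: "S \<in> V" and T: "T \<in> V" for S T
  proof (cases "\<psi> = (\<lambda>_. 0)")
    case False
    from density_of_AE[OF represents_add[OF dens(1)[OF False S] dens(1)[OF False T]] g]
    show ?thesis unfolding D_add[OF S T] by eventually_elim (simp add: distrib_left)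
  qed simp
  have scale: "AE x in lborel. ?J (\<lambda>h. c * T h) x = c * ?J T x" if T: "T \<in> V" for T c
  proof (cases "\<psi> = (\<lambda>_. 0)")
    case False
    from density_of_AE[OF represents_scale[OF dens(1)[OF False T], of c] g]
    show ?thesis unfolding D_scale[OF T] by eventually_elim simp
  qed simp
  show "pos_form V (\<lambda>S T. LINT x|lborel. ?J S x * cnj (?J T x))"
    by (rule L2_pos_form(1)[OF m i add scale V])
  show "T \<in> V \<Longrightarrow> Re (LINT x|lborel. ?J T x * cnj (?J T x)) = (LINT x|lborel. (norm (?J T x))\<^sup>2)"
    by (rule L2_pos_form(2)[OF m i add scale V])
qed

lemma schwartz_seminorm_summand:
  assumes f: "f \<in> schwartz" and bs: "bs \<in> multi_indices M"
  shows "bdd_above (range (\<lambda>x. (1 + norm x) ^ N * norm (iter_partial bs f x)))"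
    and "0 \<le> (SUP x. (1 + norm x) ^ N * norm (iter_partial bs f x))"
proof -
  have "rapid (iter_partial bs f)" using bs by (intro schwartz_rapid schwartz_iter_partial f) auto
  then obtain C where "\<And>x. (1 + norm x) ^ N * norm (iter_partial bs f x) \<le> C" unfolding rapid_def by blast
  then show bdd: "bdd_above (range (\<lambda>x. (1 + norm x) ^ N * norm (iter_partial bs f x)))" by (intro bdd_aboveI2)
  show "0 \<le> (SUP x. (1 + norm x) ^ N * norm (iter_partial bs f x))"
    by (rule cSUP_upper2[OF bdd, of 0]) auto
qed

lemma schwartz_seminorm_nonneg: "f \<in> schwartz \<Longrightarrow> 0 \<le> schwartz_seminorm N f"
  unfolding schwartz_seminorm_def by (intro sum_nonneg schwartz_seminorm_summand(2))

text \<open>Needed to bound a sum of two tempered distributions by a single seminorm.\<close>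

lemma schwartz_seminorm_mono:
  assumes f: "f \<in> schwartz" and "N \<le> N'"
  shows "schwartz_seminorm N f \<le> schwartz_seminorm N' f"
proof -
  let ?s = "\<lambda>N bs x. (1 + norm x) ^ N * norm (iter_partial bs f x)"
  have "schwartz_seminorm N f \<le> (\<Sum>bs\<in>multi_indices N. SUP x. ?s N' bs x)"
    unfolding schwartz_seminorm_def
  proof (rule sum_mono, rule cSUP_mono)
    fix bs :: "'a list" assume bs: "bs \<in> multi_indices N"
    then show "bdd_above (range (?s N' bs))" by (rule schwartz_seminorm_summand(1)[OF f])
    show "\<exists>y\<in>UNIV. ?s N bs x \<le> ?s N' bs y" for x
      using assms(2) by (intro bexI[of _ x] mult_right_mono power_increasing) auto
  qed auto
  also have "\<dots> \<le> schwartz_seminorm N' f"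
    unfolding schwartz_seminorm_def using assms(2)
    by (intro sum_mono2 finite_multi_indices schwartz_seminorm_summand(2)[OF f, of _ N']) auto
  finally show ?thesis .
qed

lemma tempered_subspace: "function_subspace (tempered :: 'a::euclidean_space distribution set)"
  unfolding function_subspace_def
proof (intro conjI ballI allI)
  fix S T :: "'a distribution" assume S: "S \<in> tempered" and T: "T \<in> tempered"
  obtain C1 N1 where 1: "\<And>f. f \<in> schwartz \<Longrightarrow> norm (S f) \<le> C1 * schwartz_seminorm N1 f"
    using S unfolding tempered_def by blast
  obtain C2 N2 where 2: "\<And>f. f \<in> schwartz \<Longrightarrow> norm (T f) \<le> C2 * schwartz_seminorm N2 f"
    using T unfolding tempered_def by blast
  have "norm (S f + T f) \<le> (\<bar>C1\<bar> + \<bar>C2\<bar>) * schwartz_seminorm (N1 + N2) f" if f: "f \<in> schwartz" for f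
  proof -
    have b: "C * schwartz_seminorm N f \<le> \<bar>C\<bar> * schwartz_seminorm (N1 + N2) f" if "N \<le> N1 + N2" for C N
      using schwartz_seminorm_nonneg[OF f] schwartz_seminorm_mono[OF f that] by (intro mult_mono) auto
    have "norm (S f + T f) \<le> norm (S f) + norm (T f)" by (rule norm_triangle_ineq)
    also have "\<dots> \<le> \<bar>C1\<bar> * schwartz_seminorm (N1 + N2) f + \<bar>C2\<bar> * schwartz_seminorm (N1 + N2) f"
      using 1[OF f] 2[OF f] b[of N1 C1] b[of N2 C2] by linarith
    finally show ?thesis by (simp add: distrib_right)
  qed
  then show "(\<lambda>h. S h + T h) \<in> tempered"
    using S T unfolding tempered_def mem_Collect_eq
    by (intro conjI exI[of _ "\<bar>C1\<bar> + \<bar>C2\<bar>"] exI[of _ "N1 + N2"]) (auto simp: distrib_left)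
  fix c
  have "norm (c * S f) \<le> (norm c * C1) * schwartz_seminorm N1 f" if f: "f \<in> schwartz" for f
    using mult_left_mono[OF 1[OF f] norm_ge_zero[of c]] by (simp add: norm_mult mult.assoc)
  then show "(\<lambda>h. c * S h) \<in> tempered"
    using S unfolding tempered_def mem_Collect_eq
    by (intro conjI exI[of _ "norm c * C1"] exI[of _ N1]) (auto simp: distrib_left)
qed

lemma stft_add: "stft g (\<lambda>h. S h + T h) z = stft g S z + stft g T z"
  and stft_scale: "stft g (\<lambda>h. c * T h) z = c * stft g T z"
  by (simp_all add: stft_def case_prod_unfold)

lemma M2_subspace:
  fixes g :: "'a::euclidean_space \<Rightarrow> complex"
  assumes g: "g \<in> schwartz" and m: "m \<in> borel_measurable borel"
  shows "function_subspace (M2 g m)"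
  unfolding function_subspace_def
proof (intro conjI ballI allI)
  note m[measurable]
  fix S :: "'a distribution" assume S: "S \<in> M2 g m"
  note S' = M2D[OF S]
  note [measurable] = stft_measurable[OF S'(1) g]
  {
    fix T :: "'a distribution" assume T: "T \<in> M2 g m"
    note T' = M2D[OF T]
    note [measurable] = stft_measurable[OF T'(1) g]
    have "integrable lborel (\<lambda>z. (norm (of_real (m z) * stft g S z + of_real (m z) * stft g T z))\<^sup>2)"
      by (rule square_integrable_add[OF _ _ S'(2) T'(2)]) measurable
    then show "(\<lambda>h. S h + T h) \<in> M2 g m"
      using function_subspaceD(1)[OF tempered_subspace S'(1) T'(1)] by (simp add: M2_def stft_add distrib_left)
  }
  fix c :: complex
  have "integrable lborel (\<lambda>z. (norm c)\<^sup>2 * (norm (of_real (m z) * stft g S z))\<^sup>2)" using S'(2) by simp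
  moreover have "(norm c)\<^sup>2 * (norm (of_real (m z) * stft g S z))\<^sup>2 = (norm (of_real (m z) * (c * stft g S z)))\<^sup>2" for z
    by (simp add: norm_mult power_mult_distrib)
  ultimately show "(\<lambda>h. c * S h) \<in> M2 g m"
    using function_subspaceD(2)[OF tempered_subspace S'(1)] by (simp add: M2_def stft_scale)
qed

theorem theorem15:
  fixes m0 :: "(real ^ 'd) \<times> (real ^ 'd) \<Rightarrow> real"
    and \<psi> \<phi> g :: "real ^ 'd \<Rightarrow> complex"
    and A :: "(real ^ 'd) distribution \<Rightarrow> (real ^ 'd) distribution"
    and f0 :: "(real ^ 'd) distribution"
  assumes g: "g \<in> schwartz" "g \<noteq> (\<lambda>_. 0)"
    and m0: "m0 \<in> weights_P"
    and adm: "admissible m0 \<psi> \<phi>"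
    and m: "m = assoc_weight \<psi> \<phi> m0"
    and A: "riesz_operator g \<psi> \<phi> m0 A"
    and f0: "is_arg_min (uncertainty_functional \<psi> \<phi>) (\<lambda>f. f \<in> M2 g m \<and> M2_norm g m0 f = 1) f0"
    and lam: "lam = uncertainty_functional \<psi> \<phi> f0"
  shows "A f0 = (\<lambda>h. of_real (1 / (lam + 1)) * f0 h) \<and>
         largest_eigenvalue_on (M2 g m) A (1 / (lam + 1))"
proof -
  let ?V = "M2 g m"
  have \<psi>: "continuous_on UNIV \<psi>" and \<phi>: "continuous_on UNIV \<phi>" and mP: "m \<in> weights_P"
    using adm by (auto simp: admissible_def m)
  have m0_le: "m0 z \<le> m z" and m0_pos: "m0 z > 0" for z
    using weights_PD(2)[OF m0, of z] by (auto simp: m assoc_weight_def case_prod_unfold intro!: real_le_rsqrt)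
  have \<psi>_le: "norm (\<psi> x) \<le> m (x, \<omega>)" and \<phi>_le: "norm (\<phi> \<omega>) \<le> m (x, \<omega>)" for x \<omega>
    by (auto simp: m assoc_weight_def intro!: real_le_rsqrt)
  note mm[measurable] = borel_measurable_continuous_onI[OF weights_PD(1)[OF mP]]
  note m0m[measurable] = borel_measurable_continuous_onI[OF weights_PD(1)[OF m0]]
  have V: "function_subspace ?V" by (rule M2_subspace[OF g(1) mm])
  let ?J = "\<lambda>T z. of_real (m0 z) * stft g T z"
  have Jm: "?J T \<in> borel_measurable lborel" if "T \<in> ?V" for T
  proof -
    note [measurable] = stft_measurable[OF M2D(1)[OF that] g(1)]
    show ?thesis by measurable
  qed
  have Ji: "integrable lborel (\<lambda>z. (norm (?J T z))\<^sup>2)" if T: "T \<in> ?V" for T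
  proof (rule Bochner_Integration.integrable_bound[OF M2D(2)[OF T]])
    note [measurable] = stft_measurable[OF M2D(1)[OF that] g(1)]
    show "(\<lambda>z. (norm (?J T z))\<^sup>2) \<in> borel_measurable lborel" by measurable
    show "AE z in lborel. norm ((norm (?J T z))\<^sup>2) \<le> norm ((norm (of_real (m z) * stft g T z))\<^sup>2)"
      using m0_le m0_pos by (intro AE_I2) (auto simp: norm_mult less_imp_le intro!: power_mono mult_right_mono order_trans[OF m0_le abs_ge_self])
  qed
  have Ja: "AE z in lborel. ?J (\<lambda>h. S h + T h) z = ?J S z + ?J T z" for S T
    by (simp add: stft_add distrib_left)
  have Js: "AE z in lborel. ?J (\<lambda>h. c * T h) z = c * ?J T z" for T c
    by (simp add: stft_scale)
  have Bform1: "pos_form ?V (\<lambda>u v. LINT z|lborel. ?J u z * cnj (?J v z))"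
    by (rule L2_pos_form(1)[where J="?J", OF _ _ _ _ V]) (erule Jm Ji | rule Ja Js)+
  have Bform2: "Re (LINT z|lborel. ?J T z * cnj (?J T z)) = (LINT z|lborel. (norm (?J T z))\<^sup>2)" if "T \<in> ?V" for T
    by (rule L2_pos_form(2)[where J="?J", OF _ _ _ _ V that]) (erule Jm Ji | rule Ja Js)+
  have Beq: "M2_inner g m0 = (\<lambda>u v. LINT z|lborel. ?J u z * cnj (?J v z))"
    by (simp add: fun_eq_iff M2_inner_def power2_eq_square mult_ac)
  have Psi: "pos_form ?V (\<lambda>S T. LINT x|lborel. (\<psi> x * density_of S x) * cnj (\<psi> x * density_of T x))"
    "T \<in> ?V \<Longrightarrow> Re (LINT x|lborel. (\<psi> x * density_of T x) * cnj (\<psi> x * density_of T x)) = (LINT x|lborel. (norm (\<psi> x * density_of T x))\<^sup>2)" for T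
    using density_pos_form[OF g V \<psi>, of "\<lambda>T. T"] represents_space_density[OF g mP \<psi>_le _ \<psi>] by blast+
  have Phi: "pos_form ?V (\<lambda>S T. LINT x|lborel. (\<phi> x * density_of (dist_fourier S) x) * cnj (\<phi> x * density_of (dist_fourier T) x))"
    "T \<in> ?V \<Longrightarrow> Re (LINT x|lborel. (\<phi> x * density_of (dist_fourier T) x) * cnj (\<phi> x * density_of (dist_fourier T) x)) = (LINT x|lborel. (norm (\<phi> x * density_of (dist_fourier T) x))\<^sup>2)" for T
    using density_pos_form[OF g V \<phi>, of dist_fourier] represents_frequency_density[OF g mP \<phi>_le _ \<phi>]
    by (auto simp: dist_fourier_def fun_eq_iff)
  define F where "F S T = (LINT x|lborel. (\<psi> x * density_of S x) * cnj (\<psi> x * density_of T x)) +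
    (LINT x|lborel. (\<phi> x * density_of (dist_fourier S) x) * cnj (\<phi> x * density_of (dist_fourier T) x))" for S T
  have F: "pos_form ?V F" unfolding F_def[abs_def] by (rule pos_form_add[OF Psi(1) Phi(1)])
  have mixed: "mixed_inner g \<psi> \<phi> m0 u v = M2_inner g m0 u v + F u v" for u v
    unfolding mixed_inner_def F_def by (simp add: complex_norm_square mult_ac del: of_real_power)
  have unc: "uncertainty_functional \<psi> \<phi> T = Re (F T T)" if "T \<in> ?V" for T
    unfolding F_def uncertainty_functional_def using Psi(2)[OF that] Phi(2)[OF that] by simp
  have nrm: "M2_norm g m0 T = 1 \<longleftrightarrow> Re (M2_inner g m0 T T) = 1" if "T \<in> ?V" for T
    unfolding Beq Bform2[OF that] M2_norm_def by simp
  have f0V: "f0 \<in> ?V" "M2_norm g m0 f0 = 1" using f0 by (auto simp: is_arg_min_def)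
  have "A f0 = (\<lambda>h. of_real (1 / (Re (F f0 f0) + 1)) * f0 h) \<and> largest_eigenvalue_on ?V A (1 / (Re (F f0 f0) + 1))"
  proof (rule rayleigh_minimizer[OF V _ F])
    show "pos_form ?V (M2_inner g m0)" unfolding Beq by (rule Bform1)
    show "u = (\<lambda>_. 0)" if u: "u \<in> ?V" and 0: "Re (M2_inner g m0 u u) = 0" for u
    proof (rule stft_injective[OF M2D(1)[OF u] g])
      have "AE z in lborel. (norm (?J u z))\<^sup>2 = 0"
        using 0 unfolding Beq Bform2[OF u] by (subst (asm) integral_nonneg_eq_0_iff_AE[OF Ji[OF u]]) auto
      then show "AE z in lborel. stft g u z = 0"
        by eventually_elim (use m0_pos in \<open>auto simp: less_le\<close>)
    qed
    show "A u \<in> ?V" if "u \<in> ?V" for u using A that by (auto simp: riesz_operator_def bounded_operator_on_def m)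
    show "M2_inner g m0 u v = M2_inner g m0 (A u) v + F (A u) v" if "u \<in> ?V" "v \<in> ?V" for u v
      using A that unfolding riesz_operator_def mixed m[symmetric] by blast
    show "Re (M2_inner g m0 f0 f0) = 1" using nrm[OF f0V(1)] f0V(2) by blast
    show "Re (F f0 f0) \<le> Re (F v v)" if v: "v \<in> ?V" "Re (M2_inner g m0 v v) = 1" for v
      using f0 v nrm[OF v(1)] unc[OF v(1)] unc[OF f0V(1)] unfolding is_arg_min_def by (metis not_le)
  qed (rule f0V(1))
  then show ?thesis unfolding lam unc[OF f0V(1)] .
qed

end
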